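(* Let $k$ be a field and let $G$ be a finite abelian group which splits over $k$. Let $\mathcal{C}$ be a skeletally small $k$-linear additive category which is idempotent complete, with a $k$-linear $G$-action $\{F_g,\varepsilon_{g,h}\mid g,h\in G\}$, and consider the dual $\widehat{G}$-action on $\mathcal{C}^G$. Then the equivariantization homomorphism $$(-)^G\colon {\rm Aut}(\mathcal{C};G)\longrightarrow {\rm Aut}(\mathcal{C}^G;\widehat{G}),\quad [F,\delta]\mapsto [(F,\delta)^G],$$ is an isomorphism of groups.
   Context: All functors are $k$-linear. $G$ splits over $k$ if $kG$ is isomorphic to a product of copies of $k$. $\widehat{G}={\rm Hom}(G,k^* )$. A $G$-action on $\mathcal{C}$ is a family of autoequivalences $F_g$ ($g\in G$) and natural isomorphisms $\varepsilon_{g,h}\colon F_gF_h\to F_{gh}$ with $\varepsilon_{gh,l}\circ\varepsilon_{g,h}F_l=\varepsilon_{g,hl}\circ F_g\varepsilon_{h,l}$ for all $g,h,l$; it is $k$-linear if each $F_g$ is. $\mathcal{C}^G$ is the category of $G$-equivariant objects: pairs $(X,\alpha)$ with isomorphisms $\alpha_g\colon X\to F_g(X)$ satisfying $\alpha_{gh}=(\varepsilon_{g,h})_X\circ F_g(\alpha_h)\circ\alpha_g$; morphisms $f\colon(X,\alpha)\to(Y,\beta)$ are morphisms $f\colon X\to Y$ with $\beta_g\circ f=F_g(f)\circ\alpha_g$. A $G$-equivariant endofunctor $(F,\delta)$ consists of $F\colon\mathcal{C}\to\mathcal{C}$ and natural isomorphisms $\delta_g\colon FF_g\to F_gF$ with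 $\delta_{gh}\circ F\varepsilon_{g,h}=\varepsilon_{g,h}F\circ F_g\delta_h\circ\delta_gF_h$. An isomorphism $(F,\delta)\to(F',\delta')$ is a natural isomorphism $\phi\colon F\to F'$ with $F_g\phi\circ\delta_g=\delta'_g\circ\phi F_g$ for all $g$. Composition: $(F,\delta)(F',\delta')=(FF',(\delta_gF'\circ F\delta'_g)_g)$. ${\rm Aut}(\mathcal{C};G)$ is the group of isoclasses $[F,\delta]$ of $k$-linear $G$-equivariant autoequivalences. The dual action is the strict $\widehat{G}$-action on $\mathcal{C}^G$ (structure isomorphisms are identities) given by $F_\chi(X,\alpha)=(X,(\chi(g^{-1})\alpha_g)_{g\in G})$, identity on morphisms. ${\rm Aut}(\mathcal{C}^G;\widehat{G})$ is defined with respect to it. For a $G$-equivariant autoequivalence $(F,\delta)$, the autoequivalence $(F,\delta)^G$ of $\mathcal{C}^G$ sends $(X,\alpha)$ to $(F(X),((\delta_g)_X\circ F(\alpha_g))_{g})$ and $f$ to $F(f)$. It satisfies $F_\chi(F,\delta)^G=(F,\delta)^GF_\chi$ and is regarded as a $\widehat{G}$-equivariant functor with identity structure isomorphisms. *)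

theory Defs
  imports "HOL-Algebra.Module" "HOL-Algebra.QuotRing"
begin

section \<open>Linear categories\<close>

text \<open>
  A category is given by a set of objects and, for every pair of objects, a set of morphisms.
  The sets of morphisms of different pairs of objects need not be disjoint, so composition and the
  action of functors on morphisms take the objects as arguments: \<open>Comp C X Y Z g f\<close> is the composite
  of \<open>f : X \<rightarrow> Y\<close> and \<open>g : Y \<rightarrow> Z\<close>.  The sets of morphisms are the carriers of records of type
  \<open>module\<close>, of which only the additive group and the scalar multiplication are used; their fields
  \<open>mult\<close> and \<open>one\<close> are irrelevant.

  As the objects form a set of some type, every such category is skeletally small.
\<close>

record ('k, 'o, 'm) lin_cat =
  Obj :: "'o set"
  Hom :: "'o \<Rightarrow> 'o \<Rightarrow> ('k, 'm) module"
  Id :: "'o \<Rightarrow> 'm"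
  Comp :: "'o \<Rightarrow> 'o \<Rightarrow> 'o \<Rightarrow> 'm \<Rightarrow> 'm \<Rightarrow> 'm"

abbreviation Mor :: "('k, 'o, 'm) lin_cat \<Rightarrow> 'o \<Rightarrow> 'o \<Rightarrow> 'm set" where
  "Mor C X Y \<equiv> carrier (Hom C X Y)"

locale category =
  fixes C :: "('k, 'o, 'm) lin_cat"
  assumes Id_closed: "X \<in> Obj C \<Longrightarrow> Id C X \<in> Mor C X X"
    and Comp_closed: "\<lbrakk>X \<in> Obj C; Y \<in> Obj C; Z \<in> Obj C; f \<in> Mor C X Y; g \<in> Mor C Y Z\<rbrakk>
      \<Longrightarrow> Comp C X Y Z g f \<in> Mor C X Z"
    and Comp_assoc: "\<lbrakk>W \<in> Obj C; X \<in> Obj C; Y \<in> Obj C; Z \<in> Obj C;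
        f \<in> Mor C W X; g \<in> Mor C X Y; h \<in> Mor C Y Z\<rbrakk>
      \<Longrightarrow> Comp C W X Z (Comp C X Y Z h g) f = Comp C W Y Z h (Comp C W X Y g f)"
    and Comp_Id_left: "\<lbrakk>X \<in> Obj C; Y \<in> Obj C; f \<in> Mor C X Y\<rbrakk> \<Longrightarrow> Comp C X Y Y (Id C Y) f = f"
    and Comp_Id_right: "\<lbrakk>X \<in> Obj C; Y \<in> Obj C; f \<in> Mor C X Y\<rbrakk> \<Longrightarrow> Comp C X X Y f (Id C X) = f"

locale linear_category = K?: field K + category C
  for K :: "('k, 'e) ring_scheme" (structure) and C :: "('k, 'o, 'm) lin_cat" +
  assumes Hom_module: "\<lbrakk>X \<in> Obj C; Y \<in> Obj C\<rbrakk> \<Longrightarrow> module K (Hom C X Y)"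
    and Comp_add_left: "\<lbrakk>X \<in> Obj C; Y \<in> Obj C; Z \<in> Obj C;
        f \<in> Mor C X Y; g \<in> Mor C Y Z; g' \<in> Mor C Y Z\<rbrakk>
      \<Longrightarrow> Comp C X Y Z (g \<oplus>\<^bsub>Hom C Y Z\<^esub> g') f = Comp C X Y Z g f \<oplus>\<^bsub>Hom C X Z\<^esub> Comp C X Y Z g' f"
    and Comp_add_right: "\<lbrakk>X \<in> Obj C; Y \<in> Obj C; Z \<in> Obj C;
        f \<in> Mor C X Y; f' \<in> Mor C X Y; g \<in> Mor C Y Z\<rbrakk>
      \<Longrightarrow> Comp C X Y Z g (f \<oplus>\<^bsub>Hom C X Y\<^esub> f') = Comp C X Y Z g f \<oplus>\<^bsub>Hom C X Z\<^esub> Comp C X Y Z g f'"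
    and Comp_smult_left: "\<lbrakk>X \<in> Obj C; Y \<in> Obj C; Z \<in> Obj C;
        c \<in> carrier K; f \<in> Mor C X Y; g \<in> Mor C Y Z\<rbrakk>
      \<Longrightarrow> Comp C X Y Z (c \<odot>\<^bsub>Hom C Y Z\<^esub> g) f = c \<odot>\<^bsub>Hom C X Z\<^esub> Comp C X Y Z g f"
    and Comp_smult_right: "\<lbrakk>X \<in> Obj C; Y \<in> Obj C; Z \<in> Obj C;
        c \<in> carrier K; f \<in> Mor C X Y; g \<in> Mor C Y Z\<rbrakk>
      \<Longrightarrow> Comp C X Y Z g (c \<odot>\<^bsub>Hom C X Y\<^esub> f) = c \<odot>\<^bsub>Hom C X Z\<^esub> Comp C X Y Z g f"

definition is_iso :: "('k, 'o, 'm) lin_cat \<Rightarrow> 'o \<Rightarrow> 'o \<Rightarrow> 'm \<Rightarrow> bool" where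
  "is_iso C X Y f \<longleftrightarrow> f \<in> Mor C X Y \<and>
     (\<exists>g \<in> Mor C Y X. Comp C X Y X g f = Id C X \<and> Comp C Y X Y f g = Id C Y)"

definition zero_object :: "('k, 'o, 'm) lin_cat \<Rightarrow> 'o \<Rightarrow> bool" where
  "zero_object C Z \<longleftrightarrow> Z \<in> Obj C \<and>
     (\<forall>X \<in> Obj C. (\<exists>!f. f \<in> Mor C Z X) \<and> (\<exists>!f. f \<in> Mor C X Z))"

definition biproduct :: "('k, 'o, 'm) lin_cat \<Rightarrow> 'o \<Rightarrow> 'o \<Rightarrow> 'o \<Rightarrow> 'm \<Rightarrow> 'm \<Rightarrow> 'm \<Rightarrow> 'm \<Rightarrow> bool" where
  "biproduct C X Y B i j p q \<longleftrightarrow>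
     B \<in> Obj C \<and> i \<in> Mor C X B \<and> j \<in> Mor C Y B \<and> p \<in> Mor C B X \<and> q \<in> Mor C B Y \<and>
     Comp C X B X p i = Id C X \<and> Comp C Y B Y q j = Id C Y \<and>
     Comp C Y B X p j = \<zero>\<^bsub>Hom C Y X\<^esub> \<and> Comp C X B Y q i = \<zero>\<^bsub>Hom C X Y\<^esub> \<and>
     Comp C B X B i p \<oplus>\<^bsub>Hom C B B\<^esub> Comp C B Y B j q = Id C B"

locale additive_linear_category = linear_category +
  assumes zero_object_exists: "\<exists>Z. zero_object C Z"
    and biproduct_exists: "\<lbrakk>X \<in> Obj C; Y \<in> Obj C\<rbrakk> \<Longrightarrow> \<exists>B i j p q. biproduct C X Y B i j p q"

definition idempotent_complete :: "('k, 'o, 'm) lin_cat \<Rightarrow> bool" where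
  "idempotent_complete C \<longleftrightarrow>
     (\<forall>X \<in> Obj C. \<forall>e \<in> Mor C X X. Comp C X X X e e = e \<longrightarrow>
        (\<exists>Y \<in> Obj C. \<exists>p \<in> Mor C X Y. \<exists>i \<in> Mor C Y X.
           Comp C X Y X i p = e \<and> Comp C Y X Y p i = Id C Y))"


section \<open>Functors\<close>

record ('o, 'm, 'p, 'n) fctr =
  fob :: "'o \<Rightarrow> 'p"
  fmor :: "'o \<Rightarrow> 'o \<Rightarrow> 'm \<Rightarrow> 'n"

definition is_functor ::
  "('k, 'o, 'm) lin_cat \<Rightarrow> ('l, 'p, 'n) lin_cat \<Rightarrow> ('o, 'm, 'p, 'n) fctr \<Rightarrow> bool" where
  "is_functor C D F \<longleftrightarrow>
     (\<forall>X \<in> Obj C. fob F X \<in> Obj D) \<and>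
     (\<forall>X \<in> Obj C. \<forall>Y \<in> Obj C. \<forall>f \<in> Mor C X Y. fmor F X Y f \<in> Mor D (fob F X) (fob F Y)) \<and>
     (\<forall>X \<in> Obj C. fmor F X X (Id C X) = Id D (fob F X)) \<and>
     (\<forall>X \<in> Obj C. \<forall>Y \<in> Obj C. \<forall>Z \<in> Obj C. \<forall>f \<in> Mor C X Y. \<forall>g \<in> Mor C Y Z.
        fmor F X Z (Comp C X Y Z g f) =
          Comp D (fob F X) (fob F Y) (fob F Z) (fmor F Y Z g) (fmor F X Y f))"

definition linear_functor ::
  "('k, 'e) ring_scheme \<Rightarrow> ('k, 'o, 'm) lin_cat \<Rightarrow> ('k, 'p, 'n) lin_cat \<Rightarrow>
    ('o, 'm, 'p, 'n) fctr \<Rightarrow> bool" where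
  "linear_functor K C D F \<longleftrightarrow> is_functor C D F \<and>
     (\<forall>X \<in> Obj C. \<forall>Y \<in> Obj C. \<forall>f \<in> Mor C X Y.
        (\<forall>g \<in> Mor C X Y. fmor F X Y (f \<oplus>\<^bsub>Hom C X Y\<^esub> g) =
           fmor F X Y f \<oplus>\<^bsub>Hom D (fob F X) (fob F Y)\<^esub> fmor F X Y g) \<and>
        (\<forall>c \<in> carrier K. fmor F X Y (c \<odot>\<^bsub>Hom C X Y\<^esub> f) =
           c \<odot>\<^bsub>Hom D (fob F X) (fob F Y)\<^esub> fmor F X Y f))"

definition id_fctr :: "('o, 'm, 'o, 'm) fctr" where
  "id_fctr = \<lparr>fob = (\<lambda>X. X), fmor = (\<lambda>X Y f. f)\<rparr>"

definition comp_fctr ::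
  "('p, 'n, 'q, 'l) fctr \<Rightarrow> ('o, 'm, 'p, 'n) fctr \<Rightarrow> ('o, 'm, 'q, 'l) fctr"
  (infixl \<open>\<circ>\<^sub>F\<close> 55) where
  "F \<circ>\<^sub>F F' = \<lparr>fob = (\<lambda>X. fob F (fob F' X)),
    fmor = (\<lambda>X Y f. fmor F (fob F' X) (fob F' Y) (fmor F' X Y f))\<rparr>"

definition natural_iso ::
  "('k, 'o, 'm) lin_cat \<Rightarrow> ('l, 'p, 'n) lin_cat \<Rightarrow> ('o, 'm, 'p, 'n) fctr \<Rightarrow>
    ('o, 'm, 'p, 'n) fctr \<Rightarrow> ('o \<Rightarrow> 'n) \<Rightarrow> bool" where
  "natural_iso C D F F' \<phi> \<longleftrightarrow>
     (\<forall>X \<in> Obj C. is_iso D (fob F X) (fob F' X) (\<phi> X)) \<and>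
     (\<forall>X \<in> Obj C. \<forall>Y \<in> Obj C. \<forall>f \<in> Mor C X Y.
        Comp D (fob F X) (fob F Y) (fob F' Y) (\<phi> Y) (fmor F X Y f) =
        Comp D (fob F X) (fob F' X) (fob F' Y) (fmor F' X Y f) (\<phi> X))"

definition autoequivalence :: "('k, 'o, 'm) lin_cat \<Rightarrow> ('o, 'm, 'o, 'm) fctr \<Rightarrow> bool" where
  "autoequivalence C F \<longleftrightarrow> is_functor C C F \<and>
     (\<exists>F' \<phi> \<psi>. is_functor C C F' \<and> natural_iso C C (F' \<circ>\<^sub>F F) id_fctr \<phi> \<and>
        natural_iso C C (F \<circ>\<^sub>F F') id_fctr \<psi>)"


section \<open>Group actions and equivariant objects\<close>

record ('g, 'o, 'm) cat_action =
  act :: "'g \<Rightarrow> ('o, 'm, 'o, 'm) fctr"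
  str :: "'g \<Rightarrow> 'g \<Rightarrow> 'o \<Rightarrow> 'm"  \<comment> \<open>the isomorphisms \<open>\<epsilon>\<close>\<close>

definition is_action ::
  "('k, 'o, 'm) lin_cat \<Rightarrow> ('g, 'f) monoid_scheme \<Rightarrow> ('g, 'o, 'm) cat_action \<Rightarrow> bool" where
  "is_action C G A \<longleftrightarrow>
     (\<forall>g \<in> carrier G. autoequivalence C (act A g)) \<and>
     (\<forall>g \<in> carrier G. \<forall>h \<in> carrier G.
        natural_iso C C (act A g \<circ>\<^sub>F act A h) (act A (g \<otimes>\<^bsub>G\<^esub> h)) (str A g h)) \<and>
     (\<forall>g \<in> carrier G. \<forall>h \<in> carrier G. \<forall>l \<in> carrier G. \<forall>X \<in> Obj C.
        (let S = fob (act A g) (fob (act A h) (fob (act A l) X));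
             T = fob (act A (g \<otimes>\<^bsub>G\<^esub> h \<otimes>\<^bsub>G\<^esub> l)) X
         in Comp C S (fob (act A (g \<otimes>\<^bsub>G\<^esub> h)) (fob (act A l) X)) T
              (str A (g \<otimes>\<^bsub>G\<^esub> h) l X) (str A g h (fob (act A l) X)) =
            Comp C S (fob (act A g) (fob (act A (h \<otimes>\<^bsub>G\<^esub> l)) X)) T
              (str A g (h \<otimes>\<^bsub>G\<^esub> l) X)
              (fmor (act A g) (fob (act A h) (fob (act A l) X)) (fob (act A (h \<otimes>\<^bsub>G\<^esub> l)) X)
                (str A h l X))))"

definition linear_action ::
  "('k, 'e) ring_scheme \<Rightarrow> ('k, 'o, 'm) lin_cat \<Rightarrow> ('g, 'f) monoid_scheme \<Rightarrow>
    ('g, 'o, 'm) cat_action \<Rightarrow> bool" where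
  "linear_action K C G A \<longleftrightarrow> is_action C G A \<and> (\<forall>g \<in> carrier G. linear_functor K C C (act A g))"

text \<open>
  Families indexed by the group are required to be \<^const>\<open>extensional\<close>, so that the objects of the
  equivariantization are determined by their values on the group.
\<close>

definition equivariant_object ::
  "('k, 'o, 'm) lin_cat \<Rightarrow> ('g, 'f) monoid_scheme \<Rightarrow> ('g, 'o, 'm) cat_action \<Rightarrow>
    'o \<times> ('g \<Rightarrow> 'm) \<Rightarrow> bool" where
  "equivariant_object C G A = (\<lambda>(X, \<alpha>).
     X \<in> Obj C \<and> \<alpha> \<in> extensional (carrier G) \<and>
     (\<forall>g \<in> carrier G. is_iso C X (fob (act A g) X) (\<alpha> g)) \<and>
     (\<forall>g \<in> carrier G. \<forall>h \<in> carrier G.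
        \<alpha> (g \<otimes>\<^bsub>G\<^esub> h) =
          Comp C X (fob (act A g) (fob (act A h) X)) (fob (act A (g \<otimes>\<^bsub>G\<^esub> h)) X)
            (str A g h X)
            (Comp C X (fob (act A g) X) (fob (act A g) (fob (act A h) X))
              (fmor (act A g) X (fob (act A h) X) (\<alpha> h)) (\<alpha> g))))"

definition equivariantization ::
  "('k, 'o, 'm) lin_cat \<Rightarrow> ('g, 'f) monoid_scheme \<Rightarrow> ('g, 'o, 'm) cat_action \<Rightarrow>
    ('k, 'o \<times> ('g \<Rightarrow> 'm), 'm) lin_cat" where
  "equivariantization C G A =
     \<lparr>Obj = {P. equivariant_object C G A P},
      Hom = (\<lambda>(X, \<alpha>) (Y, \<beta>). (Hom C X Y)\<lparr>carrier :=
        {f \<in> Mor C X Y. \<forall>g \<in> carrier G.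
           Comp C X Y (fob (act A g) Y) (\<beta> g) f =
           Comp C X (fob (act A g) X) (fob (act A g) Y) (fmor (act A g) X Y f) (\<alpha> g)}\<rparr>),
      Id = (\<lambda>(X, \<alpha>). Id C X),
      Comp = (\<lambda>(X, \<alpha>) (Y, \<beta>) (Z, \<gamma>). Comp C X Y Z)\<rparr>"


section \<open>Equivariant functors\<close>

text \<open>An equivariant endofunctor is a pair \<open>(F, \<delta>)\<close>.\<close>

type_synonym ('g, 'o, 'm) eq_fctr = "('o, 'm, 'o, 'm) fctr \<times> ('g \<Rightarrow> 'o \<Rightarrow> 'm)"

definition equivariant_functor ::
  "('k, 'o, 'm) lin_cat \<Rightarrow> ('g, 'f) monoid_scheme \<Rightarrow> ('g, 'o, 'm) cat_action \<Rightarrow>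
    ('g, 'o, 'm) eq_fctr \<Rightarrow> bool" where
  "equivariant_functor C G A = (\<lambda>(F, \<delta>).
     is_functor C C F \<and>
     (\<forall>g \<in> carrier G. natural_iso C C (F \<circ>\<^sub>F act A g) (act A g \<circ>\<^sub>F F) (\<delta> g)) \<and>
     (\<forall>g \<in> carrier G. \<forall>h \<in> carrier G. \<forall>X \<in> Obj C.
        (let S = fob F (fob (act A g) (fob (act A h) X));
             T = fob (act A (g \<otimes>\<^bsub>G\<^esub> h)) (fob F X)
         in Comp C S (fob F (fob (act A (g \<otimes>\<^bsub>G\<^esub> h)) X)) T
              (\<delta> (g \<otimes>\<^bsub>G\<^esub> h) X)
              (fmor F (fob (act A g) (fob (act A h) X)) (fob (act A (g \<otimes>\<^bsub>G\<^esub> h)) X) (str A g h X)) =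
            Comp C S (fob (act A g) (fob (act A h) (fob F X))) T
              (str A g h (fob F X))
              (Comp C S (fob (act A g) (fob F (fob (act A h) X)))
                (fob (act A g) (fob (act A h) (fob F X)))
                (fmor (act A g) (fob F (fob (act A h) X)) (fob (act A h) (fob F X)) (\<delta> h X))
                (\<delta> g (fob (act A h) X))))))"

definition equivariant_iso ::
  "('k, 'o, 'm) lin_cat \<Rightarrow> ('g, 'f) monoid_scheme \<Rightarrow> ('g, 'o, 'm) cat_action \<Rightarrow>
    ('g, 'o, 'm) eq_fctr \<Rightarrow> ('g, 'o, 'm) eq_fctr \<Rightarrow> bool" where
  "equivariant_iso C G A = (\<lambda>(F, \<delta>) (F', \<delta>'). \<exists>\<phi>.
     natural_iso C C F F' \<phi> \<and>
     (\<forall>g \<in> carrier G. \<forall>X \<in> Obj C.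
        Comp C (fob F (fob (act A g) X)) (fob (act A g) (fob F X)) (fob (act A g) (fob F' X))
          (fmor (act A g) (fob F X) (fob F' X) (\<phi> X)) (\<delta> g X) =
        Comp C (fob F (fob (act A g) X)) (fob F' (fob (act A g) X)) (fob (act A g) (fob F' X))
          (\<delta>' g X) (\<phi> (fob (act A g) X))))"

definition eq_id ::
  "('k, 'o, 'm) lin_cat \<Rightarrow> ('g, 'o, 'm) cat_action \<Rightarrow> ('g, 'o, 'm) eq_fctr" where
  "eq_id C A = (id_fctr, \<lambda>g X. Id C (fob (act A g) X))"

definition eq_comp ::
  "('k, 'o, 'm) lin_cat \<Rightarrow> ('g, 'o, 'm) cat_action \<Rightarrow>
    ('g, 'o, 'm) eq_fctr \<Rightarrow> ('g, 'o, 'm) eq_fctr \<Rightarrow> ('g, 'o, 'm) eq_fctr" where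
  "eq_comp C A = (\<lambda>(F, \<delta>) (F', \<delta>').
     (F \<circ>\<^sub>F F',
      \<lambda>g X. Comp C (fob F (fob F' (fob (act A g) X))) (fob F (fob (act A g) (fob F' X)))
              (fob (act A g) (fob F (fob F' X)))
              (\<delta> g (fob F' X))
              (fmor F (fob F' (fob (act A g) X)) (fob (act A g) (fob F' X)) (\<delta>' g X))))"

definition eq_autoequivalences ::
  "('k, 'e) ring_scheme \<Rightarrow> ('k, 'o, 'm) lin_cat \<Rightarrow> ('g, 'f) monoid_scheme \<Rightarrow>
    ('g, 'o, 'm) cat_action \<Rightarrow> ('g, 'o, 'm) eq_fctr set" where
  "eq_autoequivalences K C G A =
     {p. equivariant_functor C G A p \<and> linear_functor K C C (fst p) \<and> autoequivalence C (fst p)}"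

definition eq_iso_rel ::
  "('k, 'e) ring_scheme \<Rightarrow> ('k, 'o, 'm) lin_cat \<Rightarrow> ('g, 'f) monoid_scheme \<Rightarrow>
    ('g, 'o, 'm) cat_action \<Rightarrow> ('g, 'o, 'm) eq_fctr rel" where
  "eq_iso_rel K C G A =
     {(p, q). p \<in> eq_autoequivalences K C G A \<and> q \<in> eq_autoequivalences K C G A \<and>
        equivariant_iso C G A p q}"

abbreviation eq_class ::
  "('k, 'e) ring_scheme \<Rightarrow> ('k, 'o, 'm) lin_cat \<Rightarrow> ('g, 'f) monoid_scheme \<Rightarrow>
    ('g, 'o, 'm) cat_action \<Rightarrow> ('g, 'o, 'm) eq_fctr \<Rightarrow> ('g, 'o, 'm) eq_fctr set" where
  "eq_class K C G A p \<equiv> eq_iso_rel K C G A `` {p}"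

definition Aut ::
  "('k, 'e) ring_scheme \<Rightarrow> ('k, 'o, 'm) lin_cat \<Rightarrow> ('g, 'f) monoid_scheme \<Rightarrow>
    ('g, 'o, 'm) cat_action \<Rightarrow> ('g, 'o, 'm) eq_fctr set monoid" where
  "Aut K C G A =
     \<lparr>carrier = eq_autoequivalences K C G A // eq_iso_rel K C G A,
      monoid.mult = (\<lambda>a b. \<Union>p \<in> a. \<Union>q \<in> b. eq_class K C G A (eq_comp C A p q)),
      one = eq_class K C G A (eq_id C A)\<rparr>"


section \<open>Groups that split over a field and the dual action\<close>

definition group_algebra ::
  "('k, 'e) ring_scheme \<Rightarrow> ('g, 'f) monoid_scheme \<Rightarrow> ('k, 'g \<Rightarrow> 'k) module" where
  "group_algebra K G =
     \<lparr>carrier = carrier G \<rightarrow>\<^sub>E carrier K,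
      monoid.mult = (\<lambda>a b. \<lambda>g \<in> carrier G.
        \<Oplus>\<^bsub>K\<^esub>h \<in> carrier G. a h \<otimes>\<^bsub>K\<^esub> b (inv\<^bsub>G\<^esub> h \<otimes>\<^bsub>G\<^esub> g)),
      one = (\<lambda>g \<in> carrier G. if g = \<one>\<^bsub>G\<^esub> then \<one>\<^bsub>K\<^esub> else \<zero>\<^bsub>K\<^esub>),
      zero = (\<lambda>g \<in> carrier G. \<zero>\<^bsub>K\<^esub>),
      add = (\<lambda>a b. \<lambda>g \<in> carrier G. a g \<oplus>\<^bsub>K\<^esub> b g),
      smult = (\<lambda>c a. \<lambda>g \<in> carrier G. c \<otimes>\<^bsub>K\<^esub> a g)\<rparr>"

definition power_algebra :: "('k, 'e) ring_scheme \<Rightarrow> nat \<Rightarrow> ('k, nat \<Rightarrow> 'k) module" where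
  "power_algebra K n =
     \<lparr>carrier = {..<n} \<rightarrow>\<^sub>E carrier K,
      monoid.mult = (\<lambda>a b. \<lambda>i \<in> {..<n}. a i \<otimes>\<^bsub>K\<^esub> b i),
      one = (\<lambda>i \<in> {..<n}. \<one>\<^bsub>K\<^esub>),
      zero = (\<lambda>i \<in> {..<n}. \<zero>\<^bsub>K\<^esub>),
      add = (\<lambda>a b. \<lambda>i \<in> {..<n}. a i \<oplus>\<^bsub>K\<^esub> b i),
      smult = (\<lambda>c a. \<lambda>i \<in> {..<n}. c \<otimes>\<^bsub>K\<^esub> a i)\<rparr>"

definition splits_over :: "('k, 'e) ring_scheme \<Rightarrow> ('g, 'f) monoid_scheme \<Rightarrow> bool" where
  "splits_over K G \<longleftrightarrow>
     (\<exists>n. \<exists>\<Phi> \<in> ring_iso (group_algebra K G) (power_algebra K n).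
        \<forall>c \<in> carrier K. \<forall>a \<in> carrier (group_algebra K G).
          \<Phi> (c \<odot>\<^bsub>group_algebra K G\<^esub> a) = c \<odot>\<^bsub>power_algebra K n\<^esub> \<Phi> a)"

definition dual_group ::
  "('k, 'e) ring_scheme \<Rightarrow> ('g, 'f) monoid_scheme \<Rightarrow> ('g \<Rightarrow> 'k) monoid" where
  "dual_group K G =
     \<lparr>carrier = hom G (units_of K) \<inter> extensional (carrier G),
      monoid.mult = (\<lambda>\<chi> \<psi>. \<lambda>g \<in> carrier G. \<chi> g \<otimes>\<^bsub>K\<^esub> \<psi> g),
      one = (\<lambda>g \<in> carrier G. \<one>\<^bsub>K\<^esub>)\<rparr>"

definition dual_fctr ::
  "('k, 'o, 'm) lin_cat \<Rightarrow> ('g, 'f) monoid_scheme \<Rightarrow> ('g, 'o, 'm) cat_action \<Rightarrow> ('g \<Rightarrow> 'k) \<Rightarrow>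
    ('o \<times> ('g \<Rightarrow> 'm), 'm, 'o \<times> ('g \<Rightarrow> 'm), 'm) fctr" where
  "dual_fctr C G A \<chi> =
     \<lparr>fob = (\<lambda>(X, \<alpha>).
        (X, \<lambda>g \<in> carrier G. \<chi> (inv\<^bsub>G\<^esub> g) \<odot>\<^bsub>Hom C X (fob (act A g) X)\<^esub> \<alpha> g)),
      fmor = (\<lambda>P Q f. f)\<rparr>"

definition dual_action ::
  "('k, 'e) ring_scheme \<Rightarrow> ('k, 'o, 'm) lin_cat \<Rightarrow> ('g, 'f) monoid_scheme \<Rightarrow>
    ('g, 'o, 'm) cat_action \<Rightarrow> ('g \<Rightarrow> 'k, 'o \<times> ('g \<Rightarrow> 'm), 'm) cat_action" where
  "dual_action K C G A =
     \<lparr>act = dual_fctr C G A,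
      str = (\<lambda>\<chi> \<psi> P. Id (equivariantization C G A)
        (fob (dual_fctr C G A (\<chi> \<otimes>\<^bsub>dual_group K G\<^esub> \<psi>)) P))\<rparr>"


section \<open>The equivariantization homomorphism\<close>

definition eq_fctr_lift ::
  "('k, 'o, 'm) lin_cat \<Rightarrow> ('g, 'f) monoid_scheme \<Rightarrow> ('g, 'o, 'm) cat_action \<Rightarrow>
    ('g, 'o, 'm) eq_fctr \<Rightarrow> ('o \<times> ('g \<Rightarrow> 'm), 'm, 'o \<times> ('g \<Rightarrow> 'm), 'm) fctr" where
  "eq_fctr_lift C G A = (\<lambda>(F, \<delta>).
     \<lparr>fob = (\<lambda>(X, \<alpha>).
        (fob F X,
         \<lambda>g \<in> carrier G.
           Comp C (fob F X) (fob F (fob (act A g) X)) (fob (act A g) (fob F X))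
             (\<delta> g X) (fmor F X (fob (act A g) X) (\<alpha> g)))),
      fmor = (\<lambda>(X, \<alpha>) (Y, \<beta>) f. fmor F X Y f)\<rparr>)"

text \<open>
  The lifted functor commutes strictly with the dual action and is made equivariant by identities.
\<close>

definition eq_lift ::
  "('k, 'o, 'm) lin_cat \<Rightarrow> ('g, 'f) monoid_scheme \<Rightarrow> ('g, 'o, 'm) cat_action \<Rightarrow>
    ('g, 'o, 'm) eq_fctr \<Rightarrow> ('g \<Rightarrow> 'k, 'o \<times> ('g \<Rightarrow> 'm), 'm) eq_fctr" where
  "eq_lift C G A p =
     (eq_fctr_lift C G A p,
      \<lambda>\<chi> P. Id (equivariantization C G A) (fob (dual_fctr C G A \<chi>) (fob (eq_fctr_lift C G A p) P)))"

definition equivariantization_hom ::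
  "('k, 'e) ring_scheme \<Rightarrow> ('k, 'o, 'm) lin_cat \<Rightarrow> ('g, 'f) monoid_scheme \<Rightarrow>
    ('g, 'o, 'm) cat_action \<Rightarrow> ('g, 'o, 'm) eq_fctr set \<Rightarrow>
    ('g \<Rightarrow> 'k, 'o \<times> ('g \<Rightarrow> 'm), 'm) eq_fctr set" where
  "equivariantization_hom K C G A a =
     (\<Union>p \<in> a. eq_class K (equivariantization C G A) (dual_group K G) (dual_action K C G A)
        (eq_lift C G A p))"

end

theory Submission
  imports Defs
begin

text \<open>
  Let \<open>D = C\<^sup>G\<close>, let \<open>U : D \<rightarrow> C\<close> be the forgetful functor, and write \<open>F\<^sub>g\<close> and \<open>F\<^sub>\<chi>\<close> for the functors of
  the action and of the dual action; in formulas these are \<open>T g\<close> and \<open>S \<chi>\<close>.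

  The proof rests on two facts. First, the dual action on \<open>D\<close> knows all morphisms of \<open>C\<close> between
  underlying objects. The group acts on \<open>Hom\<^sub>C(U P, U Q)\<close>, by conjugating \<open>F\<^sub>g f\<close> with the
  structure isomorphisms of \<open>P\<close> and \<open>Q\<close>; as \<open>kG\<close> is a product of copies of \<open>k\<close>, this space is the
  direct sum of its isotypic parts; and the part of the character \<open>\<chi>\<close> is \<open>Hom\<^sub>D(P, F\<^sub>\<chi> Q)\<close>. So a
  linear identity between morphisms \<open>U P \<rightarrow> U Q\<close> of \<open>C\<close> can be checked on morphisms \<open>P \<rightarrow> F\<^sub>\<chi> Q\<close> of
  \<open>D\<close> (lemma \<open>homogeneous_ext\<close>). Second, every object of \<open>C\<close> is a retract of some \<open>U P\<close>, with \<open>P\<close>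
  an induced object \<open>\<Oplus>\<^sub>g F\<^sub>g Y\<close> (lemma \<open>retract_exists\<close>). Hence natural transformations between
  endofunctors of \<open>C\<close> extend uniquely from the objects \<open>U P\<close> (lemmas \<open>natural_ext\<close> and \<open>extend\<close>).

  Injectivity: an isomorphism \<open>\<theta>\<close> of lifted functors that is compatible with the dual action
  satisfies \<open>\<theta>\<^bsub>F\<^sub>\<chi> P\<^esub> = \<theta>\<^sub>P\<close>, so it is natural for the morphisms \<open>P \<rightarrow> F\<^sub>\<chi> Q\<close>, hence for all
  morphisms \<open>U P \<rightarrow> U Q\<close> of \<open>C\<close>, and extends to \<open>C\<close> (lemma \<open>elift_reflects_isomorphic\<close>).

  Surjectivity: an equivariant endofunctor \<open>(H, \<delta>)\<close> of \<open>D\<close> extends to all morphisms \<open>f : U P \<rightarrow> U Q\<close>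
  by the formula \<open>\<Sum>\<^sub>\<chi> \<delta>\<^sub>\<chi> \<circ> H f\<^sub>\<chi>\<close>, where \<open>f\<^sub>\<chi> : P \<rightarrow> F\<^sub>\<chi> Q\<close> is the isotypic component. If
  \<open>X\<close> is a retract of \<open>U P\<close>, the extension maps the idempotent of \<open>U P\<close> belonging to \<open>X\<close> to an
  idempotent of \<open>U H P\<close>, whose image is the value at \<open>X\<close> of a functor \<open>F\<close> on \<open>C\<close> with
  \<open>F U \<cong> U H\<close>. This isomorphism dictates the equivariant structure of \<open>F\<close> (lemma \<open>elift_descent\<close>).

  Both arguments apply to all linear equivariant endofunctors. Lifting is therefore an
  isomorphism between the monoids of isomorphism classes of linear equivariant endofunctors, and
  the groups of the theorem are the groups of units of these monoids.
\<close>


section \<open>Arrows\<close>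

text \<open>
  An arrow carries its domain and codomain. Composition becomes a binary operation and applying a
  functor a unary one, so that diagrams can be chased by rewriting; the side conditions are
  equations between domains and codomains.
\<close>

datatype ('o, 'm) arrow = Arrow (dm: 'o) (cd: 'o) (mp: 'm)

definition arr :: "('k, 'o, 'm) lin_cat \<Rightarrow> ('o, 'm) arrow \<Rightarrow> bool" where
  "arr C a \<longleftrightarrow> dm a \<in> Obj C \<and> cd a \<in> Obj C \<and> mp a \<in> Mor C (dm a) (cd a)"

definition cmp :: "('k, 'o, 'm) lin_cat \<Rightarrow> ('o, 'm) arrow \<Rightarrow> ('o, 'm) arrow \<Rightarrow> ('o, 'm) arrow" where
  "cmp C b a = Arrow (dm a) (cd b) (Comp C (dm a) (cd a) (cd b) (mp b) (mp a))"

definition ida :: "('k, 'o, 'm) lin_cat \<Rightarrow> 'o \<Rightarrow> ('o, 'm) arrow" where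
  "ida C X = Arrow X X (Id C X)"

definition inverse_arrows :: "('k, 'o, 'm) lin_cat \<Rightarrow> ('o, 'm) arrow \<Rightarrow> ('o, 'm) arrow \<Rightarrow> bool" where
  "inverse_arrows C a b \<longleftrightarrow> arr C a \<and> arr C b \<and> dm b = cd a \<and> cd b = dm a \<and>
     cmp C b a = ida C (dm a) \<and> cmp C a b = ida C (cd a)"

definition iso_arr :: "('k, 'o, 'm) lin_cat \<Rightarrow> ('o, 'm) arrow \<Rightarrow> bool" where
  "iso_arr C a \<longleftrightarrow> (\<exists>b. inverse_arrows C a b)"

definition inva :: "('k, 'o, 'm) lin_cat \<Rightarrow> ('o, 'm) arrow \<Rightarrow> ('o, 'm) arrow" where
  "inva C a = (SOME b. inverse_arrows C a b)"

definition fap :: "('o, 'm, 'p, 'n) fctr \<Rightarrow> ('o, 'm) arrow \<Rightarrow> ('p, 'n) arrow"  (infixr \<open>\<star>\<close> 80) where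
  "F \<star> a = Arrow (fob F (dm a)) (fob F (cd a)) (fmor F (dm a) (cd a) (mp a))"

lemma cmp_sel [simp]: "dm (cmp C b a) = dm a" "cd (cmp C b a) = cd b"
  by (simp_all add: cmp_def)

lemma ida_sel [simp]: "dm (ida C X) = X" "cd (ida C X) = X"
  by (simp_all add: ida_def)

lemma fap_sel [simp]: "dm (F \<star> a) = fob F (dm a)" "cd (F \<star> a) = fob F (cd a)"
  by (simp_all add: fap_def)

lemma fob_comp [simp]: "fob (F \<circ>\<^sub>F F') X = fob F (fob F' X)"
  by (simp add: comp_fctr_def)

lemma fap_comp [simp]: "(F \<circ>\<^sub>F F') \<star> a = F \<star> F' \<star> a"
  by (simp add: comp_fctr_def fap_def)

lemma fob_id [simp]: "fob id_fctr X = X"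
  by (simp add: id_fctr_def)

lemma fap_id [simp]: "id_fctr \<star> a = a"
  by (simp add: id_fctr_def fap_def)

lemma arr_obj [simp]: "arr C a \<Longrightarrow> dm a \<in> Obj C" "arr C a \<Longrightarrow> cd a \<in> Obj C"
  by (simp_all add: arr_def)

context category begin

abbreviation cmp_C (infixr \<open>\<cdot>\<close> 70) where "b \<cdot> a \<equiv> cmp C b a"
abbreviation "functor F \<equiv> is_functor C C F"
abbreviation "invertible \<equiv> iso_arr C"
abbreviation "arrow \<equiv> arr C"
abbreviation "ide \<equiv> ida C"
abbreviation "inv_arr \<equiv> inva C"

lemma arr_cmp [simp]: "arrow a \<Longrightarrow> arrow b \<Longrightarrow> cd a = dm b \<Longrightarrow> arrow (b \<cdot> a)"
  by (simp add: arr_def cmp_def Comp_closed del: arr_obj)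

lemma arr_ide [simp]: "X \<in> Obj C \<Longrightarrow> arrow (ide X)"
  by (simp add: arr_def ida_def Id_closed del: arr_obj)

lemma cmp_assoc: "\<lbrakk>arrow a; arrow b; arrow c; cd a = dm b; cd b = dm c\<rbrakk>
    \<Longrightarrow> (c \<cdot> b) \<cdot> a = c \<cdot> b \<cdot> a"
  by (simp add: arr_def cmp_def Comp_assoc del: arr_obj)

lemma cmp_ide_left [simp]: "arrow a \<Longrightarrow> cd a = X \<Longrightarrow> ide X \<cdot> a = a"
  by (cases a) (auto simp: arr_def cmp_def ida_def Comp_Id_left simp del: arr_obj)

lemma cmp_ide_right [simp]: "arrow a \<Longrightarrow> dm a = X \<Longrightarrow> a \<cdot> ide X = a"
  by (cases a) (auto simp: arr_def cmp_def ida_def Comp_Id_right simp del: arr_obj)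

lemma inverse_arrows_unique: "inverse_arrows C a b \<Longrightarrow> inverse_arrows C a b' \<Longrightarrow> b = b'"
  unfolding inverse_arrows_def by (metis cmp_assoc cmp_ide_left cmp_ide_right)

lemma inverse_arrows_inv: "invertible a \<Longrightarrow> inverse_arrows C a (inv_arr a)"
  unfolding iso_arr_def inva_def by (rule someI_ex)

lemma inva_eqI: "inverse_arrows C a b \<Longrightarrow> inv_arr a = b"
  using inverse_arrows_unique inverse_arrows_inv iso_arr_def by metis

lemma isoI: "\<lbrakk>arrow a; arrow b; dm b = cd a; cd b = dm a; b \<cdot> a = ide (dm a); a \<cdot> b = ide (cd a)\<rbrakk> \<Longrightarrow> invertible a"
  unfolding iso_arr_def inverse_arrows_def by blast

lemma iso_arr [simp]: "invertible a \<Longrightarrow> arrow a"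
  by (auto simp: iso_arr_def inverse_arrows_def simp del: arr_obj)

lemma inva_simps [simp]:
  assumes "invertible a"
  shows "arrow (inv_arr a)" "dm (inv_arr a) = cd a" "cd (inv_arr a) = dm a"
    "inv_arr a \<cdot> a = ide (dm a)" "a \<cdot> inv_arr a = ide (cd a)"
  using inverse_arrows_inv[OF assms] by (auto simp: inverse_arrows_def)

lemma inva_cancel [simp]:
  assumes "invertible a" "arrow x"
  shows "cd x = dm a \<Longrightarrow> inv_arr a \<cdot> a \<cdot> x = x" "cd x = cd a \<Longrightarrow> a \<cdot> inv_arr a \<cdot> x = x"
  using assms by (simp_all add: cmp_assoc[symmetric])

lemma iso_inva [simp]: "invertible a \<Longrightarrow> invertible (inv_arr a)"
  by (rule isoI[where b = a]) auto

lemma iso_ide [simp]: "X \<in> Obj C \<Longrightarrow> invertible (ide X)"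
  by (rule isoI[where b = "ide X"]) auto

lemma iso_cmp [simp]: "invertible a \<Longrightarrow> invertible b \<Longrightarrow> cd a = dm b \<Longrightarrow> invertible (b \<cdot> a)"
  by (rule isoI[where b = "inv_arr a \<cdot> inv_arr b"]) (auto simp: cmp_assoc)

lemma iso_cancel_right:
  assumes "b \<cdot> a = c \<cdot> a" "invertible a" "arrow b" "arrow c" "dm b = cd a" "dm c = cd a"
  shows "b = c"
proof -
  have "(b \<cdot> a) \<cdot> inv_arr a = (c \<cdot> a) \<cdot> inv_arr a" using assms(1) by simp
  then show ?thesis using assms(2-) by (simp add: cmp_assoc)
qed

lemma iso_cancel_left:
  assumes "a \<cdot> b = a \<cdot> c" "invertible a" "arrow b" "arrow c" "cd b = dm a" "cd c = dm a"
  shows "b = c"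
  using assms by (metis inva_cancel(1))

lemma inva_switch:
  assumes "b \<cdot> a = d \<cdot> c" "invertible a" "invertible d" "arrow b" "arrow c" "cd a = dm b" "cd c = dm d"
  shows "inv_arr d \<cdot> b = c \<cdot> inv_arr a"
proof -
  have 1: "cd b = cd d" "dm a = dm c"
    using arg_cong[OF assms(1), of cd] arg_cong[OF assms(1), of dm] by simp_all
  have "inv_arr d \<cdot> (b \<cdot> a) \<cdot> inv_arr a = inv_arr d \<cdot> (d \<cdot> c) \<cdot> inv_arr a"
    using assms(1) by simp
  then show ?thesis using assms(2-) 1 by (simp add: cmp_assoc)
qed

lemma iso_arr_iff:
  "invertible (Arrow X Y f) \<longleftrightarrow> X \<in> Obj C \<and> Y \<in> Obj C \<and> is_iso C X Y f"
proof -
  have "(\<exists>b. inverse_arrows C (Arrow X Y f) b) \<longleftrightarrow>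
    (\<exists>g. inverse_arrows C (Arrow X Y f) (Arrow Y X g))"
    unfolding inverse_arrows_def by (metis arrow.collapse arrow.sel)
  then show ?thesis
    unfolding is_iso_def iso_arr_def
    by (auto simp: inverse_arrows_def arr_def cmp_def ida_def simp del: arr_obj)
qed

lemma arr_fap [simp]: "functor F \<Longrightarrow> arrow a \<Longrightarrow> arrow (F \<star> a)"
  by (simp add: arr_def fap_def is_functor_def del: arr_obj)

lemma fob_closed [simp]: "functor F \<Longrightarrow> X \<in> Obj C \<Longrightarrow> fob F X \<in> Obj C"
  by (simp add: is_functor_def)

lemma fap_cmp:
  "functor F \<Longrightarrow> arrow a \<Longrightarrow> arrow b \<Longrightarrow> cd a = dm b \<Longrightarrow> F \<star> (b \<cdot> a) = (F \<star> b) \<cdot> (F \<star> a)"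
  by (auto simp add: arr_def fap_def cmp_def is_functor_def simp del: arr_obj)

lemma fap_ide [simp]: "functor F \<Longrightarrow> X \<in> Obj C \<Longrightarrow> F \<star> ide X = ide (fob F X)"
  by (simp add: ida_def fap_def is_functor_def)

lemma functorI:
  assumes "\<And>X. X \<in> Obj C \<Longrightarrow> fob F X \<in> Obj C" "\<And>a. arrow a \<Longrightarrow> arrow (F \<star> a)"
    "\<And>X. X \<in> Obj C \<Longrightarrow> F \<star> ide X = ide (fob F X)"
    "\<And>a b. arrow a \<Longrightarrow> arrow b \<Longrightarrow> cd a = dm b \<Longrightarrow> F \<star> (b \<cdot> a) = (F \<star> b) \<cdot> (F \<star> a)"
  shows "functor F"
  unfolding is_functor_def
proof (intro conjI ballI)
  fix X Y f assume XY: "X \<in> Obj C" "Y \<in> Obj C" "f \<in> Mor C X Y"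
  then show "fmor F X Y f \<in> Mor C (fob F X) (fob F Y)"
    using assms(2)[of "Arrow X Y f"] by (simp add: arr_def fap_def del: arr_obj)
  fix Z g assume "Z \<in> Obj C" "g \<in> Mor C Y Z"
  then show "fmor F X Z (Comp C X Y Z g f) =
          Comp C (fob F X) (fob F Y) (fob F Z) (fmor F Y Z g) (fmor F X Y f)"
    using XY assms(4)[of "Arrow X Y f" "Arrow Y Z g"] by (simp add: arr_def fap_def cmp_def del: arr_obj)
next
  fix X assume "X \<in> Obj C"
  then show "fmor F X X (Id C X) = Id C (fob F X)"
    using assms(3)[of X] by (simp add: fap_def ida_def)
qed (use assms(1) in auto)

lemma functor_comp [simp]: "functor F \<Longrightarrow> functor F' \<Longrightarrow> functor (F \<circ>\<^sub>F F')"
  by (rule functorI) (auto simp: fap_cmp)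

lemma functor_id [simp]: "functor id_fctr"
  by (rule functorI) auto

lemma iso_fap [simp]: "functor F \<Longrightarrow> invertible a \<Longrightarrow> invertible (F \<star> a)"
  by (rule isoI[where b = "F \<star> inv_arr a"]) (simp_all add: fap_cmp[symmetric])

lemma fap_inva: "functor F \<Longrightarrow> invertible a \<Longrightarrow> F \<star> inv_arr a = inv_arr (F \<star> a)"
  by (rule inva_eqI[symmetric]) (auto simp: inverse_arrows_def fap_cmp[symmetric])


section \<open>Natural isomorphisms and equivalences\<close>

definition natural :: "('o, 'm, 'o, 'm) fctr \<Rightarrow> ('o, 'm, 'o, 'm) fctr \<Rightarrow> ('o \<Rightarrow> ('o, 'm) arrow) \<Rightarrow> bool" where
  "natural F F' t \<longleftrightarrow>
     (\<forall>X \<in> Obj C. arrow (t X) \<and> dm (t X) = fob F X \<and> cd (t X) = fob F' X) \<and>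
     (\<forall>a. arrow a \<longrightarrow> t (cd a) \<cdot> F \<star> a = (F' \<star> a) \<cdot> t (dm a))"

definition nat_iso :: "('o, 'm, 'o, 'm) fctr \<Rightarrow> ('o, 'm, 'o, 'm) fctr \<Rightarrow> ('o \<Rightarrow> ('o, 'm) arrow) \<Rightarrow> bool" where
  "nat_iso F F' t \<longleftrightarrow> natural F F' t \<and> (\<forall>X \<in> Obj C. invertible (t X))"

definition components :: "('o, 'm, 'o, 'm) fctr \<Rightarrow> ('o, 'm, 'o, 'm) fctr \<Rightarrow> ('o \<Rightarrow> 'm) \<Rightarrow> 'o \<Rightarrow> ('o, 'm) arrow" where
  "components F F' \<phi> X = Arrow (fob F X) (fob F' X) (\<phi> X)"

lemma components_sel [simp]: "dm (components F F' \<phi> X) = fob F X" "cd (components F F' \<phi> X) = fob F' X"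
  "mp (components F F' \<phi> X) = \<phi> X"
  by (simp_all add: components_def)

lemma components_mp: "dm (t X) = fob F X \<Longrightarrow> cd (t X) = fob F' X \<Longrightarrow> components F F' (\<lambda>X. mp (t X)) X = t X"
  by (simp add: components_def arrow.expand)

lemma natural_iso_iff:
  assumes "functor F" "functor F'"
  shows "natural_iso C C F F' \<phi> \<longleftrightarrow> nat_iso F F' (components F F' \<phi>)"
proof
  assume L: "natural_iso C C F F' \<phi>"
  have i: "invertible (components F F' \<phi> X)" if "X \<in> Obj C" for X
    using L that assms by (auto simp: natural_iso_def components_def iso_arr_iff)
  have "components F F' \<phi> (cd a) \<cdot> F \<star> a = (F' \<star> a) \<cdot> components F F' \<phi> (dm a)" if "arrow a" for a
    using L that by (auto simp: natural_iso_def components_def cmp_def arr_def fap_def simp del: arr_obj)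
  with i show "nat_iso F F' (components F F' \<phi>)"
    by (simp add: nat_iso_def natural_def)
next
  assume R: "nat_iso F F' (components F F' \<phi>)"
  have "is_iso C (fob F X) (fob F' X) (\<phi> X)" if "X \<in> Obj C" for X
    using R that by (auto simp: nat_iso_def components_def iso_arr_iff)
  moreover have "Comp C (fob F X) (fob F Y) (fob F' Y) (\<phi> Y) (fmor F X Y f) =
        Comp C (fob F X) (fob F' X) (fob F' Y) (fmor F' X Y f) (\<phi> X)"
    if "X \<in> Obj C" "Y \<in> Obj C" "f \<in> Mor C X Y" for X Y f
  proof -
    have "arrow (Arrow X Y f)" using that by (simp add: arr_def del: arr_obj)
    then have "components F F' \<phi> Y \<cdot> F \<star> Arrow X Y f = (F' \<star> Arrow X Y f) \<cdot> components F F' \<phi> X"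
      using R by (auto simp: nat_iso_def natural_def)
    then show ?thesis by (simp add: components_def cmp_def fap_def)
  qed
  ultimately show "natural_iso C C F F' \<phi>" by (simp add: natural_iso_def)
qed

lemma nat_iso_cong:
  assumes "nat_iso F F' t" "\<And>X. X \<in> Obj C \<Longrightarrow> t X = s X"
  shows "nat_iso F F' s"
  using assms by (auto simp: nat_iso_def natural_def)

lemma natural_iso_mp:
  assumes "functor F" "functor F'" "nat_iso F F' t"
  shows "natural_iso C C F F' (\<lambda>X. mp (t X))"
proof -
  have "nat_iso F F' (components F F' (\<lambda>X. mp (t X)))"
    by (rule nat_iso_cong[OF assms(3)])
      (use assms(3) in \<open>simp add: nat_iso_def natural_def components_mp\<close>)
  then show ?thesis using assms by (simp add: natural_iso_iff)
qed

lemma nat_isoD: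
  assumes "nat_iso F F' t"
  shows "X \<in> Obj C \<Longrightarrow> invertible (t X)" "X \<in> Obj C \<Longrightarrow> arrow (t X)"
    "X \<in> Obj C \<Longrightarrow> dm (t X) = fob F X" "X \<in> Obj C \<Longrightarrow> cd (t X) = fob F' X"
    "arrow a \<Longrightarrow> t (cd a) \<cdot> F \<star> a = (F' \<star> a) \<cdot> t (dm a)"
  using assms by (auto simp: nat_iso_def natural_def)

lemma nat_isoI:
  assumes "\<And>X. X \<in> Obj C \<Longrightarrow> invertible (t X)" "\<And>X. X \<in> Obj C \<Longrightarrow> dm (t X) = fob F X"
    "\<And>X. X \<in> Obj C \<Longrightarrow> cd (t X) = fob F' X"
    "\<And>a. arrow a \<Longrightarrow> t (cd a) \<cdot> F \<star> a = (F' \<star> a) \<cdot> t (dm a)"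
  shows "nat_iso F F' t"
  using assms by (auto simp: nat_iso_def natural_def)

lemma nat_iso_ide: "functor F \<Longrightarrow> nat_iso F F (\<lambda>X. ide (fob F X))"
  by (rule nat_isoI) auto

lemma nat_iso_inv:
  assumes "functor F" "functor F'" "nat_iso F F' t"
  shows "nat_iso F' F (\<lambda>X. inv_arr (t X))"
proof (rule nat_isoI)
  fix a assume "arrow a"
  then show "inv_arr (t (cd a)) \<cdot> F' \<star> a = (F \<star> a) \<cdot> inv_arr (t (dm a))"
    using inva_switch[OF nat_isoD(5)[OF assms(3), symmetric, of a]] assms(1,2)
    by (simp add: nat_isoD[OF assms(3)])
qed (use assms in \<open>auto simp: nat_isoD[OF assms(3)]\<close>)

lemma nat_iso_vcomp:
  assumes F: "functor F" "functor F'" "functor F''" and t: "nat_iso F F' t" and s: "nat_iso F' F'' s"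
  shows "nat_iso F F'' (\<lambda>X. s X \<cdot> t X)"
proof (rule nat_isoI)
  note [simp] = nat_isoD(1-4)[OF t] nat_isoD(1-4)[OF s]
  fix a assume a [simp]: "arrow a"
  have "(s (cd a) \<cdot> t (cd a)) \<cdot> F \<star> a = s (cd a) \<cdot> (F' \<star> a) \<cdot> t (dm a)"
    using F nat_isoD(5)[OF t, of a] by (simp add: cmp_assoc)
  also have "\<dots> = (F'' \<star> a) \<cdot> s (dm a) \<cdot> t (dm a)"
    using F nat_isoD(5)[OF s, of a] by (simp add: cmp_assoc[symmetric])
  finally show "(s (cd a) \<cdot> t (cd a)) \<cdot> F \<star> a = (F'' \<star> a) \<cdot> s (dm a) \<cdot> t (dm a)" .
qed (auto simp: nat_isoD[OF t] nat_isoD[OF s])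

lemma nat_iso_whisker_left:
  assumes L: "functor L" "functor F" "functor F'" and t: "nat_iso F F' t"
  shows "nat_iso (L \<circ>\<^sub>F F) (L \<circ>\<^sub>F F') (\<lambda>X. L \<star> t X)"
  by (rule nat_isoI) (simp_all add: L nat_isoD[OF t] fap_cmp[symmetric])

lemma nat_iso_whisker_right:
  assumes L: "functor L" and t: "nat_iso F F' t"
  shows "nat_iso (F \<circ>\<^sub>F L) (F' \<circ>\<^sub>F L) (\<lambda>X. t (fob L X))"
proof (rule nat_isoI)
  fix a assume "arrow a"
  then show "t (fob L (cd a)) \<cdot> (F \<circ>\<^sub>F L) \<star> a = ((F' \<circ>\<^sub>F L) \<star> a) \<cdot> t (fob L (dm a))"
    using nat_isoD(5)[OF t, of "L \<star> a"] L by simp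
qed (simp_all add: L nat_isoD[OF t])

lemma comp_fctr_assoc: "F \<circ>\<^sub>F (L \<circ>\<^sub>F M) = F \<circ>\<^sub>F L \<circ>\<^sub>F M"
  by (simp add: comp_fctr_def)

lemma id_comp_fctr [simp]: "id_fctr \<circ>\<^sub>F F = F" "F \<circ>\<^sub>F id_fctr = F"
  by (simp_all add: comp_fctr_def id_fctr_def)

lemma autoequivalence_iff:
  "autoequivalence C F \<longleftrightarrow> functor F \<and>
     (\<exists>F' t s. functor F' \<and> nat_iso (F' \<circ>\<^sub>F F) id_fctr t \<and> nat_iso (F \<circ>\<^sub>F F') id_fctr s)"
proof
  assume "autoequivalence C F"
  then show "functor F \<and> (\<exists>F' t s. functor F' \<and> nat_iso (F' \<circ>\<^sub>F F) id_fctr t \<and> nat_iso (F \<circ>\<^sub>F F') id_fctr s)"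
    unfolding autoequivalence_def using natural_iso_iff functor_comp functor_id by blast
next
  assume "functor F \<and> (\<exists>F' t s. functor F' \<and> nat_iso (F' \<circ>\<^sub>F F) id_fctr t \<and> nat_iso (F \<circ>\<^sub>F F') id_fctr s)"
  then show "autoequivalence C F"
    unfolding autoequivalence_def using natural_iso_mp functor_comp functor_id by blast
qed

lemma autoequivalence_functor [simp]: "autoequivalence C F \<Longrightarrow> functor F"
  by (simp add: autoequivalence_def)

text \<open>Conjugation with \<open>t\<close> recovers \<open>a\<close> from \<open>F' (F a)\<close>.\<close>

lemma faithful_if_retract:
  assumes "functor F" "functor F'" and t: "nat_iso (F' \<circ>\<^sub>F F) id_fctr t"
    and a: "arrow a" "arrow b" "dm a = dm b" "cd a = cd b" and eq: "F \<star> a = F \<star> b"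
  shows "a = b"
proof (rule iso_cancel_right)
  note [simp] = nat_isoD(1-4)[OF t]
  show "a \<cdot> t (dm a) = b \<cdot> t (dm a)"
    using nat_isoD(5)[OF t, of a] nat_isoD(5)[OF t, of b] eq a by simp
qed (use a in \<open>auto simp: nat_isoD[OF t]\<close>)

lemma autoequivalence_faithful:
  assumes "autoequivalence C F" "F \<star> a = F \<star> b" "arrow a" "arrow b" "dm a = dm b" "cd a = cd b"
  shows "a = b"
  using assms faithful_if_retract[of F] unfolding autoequivalence_iff by metis

text \<open>
  The preimage is \<open>F' b\<close> transported along \<open>t\<close>. That \<open>F\<close> maps it to \<open>b\<close> can be tested after
  applying \<open>F'\<close>, which is faithful because \<open>F F' \<cong> 1\<close>.
\<close>

lemma autoequivalence_full:
  assumes F: "autoequivalence C F" and b: "arrow b" "dm b = fob F X" "cd b = fob F Y"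
    and X: "X \<in> Obj C" "Y \<in> Obj C"
  shows "\<exists>a. arrow a \<and> dm a = X \<and> cd a = Y \<and> F \<star> a = b"
proof -
  obtain F' t s where F' [simp]: "functor F" "functor F'" and t: "nat_iso (F' \<circ>\<^sub>F F) id_fctr t"
    and s: "nat_iso (F \<circ>\<^sub>F F') id_fctr s"
    using F unfolding autoequivalence_iff by blast
  note [simp] = nat_isoD(1-4)[OF t] b X
  define a where "a = t Y \<cdot> (F' \<star> b) \<cdot> inv_arr (t X)"
  have [simp]: "arrow a" "dm a = X" "cd a = Y" by (simp_all add: a_def)
  have "a \<cdot> t X = t Y \<cdot> F' \<star> b" by (simp add: a_def cmp_assoc)
  moreover have "a \<cdot> t X = t Y \<cdot> F' \<star> F \<star> a" using nat_isoD(5)[OF t, of a] by simp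
  ultimately have "F' \<star> F \<star> a = F' \<star> b"
    by (intro iso_cancel_left[of "t Y" "F' \<star> F \<star> a" "F' \<star> b"]) simp_all
  then have "F \<star> a = b"
    by (rule faithful_if_retract[OF F'(2,1) s, rotated 4]) simp_all
  then show ?thesis by (intro exI[of _ a]) simp
qed

lemma autoequivalence_reflects_iso:
  assumes F: "autoequivalence C F" and a: "arrow a" and i: "invertible (F \<star> a)"
  shows "invertible a"
proof -
  note [simp] = F a i
  obtain b where b [simp]: "arrow b" "dm b = cd a" "cd b = dm a" and Fb: "F \<star> b = inv_arr (F \<star> a)"
    using autoequivalence_full[OF F, of "inv_arr (F \<star> a)" "cd a" "dm a"] by auto
  have "b \<cdot> a = ide (dm a)"
    by (rule autoequivalence_faithful[OF F]) (simp_all add: fap_cmp Fb)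
  moreover have "a \<cdot> b = ide (cd a)"
    by (rule autoequivalence_faithful[OF F]) (simp_all add: fap_cmp Fb)
  ultimately show ?thesis by (intro isoI[where b = b]) simp_all
qed

lemma autoequivalence_surj:
  assumes F: "autoequivalence C F" and X: "X \<in> Obj C"
  shows "\<exists>Y a. Y \<in> Obj C \<and> invertible a \<and> dm a = fob F Y \<and> cd a = X"
proof -
  obtain F' s where F': "functor F'" and s: "nat_iso (F \<circ>\<^sub>F F') id_fctr s"
    using F unfolding autoequivalence_iff by blast
  show ?thesis
    by (intro exI[of _ "fob F' X"] exI[of _ "s X"]) (simp add: nat_isoD[OF s] X F')
qed

lemma autoequivalence_comp:
  assumes "autoequivalence C F" "autoequivalence C L"
  shows "autoequivalence C (F \<circ>\<^sub>F L)"
proof -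
  obtain F' t s where F' [simp]: "functor F" "functor F'" and t: "nat_iso (F' \<circ>\<^sub>F F) id_fctr t"
    and s: "nat_iso (F \<circ>\<^sub>F F') id_fctr s"
    using assms(1) unfolding autoequivalence_iff by blast
  obtain L' u v where L' [simp]: "functor L" "functor L'" and u: "nat_iso (L' \<circ>\<^sub>F L) id_fctr u"
    and v: "nat_iso (L \<circ>\<^sub>F L') id_fctr v"
    using assms(2) unfolding autoequivalence_iff by blast
  have "nat_iso (L' \<circ>\<^sub>F (F' \<circ>\<^sub>F F \<circ>\<^sub>F L)) (L' \<circ>\<^sub>F L) (\<lambda>X. L' \<star> t (fob L X))"
    using nat_iso_whisker_left[OF _ _ _ nat_iso_whisker_right[OF L'(1) t], of L'] by simp
  from nat_iso_vcomp[OF _ _ _ this u]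
  have 1: "\<exists>w. nat_iso (L' \<circ>\<^sub>F F' \<circ>\<^sub>F (F \<circ>\<^sub>F L)) id_fctr w"
    by (auto simp: comp_fctr_assoc)
  have "nat_iso (F \<circ>\<^sub>F (L \<circ>\<^sub>F L' \<circ>\<^sub>F F')) (F \<circ>\<^sub>F F') (\<lambda>X. F \<star> v (fob F' X))"
    using nat_iso_whisker_left[OF _ _ _ nat_iso_whisker_right[OF F'(2) v], of F] by simp
  from nat_iso_vcomp[OF _ _ _ this s]
  have 2: "\<exists>w. nat_iso (F \<circ>\<^sub>F L \<circ>\<^sub>F (L' \<circ>\<^sub>F F')) id_fctr w"
    by (auto simp: comp_fctr_assoc)
  from 1 2 show ?thesis unfolding autoequivalence_iff
    using functor_comp F' L' by blast
qed

end


section \<open>Characters\<close>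

locale characters = K?: field K + G: group G
  for K :: "('k, 'e) ring_scheme" (structure) and G :: "('g, 'f) monoid_scheme"
begin

abbreviation mult_G (infixl \<open>*\<^sub>G\<close> 70) where "g *\<^sub>G h \<equiv> g \<otimes>\<^bsub>G\<^esub> h"
abbreviation "DG \<equiv> dual_group K G"

lemma dual_char:
  assumes "\<chi> \<in> carrier DG"
  shows "g \<in> carrier G \<Longrightarrow> \<chi> g \<in> carrier K" "g \<in> carrier G \<Longrightarrow> \<chi> g \<noteq> \<zero>"
    "g \<in> carrier G \<Longrightarrow> h \<in> carrier G \<Longrightarrow> \<chi> (g *\<^sub>G h) = \<chi> g \<otimes> \<chi> h"
    "\<chi> \<one>\<^bsub>G\<^esub> = \<one>" "\<chi> \<in> extensional (carrier G)"
    "g \<in> carrier G \<Longrightarrow> \<chi> g \<otimes> \<chi> (inv\<^bsub>G\<^esub> g) = \<one>" "g \<in> carrier G \<Longrightarrow> \<chi> (inv\<^bsub>G\<^esub> g) \<otimes> \<chi> g = \<one>"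
proof -
  have hom: "\<chi> \<in> hom G (units_of K)" and ext: "\<chi> \<in> extensional (carrier G)"
    using assms by (auto simp: dual_group_def)
  show "\<chi> \<in> extensional (carrier G)" by (rule ext)
  have u: "\<chi> g \<in> Units K" if "g \<in> carrier G" for g
    using hom_in_carrier[OF hom that] by (simp add: units_of_def)
  then show c: "\<chi> g \<in> carrier K" "\<chi> g \<noteq> \<zero>" if "g \<in> carrier G" for g
    using that field_Units by auto
  show m: "\<chi> (g *\<^sub>G h) = \<chi> g \<otimes> \<chi> h" if "g \<in> carrier G" "h \<in> carrier G" for g h
    using hom_mult[OF hom that] by (simp add: units_of_def)
  have "\<chi> \<one>\<^bsub>G\<^esub> \<otimes> \<chi> \<one>\<^bsub>G\<^esub> = \<chi> \<one>\<^bsub>G\<^esub> \<otimes> \<one>" using m[of "\<one>\<^bsub>G\<^esub>" "\<one>\<^bsub>G\<^esub>"] c(1) by simp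
  then show one: "\<chi> \<one>\<^bsub>G\<^esub> = \<one>" using m_lcancel[OF c(2) c(1) c(1) one_closed] by simp
  show "\<chi> g \<otimes> \<chi> (inv\<^bsub>G\<^esub> g) = \<one>" "\<chi> (inv\<^bsub>G\<^esub> g) \<otimes> \<chi> g = \<one>" if "g \<in> carrier G"
    using m[of g "inv\<^bsub>G\<^esub> g"] m[of "inv\<^bsub>G\<^esub> g" g] one that by simp_all
qed

lemma dual_mult: "g \<in> carrier G \<Longrightarrow> (\<chi> \<otimes>\<^bsub>DG\<^esub> \<psi>) g = \<chi> g \<otimes> \<psi> g"
  by (simp add: dual_group_def)

lemma dual_one: "g \<in> carrier G \<Longrightarrow> \<one>\<^bsub>DG\<^esub> g = \<one>"
  by (simp add: dual_group_def)

lemma dualI: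
  assumes "\<And>g. g \<in> carrier G \<Longrightarrow> \<chi> g \<in> carrier K" "\<And>g. g \<in> carrier G \<Longrightarrow> \<chi> g \<noteq> \<zero>"
    "\<And>g h. g \<in> carrier G \<Longrightarrow> h \<in> carrier G \<Longrightarrow> \<chi> (g *\<^sub>G h) = \<chi> g \<otimes> \<chi> h" "\<chi> \<in> extensional (carrier G)"
  shows "\<chi> \<in> carrier DG"
  using assms by (auto simp: dual_group_def hom_def units_of_def field_Units)

lemma dual_eqI:
  assumes "\<chi> \<in> carrier DG" "\<psi> \<in> carrier DG" "\<And>g. g \<in> carrier G \<Longrightarrow> \<chi> g = \<psi> g"
  shows "\<chi> = \<psi>"
  using assms dual_char(5) by (intro extensionalityI[of _ "carrier G"]) auto

lemma dual_mult_closed: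
  assumes "\<chi> \<in> carrier DG" "\<psi> \<in> carrier DG"
  shows "\<chi> \<otimes>\<^bsub>DG\<^esub> \<psi> \<in> carrier DG"
proof (rule dualI)
  fix g h assume gh: "g \<in> carrier G" "h \<in> carrier G"
  then show "(\<chi> \<otimes>\<^bsub>DG\<^esub> \<psi>) (g *\<^sub>G h) = (\<chi> \<otimes>\<^bsub>DG\<^esub> \<psi>) g \<otimes> (\<chi> \<otimes>\<^bsub>DG\<^esub> \<psi>) h"
    using assms by (simp add: dual_mult dual_char m_ac)
qed (use assms in \<open>auto simp: dual_mult dual_char integral_iff, simp add: dual_group_def\<close>)

lemma group_DG: "group DG"
proof (rule groupI)
  show "\<one>\<^bsub>DG\<^esub> \<in> carrier DG"
    by (rule dualI) (auto simp: dual_one, simp add: dual_group_def)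
  fix \<chi> assume \<chi>: "\<chi> \<in> carrier DG"
  show "\<one>\<^bsub>DG\<^esub> \<otimes>\<^bsub>DG\<^esub> \<chi> = \<chi>"
    using \<chi> \<open>\<one>\<^bsub>DG\<^esub> \<in> carrier DG\<close>
    by (intro dual_eqI dual_mult_closed) (auto simp: dual_mult dual_one dual_char)
  define \<psi> where "\<psi> = (\<lambda>g \<in> carrier G. \<chi> (inv\<^bsub>G\<^esub> g))"
  have "\<psi> \<in> carrier DG"
    using \<chi> by (intro dualI) (auto simp: \<psi>_def dual_char G.inv_mult_group m_comm)
  moreover have "\<psi> \<otimes>\<^bsub>DG\<^esub> \<chi> = \<one>\<^bsub>DG\<^esub>"
    using \<chi> \<open>\<psi> \<in> carrier DG\<close> \<open>\<one>\<^bsub>DG\<^esub> \<in> carrier DG\<close>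
    by (intro dual_eqI dual_mult_closed) (auto simp: dual_mult dual_one dual_char \<psi>_def)
  ultimately show "\<exists>\<psi> \<in> carrier DG. \<psi> \<otimes>\<^bsub>DG\<^esub> \<chi> = \<one>\<^bsub>DG\<^esub>" by blast
  fix \<psi> assume \<psi>: "\<psi> \<in> carrier DG"
  show "\<chi> \<otimes>\<^bsub>DG\<^esub> \<psi> \<in> carrier DG" using \<chi> \<psi> by (rule dual_mult_closed)
  fix \<xi> assume "\<xi> \<in> carrier DG"
  then show "\<chi> \<otimes>\<^bsub>DG\<^esub> \<psi> \<otimes>\<^bsub>DG\<^esub> \<xi> = \<chi> \<otimes>\<^bsub>DG\<^esub> (\<psi> \<otimes>\<^bsub>DG\<^esub> \<xi>)"
    using \<chi> \<psi> by (intro dual_eqI dual_mult_closed) (auto simp: dual_mult dual_char m_assoc)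
qed


lemma sum_char_eq_zero:
  assumes fin: "finite (carrier G)" and \<chi>: "\<chi> \<in> carrier DG" and \<psi>: "\<psi> \<in> carrier DG" and ne: "\<chi> \<noteq> \<psi>"
  shows "(\<Oplus>g \<in> carrier G. \<chi> g \<otimes> \<psi> (inv\<^bsub>G\<^esub> g)) = \<zero>"
proof -
  define s where "s = (\<Oplus>g \<in> carrier G. \<chi> g \<otimes> \<psi> (inv\<^bsub>G\<^esub> g))"
  note [simp] = dual_char[OF \<chi>] dual_char[OF \<psi>]
  have s: "s \<in> carrier K" unfolding s_def by (intro finsum_closed) auto
  obtain h where h: "h \<in> carrier G" "\<chi> h \<noteq> \<psi> h" using dual_eqI[OF \<chi> \<psi>] ne by blast
  \<comment> \<open>Translating the summation by \<open>h\<close> multiplies the sum by \<open>\<chi> h / \<psi> h\<close>.\<close>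
  have inj: "inj_on (\<lambda>g. h *\<^sub>G g) (carrier G)" using h(1) by (intro inj_onI) simp
  have im: "(\<lambda>g. h *\<^sub>G g) ` carrier G = carrier G"
    using h(1) by (intro G.surj_const_mult)
  have "s = (\<Oplus>g \<in> (\<lambda>g. h *\<^sub>G g) ` carrier G. \<chi> g \<otimes> \<psi> (inv\<^bsub>G\<^esub> g))"
    by (simp only: im s_def)
  also have "\<dots> = (\<Oplus>g \<in> carrier G. \<chi> (h *\<^sub>G g) \<otimes> \<psi> (inv\<^bsub>G\<^esub> (h *\<^sub>G g)))"
    by (rule finsum_reindex[OF _ inj]) (auto simp: im)
  also have "\<dots> = (\<Oplus>g \<in> carrier G. (\<chi> h \<otimes> \<psi> (inv\<^bsub>G\<^esub> h)) \<otimes> (\<chi> g \<otimes> \<psi> (inv\<^bsub>G\<^esub> g)))"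
    using h(1) by (intro finsum_cong') (auto simp: G.inv_mult_group m_ac)
  also have "\<dots> = (\<chi> h \<otimes> \<psi> (inv\<^bsub>G\<^esub> h)) \<otimes> s"
    unfolding s_def using h(1) fin by (intro finsum_rdistr[symmetric]) auto
  finally have eq: "s = (\<chi> h \<otimes> \<psi> (inv\<^bsub>G\<^esub> h)) \<otimes> s" .
  show ?thesis
  proof (rule ccontr)
    assume "\<not> ?thesis"
    then have "s \<noteq> \<zero>" by (simp add: s_def)
    moreover have "\<one> \<otimes> s = (\<chi> h \<otimes> \<psi> (inv\<^bsub>G\<^esub> h)) \<otimes> s" using eq s by simp
    ultimately have "\<one> = \<chi> h \<otimes> \<psi> (inv\<^bsub>G\<^esub> h)"
      using s h(1) m_rcancel[of s \<one> "\<chi> h \<otimes> \<psi> (inv\<^bsub>G\<^esub> h)"] by simp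
    then have "\<chi> h \<otimes> \<psi> (inv\<^bsub>G\<^esub> h) \<otimes> \<psi> h = \<one> \<otimes> \<psi> h" by (rule arg_cong[OF sym])
    then show False using h by (simp add: m_assoc)
  qed
qed

text \<open>
  The constant \<open>c\<close> is the inverse of the order of \<open>G\<close>. Let \<open>e i\<close> be the idempotent of \<open>kG\<close> that
  corresponds to the \<open>i\<close>-th factor of \<open>k\<^sup>n\<close>. The group elements act on \<open>e i\<close> by a character \<open>X i\<close>,
  so the coefficients of \<open>e i\<close> are \<open>e i h = X i (h\<^sup>-\<^sup>1) c\<close>; that \<open>e i\<close> is idempotent gives the value
  of \<open>c\<close>, and that the \<open>e i\<close> sum up to \<open>1\<close> is the first formula once the \<open>X i\<close> are known to be all
  the characters.
\<close>

lemma character_sums: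
  assumes fin: "finite (carrier G)" and split: "splits_over K G"
  shows "\<exists>c \<in> carrier K. finite (carrier DG) \<and>
    (\<forall>g \<in> carrier G. c \<otimes> (\<Oplus>\<chi> \<in> carrier DG. \<chi> g) = (if g = \<one>\<^bsub>G\<^esub> then \<one> else \<zero>)) \<and>
    (\<forall>\<chi> \<in> carrier DG. \<forall>\<psi> \<in> carrier DG.
      c \<otimes> (\<Oplus>g \<in> carrier G. \<chi> g \<otimes> \<psi> (inv\<^bsub>G\<^esub> g)) = (if \<chi> = \<psi> then \<one> else \<zero>))"
proof -
  define R where "R = group_algebra K G"
  obtain n \<Phi> where iso: "\<Phi> \<in> ring_iso R (power_algebra K n)"
    and lin: "\<And>c a. c \<in> carrier K \<Longrightarrow> a \<in> carrier R \<Longrightarrow> \<Phi> (c \<odot>\<^bsub>R\<^esub> a) = c \<odot>\<^bsub>power_algebra K n\<^esub> \<Phi> a"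
    using split unfolding splits_over_def R_def by blast
  have mem_R: "a \<in> carrier R \<longleftrightarrow> a \<in> carrier G \<rightarrow>\<^sub>E carrier K" for a
    by (simp add: R_def group_algebra_def)
  have R_eval [simp]: "a g \<in> carrier K" if "a \<in> carrier R" "g \<in> carrier G" for a g
    using that by (auto simp: mem_R)
  have R_eqI: "a = b" if "a \<in> carrier R" "b \<in> carrier R" "\<And>g. g \<in> carrier G \<Longrightarrow> a g = b g" for a b
    using that by (auto simp: mem_R intro: PiE_ext)
  have bij: "bij_betw \<Phi> (carrier R) ({..<n} \<rightarrow>\<^sub>E carrier K)"
    using iso by (simp add: ring_iso_def power_algebra_def)
  have inj: "a = b" if "\<Phi> a = \<Phi> b" "a \<in> carrier R" "b \<in> carrier R" for a b
    using that bij by (auto simp: bij_betw_def inj_on_def)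
  have \<Phi>: "\<Phi> a \<in> {..<n} \<rightarrow>\<^sub>E carrier K" if "a \<in> carrier R" for a
    using bij that by (auto simp: bij_betw_def)
  have \<Phi>_i [simp]: "\<Phi> a i \<in> carrier K" if "a \<in> carrier R" "i < n" for a i
    using \<Phi>[OF that(1)] that(2) by auto
  have \<Phi>_eqI: "a = b" if "a \<in> carrier R" "b \<in> carrier R" "\<And>i. i < n \<Longrightarrow> \<Phi> a i = \<Phi> b i" for a b
    using PiE_ext[OF \<Phi>[OF that(1)] \<Phi>[OF that(2)]] that inj by auto
  have \<Phi>_mult: "\<Phi> (a \<otimes>\<^bsub>R\<^esub> b) i = \<Phi> a i \<otimes> \<Phi> b i" if "a \<in> carrier R" "b \<in> carrier R" "i < n" for a b i
    using ring_hom_mult[of \<Phi> R "power_algebra K n"] iso that by (simp add: ring_iso_def power_algebra_def)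
  have \<Phi>_add: "\<Phi> (a \<oplus>\<^bsub>R\<^esub> b) i = \<Phi> a i \<oplus> \<Phi> b i" if "a \<in> carrier R" "b \<in> carrier R" "i < n" for a b i
    using ring_hom_add[of \<Phi> R "power_algebra K n"] iso that by (simp add: ring_iso_def power_algebra_def)
  have \<Phi>_one: "\<Phi> \<one>\<^bsub>R\<^esub> i = \<one>" if "i < n" for i
    using ring_hom_one[of \<Phi> R "power_algebra K n"] iso that by (simp add: ring_iso_def power_algebra_def)
  have \<Phi>_smult: "\<Phi> (c \<odot>\<^bsub>R\<^esub> a) i = c \<otimes> \<Phi> a i" if "c \<in> carrier K" "a \<in> carrier R" "i < n" for c a i
    using lin[OF that(1,2)] that(3) by (simp add: power_algebra_def)
  have mult: "(a \<otimes>\<^bsub>R\<^esub> b) g = (\<Oplus>h \<in> carrier G. a h \<otimes> b (inv\<^bsub>G\<^esub> h *\<^sub>G g))" if "g \<in> carrier G" for a b g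
    using that by (simp add: R_def group_algebra_def)
  have mult_closed [simp]: "a \<otimes>\<^bsub>R\<^esub> b \<in> carrier R" if "a \<in> carrier R" "b \<in> carrier R" for a b
    using that by (auto simp: mem_R R_def group_algebra_def intro!: finsum_closed)
  have add: "(a \<oplus>\<^bsub>R\<^esub> b) g = a g \<oplus> b g" if "g \<in> carrier G" for a b g
    using that by (simp add: R_def group_algebra_def)
  have add_closed [simp]: "a \<oplus>\<^bsub>R\<^esub> b \<in> carrier R" if "a \<in> carrier R" "b \<in> carrier R" for a b
    using that by (auto simp: mem_R R_def group_algebra_def)
  have smult: "(c \<odot>\<^bsub>R\<^esub> a) g = c \<otimes> a g" if "g \<in> carrier G" for c a g
    using that by (simp add: R_def group_algebra_def)
  have smult_closed [simp]: "c \<odot>\<^bsub>R\<^esub> a \<in> carrier R" if "c \<in> carrier K" "a \<in> carrier R" for c a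
    using that by (auto simp: mem_R R_def group_algebra_def)
  have one: "\<one>\<^bsub>R\<^esub> g = (if g = \<one>\<^bsub>G\<^esub> then \<one> else \<zero>)" if "g \<in> carrier G" for g
    using that by (simp add: R_def group_algebra_def)
  have one_closed_R [simp]: "\<one>\<^bsub>R\<^esub> \<in> carrier R"
    unfolding mem_R by (simp add: R_def group_algebra_def)
  define b where "b h = (\<lambda>g \<in> carrier G. if g = h then \<one> else \<zero>)" for h
  have b [simp]: "b h \<in> carrier R" for h by (auto simp: mem_R b_def)
  have translate: "(b h \<otimes>\<^bsub>R\<^esub> a) g = a (inv\<^bsub>G\<^esub> h *\<^sub>G g)"
    if [simp]: "h \<in> carrier G" "a \<in> carrier R" "g \<in> carrier G" for h a g
  proof -
    have "(b h \<otimes>\<^bsub>R\<^esub> a) g = (\<Oplus>k \<in> carrier G. if h = k then a (inv\<^bsub>G\<^esub> k *\<^sub>G g) else \<zero>)"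
      unfolding mult[OF that(3)] by (intro finsum_cong') (auto simp: b_def)
    also have "\<dots> = a (inv\<^bsub>G\<^esub> h *\<^sub>G g)"
      using fin by (intro finsum_singleton) auto
    finally show ?thesis .
  qed
  define X where "X i = (\<lambda>h \<in> carrier G. \<Phi> (b h) i)" for i
  have X_eq: "X i h = \<Phi> (b h) i" if "h \<in> carrier G" for i h using that by (simp add: X_def)
  have X: "X i \<in> carrier DG" if i: "i < n" for i
  proof (rule dualI)
    show m: "X i (g *\<^sub>G h) = X i g \<otimes> X i h" if "g \<in> carrier G" "h \<in> carrier G" for g h
    proof -
      have "b g \<otimes>\<^bsub>R\<^esub> b h = b (g *\<^sub>G h)"
        using that by (intro R_eqI) (auto simp: translate, auto simp: b_def G.m_assoc[symmetric] G.inv_solve_left')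
      then show ?thesis using that i by (simp add: X_eq \<Phi>_mult[symmetric])
    qed
    have "b \<one>\<^bsub>G\<^esub> = \<one>\<^bsub>R\<^esub>" by (intro R_eqI b one_closed_R) (simp add: b_def one)
    then have X1: "X i \<one>\<^bsub>G\<^esub> = \<one>" using i by (simp add: X_eq \<Phi>_one)
    show c: "X i g \<in> carrier K" if "g \<in> carrier G" for g using that i by (simp add: X_eq)
    show "X i g \<noteq> \<zero>" if g: "g \<in> carrier G" for g
    proof
      assume "X i g = \<zero>"
      then have "X i (g *\<^sub>G inv\<^bsub>G\<^esub> g) = \<zero>" using g c by (simp only: m G.inv_closed) simp
      then show False using g X1 by simp
    qed
  qed (simp add: X_def)
  \<comment> \<open>An element of \<open>kG\<close> on which the group acts by \<open>\<chi>\<close> has a nonzero \<open>i\<close>-th coordinate only if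
     \<open>\<chi>\<close> is the character of the \<open>i\<close>-th factor.\<close>
  have eigen: "X i = \<chi>" if i: "i < n" and \<chi>: "\<chi> \<in> carrier DG" and a: "a \<in> carrier R" "\<Phi> a i \<noteq> \<zero>"
    and e: "\<And>h g. h \<in> carrier G \<Longrightarrow> g \<in> carrier G \<Longrightarrow> a (inv\<^bsub>G\<^esub> h *\<^sub>G g) = \<chi> h \<otimes> a g" for i \<chi> a
  proof (rule dual_eqI[OF X[OF i] \<chi>])
    fix h assume h: "h \<in> carrier G"
    have "b h \<otimes>\<^bsub>R\<^esub> a = \<chi> h \<odot>\<^bsub>R\<^esub> a"
      using h a e dual_char[OF \<chi>] by (intro R_eqI) (auto simp: translate smult)
    then have "\<Phi> (b h) i \<otimes> \<Phi> a i = \<chi> h \<otimes> \<Phi> a i"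
      using \<Phi>_mult[of "b h" a i] \<Phi>_smult[of "\<chi> h" a i] a h i dual_char[OF \<chi>] by simp
    then show "X i h = \<chi> h"
      using a i h dual_char[OF \<chi>] m_rcancel by (simp add: X_eq)
  qed
  define e where "e i = (SOME a. a \<in> carrier R \<and> \<Phi> a = (\<lambda>j \<in> {..<n}. if j = i then \<one> else \<zero>))" for i
  have e: "e i \<in> carrier R \<and> \<Phi> (e i) = (\<lambda>j \<in> {..<n}. if j = i then \<one> else \<zero>)" for i
  proof -
    have "(\<lambda>j \<in> {..<n}. if j = i then \<one> else \<zero>) \<in> {..<n} \<rightarrow>\<^sub>E carrier K" by auto
    then have "\<exists>a. a \<in> carrier R \<and> \<Phi> a = (\<lambda>j \<in> {..<n}. if j = i then \<one> else \<zero>)"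
      using bij unfolding bij_betw_def by (metis (no_types, lifting) imageE)
    then show ?thesis unfolding e_def by (rule someI_ex)
  qed
  then have e_closed [simp]: "e i \<in> carrier R" and e_eval: "j < n \<Longrightarrow> \<Phi> (e i) j = (if j = i then \<one> else \<zero>)" for i j
    by auto
  have e_translate: "e i (inv\<^bsub>G\<^esub> h *\<^sub>G g) = X i h \<otimes> e i g"
    if "i < n" and h: "h \<in> carrier G" and g: "g \<in> carrier G" for i h g
  proof -
    note [simp] = dual_char(1)[OF X[OF that(1)] h]
    have "b h \<otimes>\<^bsub>R\<^esub> e i = X i h \<odot>\<^bsub>R\<^esub> e i"
      using h that(1) by (intro \<Phi>_eqI mult_closed smult_closed) (auto simp: \<Phi>_mult \<Phi>_smult e_eval X_eq[symmetric] dual_char(1)[OF X])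
    then show ?thesis using translate[OF h e_closed g, of i] by (simp add: smult g)
  qed
  have e_char: "e i h = X i (inv\<^bsub>G\<^esub> h) \<otimes> e i \<one>\<^bsub>G\<^esub>" if "i < n" "h \<in> carrier G" for i h
    using e_translate[OF that(1), of "inv\<^bsub>G\<^esub> h" "\<one>\<^bsub>G\<^esub>"] that by simp
  define N where "N = (\<Oplus>g \<in> carrier G. \<one>)"
  have N [simp]: "N \<in> carrier K" unfolding N_def by (intro finsum_closed) auto
  have e_one: "N \<otimes> e i \<one>\<^bsub>G\<^esub> = \<one>" if i: "i < n" for i
  proof -
    define c where "c = e i \<one>\<^bsub>G\<^esub>"
    have c [simp]: "c \<in> carrier K" by (simp add: c_def)
    note [simp] = dual_char[OF X[OF i]]
    have "c \<noteq> \<zero>"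
    proof
      assume "c = \<zero>"
      then have "e i = \<zero> \<odot>\<^bsub>R\<^esub> \<one>\<^bsub>R\<^esub>"
        using i by (intro R_eqI) (auto simp: smult e_char[of i] c_def[symmetric])
      then have "\<Phi> (e i) i = \<zero>" using i by (simp add: \<Phi>_smult)
      then show False using i by (simp add: e_eval)
    qed
    have "e i \<otimes>\<^bsub>R\<^esub> e i = e i" using i by (intro \<Phi>_eqI) (auto simp: \<Phi>_mult e_eval)
    then have "c = (\<Oplus>h \<in> carrier G. e i h \<otimes> e i (inv\<^bsub>G\<^esub> h *\<^sub>G \<one>\<^bsub>G\<^esub>))"
      using mult[of "\<one>\<^bsub>G\<^esub>" "e i" "e i"] by (simp add: c_def)
    also have "\<dots> = (\<Oplus>h \<in> carrier G. (c \<otimes> c) \<otimes> \<one>)"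
    proof (rule finsum_cong')
      fix h assume [simp]: "h \<in> carrier G"
      have "e i h \<otimes> e i (inv\<^bsub>G\<^esub> h *\<^sub>G \<one>\<^bsub>G\<^esub>) = (X i (inv\<^bsub>G\<^esub> h) \<otimes> c) \<otimes> (X i h \<otimes> c)"
        using i e_char[of i h] e_char[of i "inv\<^bsub>G\<^esub> h"] by (simp add: c_def)
      also have "\<dots> = (X i h \<otimes> X i (inv\<^bsub>G\<^esub> h)) \<otimes> (c \<otimes> c)" by (simp del: dual_char add: dual_char(1)[OF X[OF i]] m_ac)
      finally show "e i h \<otimes> e i (inv\<^bsub>G\<^esub> h *\<^sub>G \<one>\<^bsub>G\<^esub>) = c \<otimes> c \<otimes> \<one>" by simp
    qed auto
    also have "\<dots> = (c \<otimes> c) \<otimes> N" unfolding N_def using fin by (intro finsum_rdistr[symmetric]) auto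
    finally have "c \<otimes> \<one> = c \<otimes> (N \<otimes> c)" by (simp add: m_ac)
    then show ?thesis using \<open>c \<noteq> \<zero>\<close> m_lcancel[of c \<one> "N \<otimes> c"] by (simp add: c_def)
  qed
  have "0 < n"
  proof (rule ccontr)
    assume "\<not> 0 < n"
    then have "\<one>\<^bsub>R\<^esub> = \<zero> \<odot>\<^bsub>R\<^esub> \<one>\<^bsub>R\<^esub>" by (intro \<Phi>_eqI) auto
    then have "\<one>\<^bsub>R\<^esub> \<one>\<^bsub>G\<^esub> = \<zero>" using smult[of "\<one>\<^bsub>G\<^esub>" \<zero> "\<one>\<^bsub>R\<^esub>"] by simp
    then show False by (simp add: one)
  qed
  define c where "c = e 0 \<one>\<^bsub>G\<^esub>"
  have c [simp]: "c \<in> carrier K" and Nc: "N \<otimes> c = \<one>" using e_one[OF \<open>0 < n\<close>] by (simp_all add: c_def)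
  have e_one_eq: "e i \<one>\<^bsub>G\<^esub> = c" if "i < n" for i
  proof -
    have "N \<noteq> \<zero>" using Nc by auto
    moreover have "N \<otimes> e i \<one>\<^bsub>G\<^esub> = N \<otimes> c" using e_one[OF that] Nc by simp
    ultimately show ?thesis using m_lcancel[of N "e i \<one>\<^bsub>G\<^esub>" c] by simp
  qed
  have X_inj: "inj_on X {..<n}"
  proof (rule inj_onI)
    fix i j assume ij: "i \<in> {..<n}" "j \<in> {..<n}" "X i = X j"
    then have "e i g = e j g" if "g \<in> carrier G" for g
      using e_char[of i g] e_char[of j g] that by (simp add: e_one_eq)
    then have "e i = e j" by (intro R_eqI e_closed)
    then have "\<Phi> (e i) i = \<Phi> (e j) i" by simp
    then show "i = j" using ij by (simp add: e_eval split: if_splits)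
  qed
  have X_surj: "X ` {..<n} = carrier DG"
  proof
    show "X ` {..<n} \<subseteq> carrier DG" using X by auto
    show "carrier DG \<subseteq> X ` {..<n}"
    proof
      fix \<chi> assume \<chi>: "\<chi> \<in> carrier DG"
      note [simp] = dual_char[OF \<chi>]
      define a where "a = (\<lambda>g \<in> carrier G. \<chi> (inv\<^bsub>G\<^esub> g))"
      have a: "a \<in> carrier R" by (auto simp: a_def mem_R)
      have "\<exists>i < n. \<Phi> a i \<noteq> \<zero>"
      proof (rule ccontr)
        assume "\<not> ?thesis"
        then have "a = \<zero> \<odot>\<^bsub>R\<^esub> \<one>\<^bsub>R\<^esub>" using a by (intro \<Phi>_eqI) (auto simp: \<Phi>_smult)
        then have "a \<one>\<^bsub>G\<^esub> = \<zero>" using smult[of "\<one>\<^bsub>G\<^esub>" \<zero> "\<one>\<^bsub>R\<^esub>"] by simp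
        then show False by (simp add: a_def)
      qed
      then obtain i where i: "i < n" "\<Phi> a i \<noteq> \<zero>" by blast
      have "X i = \<chi>"
        by (rule eigen[OF i(1) \<chi> a i(2)]) (simp add: a_def G.inv_mult_group m_comm)
      then show "\<chi> \<in> X ` {..<n}" using i by auto
    qed
  qed
  \<comment> \<open>The partial sums of the \<open>e i\<close> have the coordinates \<open>(1, \<dots>, 1, 0, \<dots>, 0)\<close>.\<close>
  have e_sum: "(\<Oplus>i \<in> {..<n}. e i g) = \<one>\<^bsub>R\<^esub> g" if g: "g \<in> carrier G" for g
  proof -
    define s where "s m = (\<lambda>g \<in> carrier G. \<Oplus>i \<in> {..<m}. e i g)" for m
    have s [simp]: "s m \<in> carrier R" for m
      using R_eval[OF e_closed] unfolding mem_R by (auto simp: s_def intro!: finsum_closed)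
    have "\<forall>j < n. \<Phi> (s m) j = (if j < m then \<one> else \<zero>)" for m
    proof (induction m)
      case 0
      have "s 0 = \<zero> \<odot>\<^bsub>R\<^esub> \<one>\<^bsub>R\<^esub>" by (intro R_eqI) (auto simp: smult, simp add: s_def)
      then show ?case by (simp add: \<Phi>_smult)
    next
      case (Suc m)
      have "s (Suc m) = e m \<oplus>\<^bsub>R\<^esub> s m"
        by (intro R_eqI) (auto simp: add, simp add: s_def lessThan_Suc)
      then show ?case using Suc by (auto simp: \<Phi>_add e_eval)
    qed
    then have "s n = \<one>\<^bsub>R\<^esub>" by (intro \<Phi>_eqI) (auto simp: \<Phi>_one)
    then show ?thesis using g by (metis (no_types, lifting) restrict_apply' s_def)
  qed
  show ?thesis
  proof (intro bexI[OF _ c] conjI ballI)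
    show fin_DG: "finite (carrier DG)" unfolding X_surj[symmetric] by simp
    fix g assume g [simp]: "g \<in> carrier G"
    have "(\<Oplus>\<chi> \<in> carrier DG. \<chi> g) = (\<Oplus>i \<in> {..<n}. X i g)"
      unfolding X_surj[symmetric] using X dual_char(1) by (intro finsum_reindex X_inj) auto
    then have "c \<otimes> (\<Oplus>\<chi> \<in> carrier DG. \<chi> g) = (\<Oplus>i \<in> {..<n}. c \<otimes> X i g)"
      using X dual_char(1) by (simp add: finsum_rdistr Pi_iff)
    also have "\<dots> = (\<Oplus>i \<in> {..<n}. e i (inv\<^bsub>G\<^esub> g))"
      using X dual_char(1) by (intro finsum_cong') (auto simp: e_char[of _ "inv\<^bsub>G\<^esub> g"] e_one_eq m_comm)
    also have "\<dots> = (if g = \<one>\<^bsub>G\<^esub> then \<one> else \<zero>)" by (simp add: e_sum one G.inv_eq_1_iff)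
    finally show "c \<otimes> (\<Oplus>\<chi> \<in> carrier DG. \<chi> g) = (if g = \<one>\<^bsub>G\<^esub> then \<one> else \<zero>)" .
  next
    fix \<chi> \<psi> assume \<chi>: "\<chi> \<in> carrier DG" and \<psi>: "\<psi> \<in> carrier DG"
    show "c \<otimes> (\<Oplus>g \<in> carrier G. \<chi> g \<otimes> \<psi> (inv\<^bsub>G\<^esub> g)) = (if \<chi> = \<psi> then \<one> else \<zero>)"
    proof (cases "\<chi> = \<psi>")
      case True
      have "(\<Oplus>g \<in> carrier G. \<chi> g \<otimes> \<psi> (inv\<^bsub>G\<^esub> g)) = N"
        unfolding N_def using dual_char[OF \<psi>] by (intro finsum_cong') (auto simp: True)
      then show ?thesis using True Nc by (simp add: m_comm)
    next
      case False
      then show ?thesis using sum_char_eq_zero[OF fin \<chi> \<psi>] by simp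
    qed
  qed
qed

end


section \<open>Equivariant endofunctors\<close>

text \<open>
  Isomorphism is studied for all linear equivariant endofunctors, not only for autoequivalences:
  their classes form a monoid, and \<open>Aut\<close> is its group of units.
\<close>

locale acted_category = linear_category K C + characters K G
  for K :: "('k, 'e) ring_scheme" (structure) and C :: "('k, 'o, 'm) lin_cat"
    and G :: "('g, 'f) monoid_scheme" and A :: "('g, 'o, 'm) cat_action" +
  assumes action: "linear_action K C G A"
begin

abbreviation "T \<equiv> act A"

definition eps :: "'g \<Rightarrow> 'g \<Rightarrow> 'o \<Rightarrow> ('o, 'm) arrow" where
  "eps g h = components (T g \<circ>\<^sub>F T h) (T (g *\<^sub>G h)) (str A g h)"

lemma eps_sel [simp]: "dm (eps g h X) = fob (T g) (fob (T h) X)" "cd (eps g h X) = fob (T (g *\<^sub>G h)) X"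
  "mp (eps g h X) = str A g h X"
  by (simp_all add: eps_def)

lemma act_autoequivalence [simp]: "g \<in> carrier G \<Longrightarrow> autoequivalence C (T g)"
  using action by (simp add: linear_action_def is_action_def)

lemma act_linear: "g \<in> carrier G \<Longrightarrow> linear_functor K C C (T g)"
  using action by (simp add: linear_action_def)

lemma act_functor [simp]: "g \<in> carrier G \<Longrightarrow> functor (T g)"
  by simp

lemma eps_nat_iso:
  assumes "g \<in> carrier G" "h \<in> carrier G"
  shows "nat_iso (T g \<circ>\<^sub>F T h) (T (g *\<^sub>G h)) (eps g h)"
proof -
  have "natural_iso C C (T g \<circ>\<^sub>F T h) (T (g *\<^sub>G h)) (str A g h)"
    using action assms by (simp add: linear_action_def is_action_def)
  then show ?thesis using assms natural_iso_iff[of "T g \<circ>\<^sub>F T h" "T (g *\<^sub>G h)"] by (simp add: eps_def)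
qed

lemma eps_simps [simp]:
  assumes "g \<in> carrier G" "h \<in> carrier G" "X \<in> Obj C"
  shows "invertible (eps g h X)" "arrow (eps g h X)"
  using nat_isoD[OF eps_nat_iso[OF assms(1,2)]] assms(3) by auto

lemma eps_natural:
  assumes "g \<in> carrier G" "h \<in> carrier G" "arrow a"
  shows "eps g h (cd a) \<cdot> T g \<star> T h \<star> a = (T (g *\<^sub>G h) \<star> a) \<cdot> eps g h (dm a)"
  using nat_isoD(5)[OF eps_nat_iso[OF assms(1,2)] assms(3)] by simp

lemma eps_assoc:
  assumes "g \<in> carrier G" "h \<in> carrier G" "l \<in> carrier G" "X \<in> Obj C"
  shows "eps (g *\<^sub>G h) l X \<cdot> eps g h (fob (T l) X) = eps g (h *\<^sub>G l) X \<cdot> T g \<star> eps h l X"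
  using action assms
  by (auto simp add: linear_action_def is_action_def Let_def cmp_def fap_def eps_def components_def G.m_assoc)

text \<open>The components \<open>\<delta>\<^sub>g\<close> of an equivariant functor as arrows, like \<open>\<epsilon>\<close> above.\<close>

definition dlt :: "('g, 'o, 'm) eq_fctr \<Rightarrow> 'g \<Rightarrow> 'o \<Rightarrow> ('o, 'm) arrow" where
  "dlt p g = components (fst p \<circ>\<^sub>F T g) (T g \<circ>\<^sub>F fst p) (snd p g)"

lemma dlt_sel [simp]: "dm (dlt p g X) = fob (fst p) (fob (T g) X)" "cd (dlt p g X) = fob (T g) (fob (fst p) X)"
  "mp (dlt p g X) = snd p g X"
  by (simp_all add: dlt_def)

definition coherent :: "('o, 'm, 'o, 'm) fctr \<Rightarrow> ('g \<Rightarrow> 'o \<Rightarrow> ('o, 'm) arrow) \<Rightarrow> bool" where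
  "coherent F d \<longleftrightarrow> (\<forall>g \<in> carrier G. nat_iso (F \<circ>\<^sub>F T g) (T g \<circ>\<^sub>F F) (d g)) \<and>
     (\<forall>g \<in> carrier G. \<forall>h \<in> carrier G. \<forall>X \<in> Obj C.
        d (g *\<^sub>G h) X \<cdot> F \<star> eps g h X = eps g h (fob F X) \<cdot> (T g \<star> d h X) \<cdot> d g (fob (T h) X))"

lemma equivariant_functor_iff:
  "equivariant_functor C G A p \<longleftrightarrow> functor (fst p) \<and> coherent (fst p) (dlt p)"
proof (cases p)
  case (Pair F d)
  have 1: "(\<forall>g \<in> carrier G. natural_iso C C (F \<circ>\<^sub>F T g) (T g \<circ>\<^sub>F F) (d g)) \<longleftrightarrow>
     (\<forall>g \<in> carrier G. nat_iso (F \<circ>\<^sub>F T g) (T g \<circ>\<^sub>F F) (dlt p g))" if "functor F"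
    using that natural_iso_iff by (auto simp: dlt_def Pair)
  have 2: "(\<forall>g \<in> carrier G. \<forall>h \<in> carrier G. \<forall>X \<in> Obj C.
     (let S = fob F (fob (T g) (fob (T h) X)); R = fob (T (g *\<^sub>G h)) (fob F X)
      in Comp C S (fob F (fob (T (g *\<^sub>G h)) X)) R (d (g *\<^sub>G h) X)
           (fmor F (fob (T g) (fob (T h) X)) (fob (T (g *\<^sub>G h)) X) (str A g h X)) =
         Comp C S (fob (T g) (fob (T h) (fob F X))) R (str A g h (fob F X))
           (Comp C S (fob (T g) (fob F (fob (T h) X))) (fob (T g) (fob (T h) (fob F X)))
             (fmor (T g) (fob F (fob (T h) X)) (fob (T h) (fob F X)) (d h X)) (d g (fob (T h) X)))))
    \<longleftrightarrow> (\<forall>g \<in> carrier G. \<forall>h \<in> carrier G. \<forall>X \<in> Obj C.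
        dlt p (g *\<^sub>G h) X \<cdot> F \<star> eps g h X = eps g h (fob F X) \<cdot> (T g \<star> dlt p h X) \<cdot> dlt p g (fob (T h) X))"
    by (simp add: Let_def cmp_def fap_def dlt_def components_def eps_def Pair)
  from 1 2 show ?thesis
    unfolding equivariant_functor_def coherent_def Pair fst_conv split_conv by blast
qed

definition endo :: "('g, 'o, 'm) eq_fctr \<Rightarrow> bool" where
  "endo p \<longleftrightarrow> equivariant_functor C G A p \<and> linear_functor K C C (fst p)"

lemma endoD:
  assumes "endo p"
  shows "functor (fst p)" "linear_functor K C C (fst p)"
    "g \<in> carrier G \<Longrightarrow> nat_iso (fst p \<circ>\<^sub>F T g) (T g \<circ>\<^sub>F fst p) (dlt p g)"
    "g \<in> carrier G \<Longrightarrow> h \<in> carrier G \<Longrightarrow> X \<in> Obj C \<Longrightarrow>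
      dlt p (g *\<^sub>G h) X \<cdot> fst p \<star> eps g h X =
        eps g h (fob (fst p) X) \<cdot> (T g \<star> dlt p h X) \<cdot> dlt p g (fob (T h) X)"
  using assms by (auto simp: endo_def equivariant_functor_iff coherent_def)

lemma endo_functor [simp]: "endo p \<Longrightarrow> functor (fst p)"
  by (rule endoD)

lemma dlt_simps [simp]:
  assumes "endo p" "g \<in> carrier G" "X \<in> Obj C"
  shows "invertible (dlt p g X)" "arrow (dlt p g X)"
  using nat_isoD[OF endoD(3)[OF assms(1,2)]] assms(3) by auto

lemma dlt_natural:
  assumes "endo p" "g \<in> carrier G" "arrow a"
  shows "dlt p g (cd a) \<cdot> fst p \<star> T g \<star> a = (T g \<star> fst p \<star> a) \<cdot> dlt p g (dm a)"
  using nat_isoD(5)[OF endoD(3)[OF assms(1,2)] assms(3)] by simp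

text \<open>
  Structures are constructed as arrows; the morphisms in them determine an equivariant functor.
\<close>

definition with_arrows :: "('o, 'm, 'o, 'm) fctr \<Rightarrow> ('g \<Rightarrow> 'o \<Rightarrow> ('o, 'm) arrow) \<Rightarrow> ('g, 'o, 'm) eq_fctr" where
  "with_arrows F d = (F, \<lambda>g X. mp (d g X))"

lemma fst_with_arrows [simp]: "fst (with_arrows F d) = F"
  by (simp add: with_arrows_def)

lemma dlt_with_arrows:
  assumes "coherent F d" "g \<in> carrier G" "X \<in> Obj C"
  shows "dlt (with_arrows F d) g X = d g X"
  unfolding dlt_def fst_with_arrows
  using assms nat_isoD(3,4)[of "F \<circ>\<^sub>F T g" "T g \<circ>\<^sub>F F" "d g" X]
  by (auto simp: with_arrows_def coherent_def intro!: arrow.expand)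

lemma coherent_cong:
  assumes F: "functor F" and d: "coherent F d"
    and e: "\<And>g X. g \<in> carrier G \<Longrightarrow> X \<in> Obj C \<Longrightarrow> d g X = d' g X"
  shows "coherent F d'"
  unfolding coherent_def
proof (intro conjI ballI)
  fix g assume g: "g \<in> carrier G"
  then show "nat_iso (F \<circ>\<^sub>F T g) (T g \<circ>\<^sub>F F) (d' g)"
    using d e by (auto simp: coherent_def intro: nat_iso_cong)
  fix h X assume [simp]: "h \<in> carrier G" "X \<in> Obj C"
  note [simp] = g
  show "d' (g *\<^sub>G h) X \<cdot> F \<star> eps g h X = eps g h (fob F X) \<cdot> (T g \<star> d' h X) \<cdot> d' g (fob (T h) X)"
    using d by (simp add: coherent_def e[symmetric])
qed

lemma endo_with_arrows:
  assumes "linear_functor K C C F" "coherent F d"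
  shows "endo (with_arrows F d)"
proof -
  have F: "functor F" using assms(1) by (simp add: linear_functor_def)
  have "coherent F (dlt (with_arrows F d))"
    by (rule coherent_cong[OF F assms(2)]) (simp add: dlt_with_arrows assms)
  then show ?thesis using assms F by (simp add: endo_def equivariant_functor_iff)
qed

definition intertwines :: "('g, 'o, 'm) eq_fctr \<Rightarrow> ('g, 'o, 'm) eq_fctr \<Rightarrow> ('o \<Rightarrow> ('o, 'm) arrow) \<Rightarrow> bool" where
  "intertwines p q t \<longleftrightarrow> nat_iso (fst p) (fst q) t \<and>
    (\<forall>g \<in> carrier G. \<forall>X \<in> Obj C. (T g \<star> t X) \<cdot> dlt p g X = dlt q g X \<cdot> t (fob (T g) X))"

lemma equivariant_iso_iff:
  assumes p: "functor (fst p)" and q: "functor (fst q)"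
  shows "equivariant_iso C G A p q \<longleftrightarrow> (\<exists>t. intertwines p q t)"
proof (cases p; cases q)
  fix F d L e assume pq: "p = (F, d)" "q = (L, e)"
  have 1: "equivariant_iso C G A p q \<longleftrightarrow> (\<exists>\<phi>. intertwines p q (components F L \<phi>))"
    using p q unfolding equivariant_iso_def intertwines_def pq
    by (simp add: natural_iso_iff cmp_def fap_def dlt_def components_def)
  have 2: "intertwines p q (components F L (\<lambda>X. mp (t X)))" if t: "intertwines p q t" for t
  proof -
    have n: "nat_iso F L t" using t by (simp add: intertwines_def pq)
    have e: "components F L (\<lambda>X. mp (t X)) X = t X" if "X \<in> Obj C" for X
      using nat_isoD(3,4)[OF n that] by (rule components_mp)
    have "nat_iso F L (components F L (\<lambda>X. mp (t X)))"
      by (rule nat_iso_cong[OF n]) (simp add: e)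
    then show ?thesis using t by (simp add: intertwines_def pq e)
  qed
  from 1 2 show ?thesis by blast
qed

lemma intertwinesI:
  assumes "nat_iso (fst p) (fst q) t"
    "\<And>g X. g \<in> carrier G \<Longrightarrow> X \<in> Obj C \<Longrightarrow> (T g \<star> t X) \<cdot> dlt p g X = dlt q g X \<cdot> t (fob (T g) X)"
  shows "intertwines p q t"
  using assms by (simp add: intertwines_def)

lemma intertwinesD:
  assumes "intertwines p q t"
  shows "nat_iso (fst p) (fst q) t"
    "g \<in> carrier G \<Longrightarrow> X \<in> Obj C \<Longrightarrow> (T g \<star> t X) \<cdot> dlt p g X = dlt q g X \<cdot> t (fob (T g) X)"
  using assms by (auto simp: intertwines_def)

definition isomorphic (infix \<open>\<approx>\<close> 50) where
  "p \<approx> q \<longleftrightarrow> endo p \<and> endo q \<and> (\<exists>t. intertwines p q t)"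

lemma isomorphicI: "endo p \<Longrightarrow> endo q \<Longrightarrow> intertwines p q t \<Longrightarrow> p \<approx> q"
  by (auto simp: isomorphic_def)

lemma isomorphic_refl: "endo p \<Longrightarrow> p \<approx> p"
  by (rule isomorphicI[where t = "\<lambda>X. ide (fob (fst p) X)"])
    (auto intro!: intertwinesI nat_iso_ide)

text \<open>
  Functors with equal values on the category may still differ as records, which also have values
  at arguments outside the category.
\<close>

lemma isomorphic_if_eq:
  assumes p: "endo p" and q: "endo q" and "\<And>X. X \<in> Obj C \<Longrightarrow> fob (fst p) X = fob (fst q) X"
    "\<And>a. arrow a \<Longrightarrow> fst p \<star> a = fst q \<star> a"
    "\<And>g X. g \<in> carrier G \<Longrightarrow> X \<in> Obj C \<Longrightarrow> dlt p g X = dlt q g X"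
  shows "p \<approx> q"
proof (rule isomorphicI[OF p q])
  show "intertwines p q (\<lambda>X. ide (fob (fst p) X))"
    using assms by (auto intro!: intertwinesI nat_isoI simp: arr_fap[OF endo_functor[OF q]])
qed

lemma isomorphic_sym:
  assumes "p \<approx> q"
  shows "q \<approx> p"
proof -
  from assms obtain t where pq [simp]: "endo p" "endo q" and t: "intertwines p q t"
    by (auto simp: isomorphic_def)
  note n = intertwinesD(1)[OF t]
  note [simp] = nat_isoD(1-4)[OF n]
  show ?thesis
  proof (rule isomorphicI[OF _ _ intertwinesI])
    fix g X assume gX [simp]: "g \<in> carrier G" "X \<in> Obj C"
    have "inv_arr (T g \<star> t X) \<cdot> dlt q g X = dlt p g X \<cdot> inv_arr (t (fob (T g) X))"
      by (rule inva_switch) (simp_all add: intertwinesD(2)[OF t])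
    then show "(T g \<star> inv_arr (t X)) \<cdot> dlt q g X = dlt p g X \<cdot> inv_arr (t (fob (T g) X))"
      by (simp add: fap_inva)
  qed (auto intro: nat_iso_inv n)
qed

lemma isomorphic_trans:
  assumes "p \<approx> q" "q \<approx> r"
  shows "p \<approx> r"
proof -
  from assms obtain t s where pq [simp]: "endo p" "endo q" "endo r"
    and t: "intertwines p q t" and s: "intertwines q r s"
    by (auto simp: isomorphic_def)
  note n = intertwinesD(1)[OF t] intertwinesD(1)[OF s]
  note [simp] = nat_isoD(1-4)[OF n(1)] nat_isoD(1-4)[OF n(2)]
  show ?thesis
  proof (rule isomorphicI[OF _ _ intertwinesI])
    fix g X assume gX [simp]: "g \<in> carrier G" "X \<in> Obj C"
    have "(T g \<star> (s X \<cdot> t X)) \<cdot> dlt p g X = (T g \<star> s X) \<cdot> dlt q g X \<cdot> t (fob (T g) X)"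
      by (simp add: fap_cmp cmp_assoc intertwinesD(2)[OF t])
    also have "\<dots> = (dlt r g X \<cdot> s (fob (T g) X)) \<cdot> t (fob (T g) X)"
      by (simp add: cmp_assoc[symmetric] intertwinesD(2)[OF s])
    finally show "(T g \<star> (s X \<cdot> t X)) \<cdot> dlt p g X = dlt r g X \<cdot> s (fob (T g) X) \<cdot> t (fob (T g) X)"
      by (simp add: cmp_assoc)
  qed (simp_all add: nat_iso_vcomp[OF _ _ _ n])
qed

abbreviation "one_endo \<equiv> eq_id C A"
abbreviation comp_endo (infixl \<open>\<diamondop>\<close> 65) where "p \<diamondop> q \<equiv> eq_comp C A p q"

lemma fst_comp_endo [simp]: "fst (p \<diamondop> q) = fst p \<circ>\<^sub>F fst q"
  by (simp add: eq_comp_def split: prod.split)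

lemma fst_one_endo [simp]: "fst one_endo = id_fctr"
  by (simp add: eq_id_def)

lemma dlt_comp_endo [simp]: "dlt (p \<diamondop> q) g X = dlt p g (fob (fst q) X) \<cdot> fst p \<star> dlt q g X"
  by (simp add: eq_comp_def dlt_def components_def cmp_def fap_def split: prod.split)

lemma dlt_one_endo [simp]: "dlt one_endo g X = ide (fob (T g) X)"
  by (simp add: eq_id_def dlt_def components_def ida_def)

lemma linear_functor_comp:
  assumes "linear_functor K C C F" "linear_functor K C C L"
  shows "linear_functor K C C (F \<circ>\<^sub>F L)"
proof -
  have f: "functor F" "functor L" using assms by (auto simp: linear_functor_def)
  have "fmor L X Y f \<in> Mor C (fob L X) (fob L Y)" if "X \<in> Obj C" "Y \<in> Obj C" "f \<in> Mor C X Y" for X Y f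
    using f(2) that by (simp add: is_functor_def)
  then show ?thesis
    using assms f functor_comp[of F L] fob_closed[of L] unfolding linear_functor_def
    by (simp add: comp_fctr_def)
qed

lemma endo_one [simp]: "endo one_endo"
  unfolding endo_def equivariant_functor_iff coherent_def
  by (auto simp: linear_functor_def intro!: nat_isoI) (auto simp: id_fctr_def)

lemma endo_comp [simp]:
  assumes [simp]: "endo p" "endo q"
  shows "endo (p \<diamondop> q)"
  unfolding endo_def equivariant_functor_iff coherent_def
proof (intro conjI ballI)
  show "linear_functor K C C (fst (p \<diamondop> q))"
    by (simp add: linear_functor_comp endoD(2))
  fix g assume [simp]: "g \<in> carrier G"
  show "nat_iso (fst (p \<diamondop> q) \<circ>\<^sub>F T g) (T g \<circ>\<^sub>F fst (p \<diamondop> q)) (dlt (p \<diamondop> q) g)"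
  proof (rule nat_isoI)
    fix a assume [simp]: "arrow a"
    have "dlt (p \<diamondop> q) g (cd a) \<cdot> (fst (p \<diamondop> q) \<circ>\<^sub>F T g) \<star> a =
        dlt p g (fob (fst q) (cd a)) \<cdot> fst p \<star> (dlt q g (cd a) \<cdot> fst q \<star> T g \<star> a)"
      by (simp add: fap_cmp cmp_assoc)
    also have "\<dots> = (dlt p g (cd (fst q \<star> a)) \<cdot> fst p \<star> T g \<star> fst q \<star> a) \<cdot> fst p \<star> dlt q g (dm a)"
      by (simp add: dlt_natural fap_cmp cmp_assoc)
    also have "\<dots> = ((T g \<star> fst p \<star> fst q \<star> a) \<cdot> dlt p g (fob (fst q) (dm a))) \<cdot> fst p \<star> dlt q g (dm a)"
      by (subst dlt_natural) simp_all
    finally show "dlt (p \<diamondop> q) g (cd a) \<cdot> (fst (p \<diamondop> q) \<circ>\<^sub>F T g) \<star> a =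
        ((T g \<circ>\<^sub>F fst (p \<diamondop> q)) \<star> a) \<cdot> dlt (p \<diamondop> q) g (dm a)"
      by (simp add: cmp_assoc)
  qed simp_all
  fix h X assume [simp]: "h \<in> carrier G" "X \<in> Obj C"
  let ?P = "fst p" and ?Q = "fst q"
  have "dlt (p \<diamondop> q) (g *\<^sub>G h) X \<cdot> fst (p \<diamondop> q) \<star> eps g h X
    = dlt p (g *\<^sub>G h) (fob ?Q X) \<cdot> ?P \<star> (dlt q (g *\<^sub>G h) X \<cdot> ?Q \<star> eps g h X)"
    by (simp add: fap_cmp cmp_assoc)
  also have "\<dots> = (dlt p (g *\<^sub>G h) (fob ?Q X) \<cdot> ?P \<star> eps g h (fob ?Q X)) \<cdot>
      (?P \<star> T g \<star> dlt q h X) \<cdot> ?P \<star> dlt q g (fob (T h) X)"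
    by (simp add: endoD(4)[OF assms(2)] fap_cmp cmp_assoc)
  also have "\<dots> = eps g h (fob ?P (fob ?Q X)) \<cdot> (T g \<star> dlt p h (fob ?Q X)) \<cdot>
      (dlt p g (fob (T h) (fob ?Q X)) \<cdot> (?P \<star> T g \<star> dlt q h X)) \<cdot> ?P \<star> dlt q g (fob (T h) X)"
    by (simp add: endoD(4)[OF assms(1)] cmp_assoc)
  also have "dlt p g (fob (T h) (fob ?Q X)) \<cdot> (?P \<star> T g \<star> dlt q h X) =
      (T g \<star> ?P \<star> dlt q h X) \<cdot> dlt p g (fob ?Q (fob (T h) X))"
    using dlt_natural[OF assms(1), of g "dlt q h X"] by simp
  finally show "dlt (p \<diamondop> q) (g *\<^sub>G h) X \<cdot> fst (p \<diamondop> q) \<star> eps g h X =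
     eps g h (fob (fst (p \<diamondop> q)) X) \<cdot> (T g \<star> dlt (p \<diamondop> q) h X) \<cdot> dlt (p \<diamondop> q) g (fob (T h) X)"
    by (simp add: fap_cmp cmp_assoc)
qed simp_all

lemma isomorphic_endo: "p \<approx> q \<Longrightarrow> endo p" "p \<approx> q \<Longrightarrow> endo q"
  by (auto simp: isomorphic_def)

lemma comp_endo_cong:
  assumes "p \<approx> p'" "q \<approx> q'"
  shows "p \<diamondop> q \<approx> p' \<diamondop> q'"
proof -
  from assms obtain t s where pq [simp]: "endo p" "endo p'" "endo q" "endo q'"
    and t: "intertwines p p' t" and s: "intertwines q q' s"
    by (auto simp: isomorphic_def)
  note n = intertwinesD(1)[OF t] intertwinesD(1)[OF s]
  note [simp] = nat_isoD(1-4)[OF n(1)] nat_isoD(1-4)[OF n(2)]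
  show ?thesis
  proof (rule isomorphicI[OF _ _ intertwinesI])
    show "nat_iso (fst (p \<diamondop> q)) (fst (p' \<diamondop> q')) (\<lambda>X. t (fob (fst q') X) \<cdot> fst p \<star> s X)"
      using nat_iso_vcomp[OF _ _ _ nat_iso_whisker_left[OF _ _ _ n(2), of "fst p"]
          nat_iso_whisker_right[OF _ n(1), of "fst q'"]] by simp
    fix g X assume gX [simp]: "g \<in> carrier G" "X \<in> Obj C"
    have "(T g \<star> (t (fob (fst q') X) \<cdot> fst p \<star> s X)) \<cdot> dlt (p \<diamondop> q) g X
       = (T g \<star> t (fob (fst q') X)) \<cdot> ((T g \<star> fst p \<star> s X) \<cdot> dlt p g (fob (fst q) X)) \<cdot> fst p \<star> dlt q g X"
      by (simp add: fap_cmp cmp_assoc)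
    also have "(T g \<star> fst p \<star> s X) \<cdot> dlt p g (fob (fst q) X) = dlt p g (fob (fst q') X) \<cdot> fst p \<star> T g \<star> s X"
      using dlt_natural[of p g "s X"] by simp
    also have "(T g \<star> t (fob (fst q') X)) \<cdot> (dlt p g (fob (fst q') X) \<cdot> fst p \<star> T g \<star> s X) \<cdot> fst p \<star> dlt q g X
       = ((T g \<star> t (fob (fst q') X)) \<cdot> dlt p g (fob (fst q') X)) \<cdot> fst p \<star> ((T g \<star> s X) \<cdot> dlt q g X)"
      by (simp add: fap_cmp cmp_assoc)
    also have "\<dots> = (dlt p' g (fob (fst q') X) \<cdot> t (fob (T g) (fob (fst q') X))) \<cdot> fst p \<star> (dlt q' g X \<cdot> s (fob (T g) X))"
      by (simp add: intertwinesD(2)[OF t] intertwinesD(2)[OF s])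
    also have "\<dots> = dlt p' g (fob (fst q') X) \<cdot> (t (fob (T g) (fob (fst q') X)) \<cdot> fst p \<star> dlt q' g X) \<cdot> fst p \<star> s (fob (T g) X)"
      by (simp add: fap_cmp cmp_assoc)
    also have "t (fob (T g) (fob (fst q') X)) \<cdot> fst p \<star> dlt q' g X
        = (fst p' \<star> dlt q' g X) \<cdot> t (fob (fst q') (fob (T g) X))"
      using nat_isoD(5)[OF n(1), of "dlt q' g X"] by simp
    finally show "(T g \<star> (t (fob (fst q') X) \<cdot> fst p \<star> s X)) \<cdot> dlt (p \<diamondop> q) g X
       = dlt (p' \<diamondop> q') g X \<cdot> t (fob (fst q') (fob (T g) X)) \<cdot> fst p \<star> s (fob (T g) X)"
      by (simp add: cmp_assoc)
  qed simp_all
qed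

lemma comp_endo_assoc:
  assumes [simp]: "endo p" "endo q" "endo r"
  shows "p \<diamondop> q \<diamondop> r \<approx> p \<diamondop> (q \<diamondop> r)"
  by (rule isomorphic_if_eq) (simp_all add: fap_cmp cmp_assoc)

lemma comp_endo_one:
  assumes [simp]: "endo p"
  shows "one_endo \<diamondop> p \<approx> p" "p \<diamondop> one_endo \<approx> p"
  by (rule isomorphic_if_eq; simp)+

end


context linear_category begin

text \<open>As \<open>F F' \<cong> 1\<close> is linear and \<open>F\<close> is linear and faithful, \<open>F'\<close> is linear.\<close>

lemma linear_quasi_inverse:
  assumes F: "linear_functor K C C F" and aF: "autoequivalence C F" and F': "functor F'"
    and s: "nat_iso (F \<circ>\<^sub>F F') id_fctr s"
  shows "linear_functor K C C F'"
proof -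
  have [simp]: "functor F" using aF by simp
  note [simp] = F' nat_isoD(1-4)[OF s]
  have unique: "fmor F' X Y f = m"
    if X: "X \<in> Obj C" "Y \<in> Obj C" and f: "f \<in> Mor C X Y" and m: "m \<in> Mor C (fob F' X) (fob F' Y)"
      and eq: "s Y \<cdot> F \<star> Arrow (fob F' X) (fob F' Y) m = Arrow X Y f \<cdot> s X" for X Y f m
  proof -
    have arrows [simp]: "arrow (Arrow X Y f)" "arrow (Arrow (fob F' X) (fob F' Y) m)"
      using X f m by (simp_all add: arr_def)
    have "s Y \<cdot> F \<star> F' \<star> Arrow X Y f = Arrow X Y f \<cdot> s X"
      using nat_isoD(5)[OF s, of "Arrow X Y f"] by simp
    with eq have "s Y \<cdot> F \<star> F' \<star> Arrow X Y f = s Y \<cdot> F \<star> Arrow (fob F' X) (fob F' Y) m" by simp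
    then have "F \<star> F' \<star> Arrow X Y f = F \<star> Arrow (fob F' X) (fob F' Y) m"
      by (rule iso_cancel_left[of "s Y"]) (simp_all add: X)
    then have "F' \<star> Arrow X Y f = Arrow (fob F' X) (fob F' Y) m"
      by (rule autoequivalence_faithful[OF aF]) (simp_all add: X)
    then show ?thesis by (simp add: fap_def)
  qed
  have nat: "Comp C (fob F (fob F' X)) (fob F (fob F' Y)) Y (mp (s Y)) (fmor F (fob F' X) (fob F' Y) (fmor F' X Y f))
      = Comp C (fob F (fob F' X)) X Y f (mp (s X))"
    if "X \<in> Obj C" "Y \<in> Obj C" "f \<in> Mor C X Y" for X Y f
  proof -
    have "arrow (Arrow X Y f)" using that by (simp add: arr_def)
    then show ?thesis using nat_isoD(5)[OF s, of "Arrow X Y f"] that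
      by (simp add: cmp_def fap_def comp_fctr_def id_fctr_def)
  qed
  have s_mor: "mp (s X) \<in> Mor C (fob F (fob F' X)) X" if "X \<in> Obj C" for X
    using nat_isoD(2)[OF s that] that by (simp add: arr_def)
  have F'_mor: "fmor F' X Y f \<in> Mor C (fob F' X) (fob F' Y)" if "X \<in> Obj C" "Y \<in> Obj C" "f \<in> Mor C X Y" for X Y f
    using F' that by (simp add: is_functor_def)
  have F_mor: "fmor F X Y f \<in> Mor C (fob F X) (fob F Y)" if "X \<in> Obj C" "Y \<in> Obj C" "f \<in> Mor C X Y" for X Y f
    using \<open>functor F\<close> that by (simp add: is_functor_def)
  show ?thesis
    unfolding linear_functor_def
  proof (intro conjI ballI)
    fix X Y f assume X [simp]: "X \<in> Obj C" "Y \<in> Obj C" and f: "f \<in> Mor C X Y"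
    interpret H: module K "Hom C X Y" by (rule Hom_module[OF X])
    interpret H': module K "Hom C (fob F' X) (fob F' Y)" by (rule Hom_module) simp_all
    {
      fix g assume g: "g \<in> Mor C X Y"
      show "fmor F' X Y (f \<oplus>\<^bsub>Hom C X Y\<^esub> g) = fmor F' X Y f \<oplus>\<^bsub>Hom C (fob F' X) (fob F' Y)\<^esub> fmor F' X Y g"
      proof (rule unique)
        show "s Y \<cdot> F \<star> Arrow (fob F' X) (fob F' Y) (fmor F' X Y f \<oplus>\<^bsub>Hom C (fob F' X) (fob F' Y)\<^esub> fmor F' X Y g)
          = Arrow X Y (f \<oplus>\<^bsub>Hom C X Y\<^esub> g) \<cdot> s X"
          using F f g by (simp add: linear_functor_def cmp_def fap_def Comp_add_left Comp_add_right
              s_mor F'_mor F_mor nat)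
      qed (use f g F'_mor in auto)
    next
      fix c assume c: "c \<in> carrier K"
      show "fmor F' X Y (c \<odot>\<^bsub>Hom C X Y\<^esub> f) = c \<odot>\<^bsub>Hom C (fob F' X) (fob F' Y)\<^esub> fmor F' X Y f"
      proof (rule unique)
        show "s Y \<cdot> F \<star> Arrow (fob F' X) (fob F' Y) (c \<odot>\<^bsub>Hom C (fob F' X) (fob F' Y)\<^esub> fmor F' X Y f)
          = Arrow X Y (c \<odot>\<^bsub>Hom C X Y\<^esub> f) \<cdot> s X"
          using F f c by (simp add: linear_functor_def cmp_def fap_def Comp_smult_left Comp_smult_right
              s_mor F'_mor F_mor nat)
      qed (use f c F'_mor in auto)
    }
  qed (fact F')
qed

end

context acted_category begin

text \<open>
  The structure of the quasi-inverse \<open>F'\<close> is the unique one for which \<open>s : F F' \<rightarrow> 1\<close> is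
  equivariant. The condition prescribes the images under \<open>F\<close> of the structure arrows, and \<open>F\<close> is
  full and faithful.
\<close>

lemma equivariant_right_inverse:
  assumes p [simp]: "endo p" and ap [simp]: "autoequivalence C (fst p)"
  shows "\<exists>q. endo q \<and> autoequivalence C (fst q) \<and> p \<diamondop> q \<approx> one_endo"
proof -
  define F where "F = fst p"
  have F [simp]: "autoequivalence C F" "functor F" and fst_p [simp]: "fst p = F"
    using ap by (simp_all add: F_def)
  obtain F' t s where F' [simp]: "functor F'" and t: "nat_iso (F' \<circ>\<^sub>F F) id_fctr t"
    and s: "nat_iso (F \<circ>\<^sub>F F') id_fctr s"
    using F(1) unfolding autoequivalence_iff by blast
  note [simp] = nat_isoD(1-4)[OF s]
  have s_nat: "s (cd a) \<cdot> F \<star> F' \<star> a = a \<cdot> s (dm a)" if "arrow a" for a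
    using nat_isoD(5)[OF s that] by simp
  define k where "k g X = (T g \<star> s X) \<cdot> dlt p g (fob F' X)" for g X
  have k [simp]: "invertible (k g X)" "dm (k g X) = fob F (fob (T g) (fob F' X))" "cd (k g X) = fob (T g) X"
    if "g \<in> carrier G" "X \<in> Obj C" for g X
    using that by (simp_all add: k_def)
  have "\<forall>g X. \<exists>e. g \<in> carrier G \<and> X \<in> Obj C \<longrightarrow> arrow e \<and> dm e = fob F' (fob (T g) X) \<and>
      cd e = fob (T g) (fob F' X) \<and> F \<star> e = inv_arr (k g X) \<cdot> s (fob (T g) X)"
    using autoequivalence_full[OF F(1)] by simp
  then obtain d where d: "\<And>g X. g \<in> carrier G \<Longrightarrow> X \<in> Obj C \<Longrightarrow>
      arrow (d g X) \<and> dm (d g X) = fob F' (fob (T g) X) \<and>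
      cd (d g X) = fob (T g) (fob F' X) \<and> F \<star> d g X = inv_arr (k g X) \<cdot> s (fob (T g) X)"
    by metis
  have d_sel [simp]: "arrow (d g X)" "dm (d g X) = fob F' (fob (T g) X)" "cd (d g X) = fob (T g) (fob F' X)"
    if "g \<in> carrier G" "X \<in> Obj C" for g X
    using d that by auto
  have kd: "k g X \<cdot> F \<star> d g X = s (fob (T g) X)" if "g \<in> carrier G" "X \<in> Obj C" for g X
    using d[OF that] that by simp
  have d_iso [simp]: "invertible (d g X)" if "g \<in> carrier G" "X \<in> Obj C" for g X
    using autoequivalence_reflects_iso[OF F(1), of "d g X"] d[OF that] that by simp
  \<comment> \<open>The structure \<open>d g X\<close> is only known through \<open>kd\<close>; equations for it are proved in that form.\<close>
  have eqI: "a = b" if "k g X \<cdot> F \<star> a = k g X \<cdot> F \<star> b" "g \<in> carrier G" "X \<in> Obj C" "arrow a" "arrow b"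
    "dm a = dm b" "cd a = fob (T g) (fob F' X)" "cd b = fob (T g) (fob F' X)" for a b g X
    by (rule autoequivalence_faithful[OF F(1) iso_cancel_left[OF that(1)]]) (use that in simp_all)
  have k_nat: "k g (cd a) \<cdot> F \<star> T g \<star> F' \<star> a = (T g \<star> a) \<cdot> k g (dm a)"
    if [simp]: "g \<in> carrier G" "arrow a" for g a
  proof -
    have "k g (cd a) \<cdot> F \<star> T g \<star> F' \<star> a = (T g \<star> s (cd a)) \<cdot> dlt p g (cd (F' \<star> a)) \<cdot> fst p \<star> T g \<star> F' \<star> a"
      by (simp add: k_def cmp_assoc)
    also have "\<dots> = (T g \<star> (s (cd a) \<cdot> F \<star> F' \<star> a)) \<cdot> dlt p g (fob F' (dm a))"
      by (subst dlt_natural) (simp_all add: fap_cmp cmp_assoc)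
    finally show ?thesis by (simp add: s_nat fap_cmp k_def cmp_assoc)
  qed
  have coh: "coherent F' d"
    unfolding coherent_def
  proof (intro conjI ballI)
    fix g assume g [simp]: "g \<in> carrier G"
    show "nat_iso (F' \<circ>\<^sub>F T g) (T g \<circ>\<^sub>F F') (d g)"
    proof (rule nat_isoI)
      fix a assume [simp]: "arrow a"
      have "k g (cd a) \<cdot> F \<star> (d g (cd a) \<cdot> F' \<star> T g \<star> a) = (k g (cd a) \<cdot> F \<star> d g (cd a)) \<cdot> F \<star> F' \<star> T g \<star> a"
        by (simp add: fap_cmp cmp_assoc)
      also have "\<dots> = (T g \<star> a) \<cdot> s (fob (T g) (dm a))"
        using s_nat[of "T g \<star> a"] by (simp add: kd)
      also have "\<dots> = ((T g \<star> a) \<cdot> k g (dm a)) \<cdot> F \<star> d g (dm a)"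
        by (simp add: cmp_assoc kd)
      also have "\<dots> = k g (cd a) \<cdot> F \<star> ((T g \<star> F' \<star> a) \<cdot> d g (dm a))"
        by (simp add: k_nat[symmetric] fap_cmp cmp_assoc)
      finally have "d g (cd a) \<cdot> F' \<star> T g \<star> a = (T g \<star> F' \<star> a) \<cdot> d g (dm a)"
        by (rule eqI) simp_all
      then show "d g (cd a) \<cdot> (F' \<circ>\<^sub>F T g) \<star> a = ((T g \<circ>\<^sub>F F') \<star> a) \<cdot> d g (dm a)" by simp
    qed simp_all
    fix h X assume [simp]: "h \<in> carrier G" "X \<in> Obj C"
    have k2: "k (g *\<^sub>G h) X \<cdot> F \<star> eps g h (fob F' X) = eps g h X \<cdot> (T g \<star> k h X) \<cdot> dlt p g (fob (T h) (fob F' X))"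
    proof -
      have "k (g *\<^sub>G h) X \<cdot> F \<star> eps g h (fob F' X) =
          (T (g *\<^sub>G h) \<star> s X) \<cdot> dlt p (g *\<^sub>G h) (fob F' X) \<cdot> fst p \<star> eps g h (fob F' X)"
        by (simp add: k_def cmp_assoc)
      also have "\<dots> = ((T (g *\<^sub>G h) \<star> s X) \<cdot> eps g h (dm (s X))) \<cdot>
          (T g \<star> dlt p h (fob F' X)) \<cdot> dlt p g (fob (T h) (fob F' X))"
        by (subst endoD(4)[OF p]) (simp_all add: cmp_assoc)
      also have "\<dots> = (eps g h X \<cdot> T g \<star> T h \<star> s X) \<cdot>
          (T g \<star> dlt p h (fob F' X)) \<cdot> dlt p g (fob (T h) (fob F' X))"
        by (subst eps_natural[symmetric]) simp_all
      finally show ?thesis by (simp add: k_def fap_cmp cmp_assoc)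
    qed
    have "k (g *\<^sub>G h) X \<cdot> F \<star> (d (g *\<^sub>G h) X \<cdot> F' \<star> eps g h X) =
        (k (g *\<^sub>G h) X \<cdot> F \<star> d (g *\<^sub>G h) X) \<cdot> F \<star> F' \<star> eps g h X"
      by (simp add: fap_cmp cmp_assoc)
    also have "\<dots> = eps g h X \<cdot> s (fob (T g) (fob (T h) X))"
      using s_nat[of "eps g h X"] by (simp add: kd)
    also have "\<dots> = eps g h X \<cdot> (T g \<star> s (fob (T h) X)) \<cdot> dlt p g (fob F' (fob (T h) X)) \<cdot> F \<star> d g (fob (T h) X)"
      using kd[of g "fob (T h) X"] by (simp add: k_def cmp_assoc)
    also have "\<dots> = eps g h X \<cdot> (T g \<star> k h X) \<cdot> ((T g \<star> F \<star> d h X) \<cdot> dlt p g (dm (d h X))) \<cdot> F \<star> d g (fob (T h) X)"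
      by (simp add: kd[symmetric] fap_cmp cmp_assoc)
    also have "(T g \<star> F \<star> d h X) \<cdot> dlt p g (dm (d h X)) = dlt p g (fob (T h) (fob F' X)) \<cdot> F \<star> T g \<star> d h X"
      using dlt_natural[OF p, of g "d h X"] by simp
    also have "eps g h X \<cdot> (T g \<star> k h X) \<cdot> (dlt p g (fob (T h) (fob F' X)) \<cdot> F \<star> T g \<star> d h X) \<cdot> F \<star> d g (fob (T h) X)
       = (eps g h X \<cdot> (T g \<star> k h X) \<cdot> dlt p g (fob (T h) (fob F' X))) \<cdot> F \<star> ((T g \<star> d h X) \<cdot> d g (fob (T h) X))"
      by (simp add: fap_cmp cmp_assoc)
    also have "\<dots> = k (g *\<^sub>G h) X \<cdot> F \<star> (eps g h (fob F' X) \<cdot> (T g \<star> d h X) \<cdot> d g (fob (T h) X))"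
      by (simp add: k2[symmetric] fap_cmp cmp_assoc)
    finally show "d (g *\<^sub>G h) X \<cdot> F' \<star> eps g h X = eps g h (fob F' X) \<cdot> (T g \<star> d h X) \<cdot> d g (fob (T h) X)"
      by (rule eqI) simp_all
  qed
  have lin: "linear_functor K C C F'"
    by (rule linear_quasi_inverse[OF _ _ _ s]) (use endoD(2)[OF p] in simp_all)
  define q where "q = with_arrows F' d"
  have [simp]: "endo q" "fst q = F'" using endo_with_arrows[OF lin coh] by (simp_all add: q_def)
  have [simp]: "dlt q g X = d g X" if "g \<in> carrier G" "X \<in> Obj C" for g X
    using dlt_with_arrows[OF coh] that by (simp add: q_def)
  have "p \<diamondop> q \<approx> one_endo"
  proof (rule isomorphicI)
    show "intertwines (p \<diamondop> q) one_endo s"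
    proof (rule intertwinesI)
      fix g X assume gX [simp]: "g \<in> carrier G" "X \<in> Obj C"
      show "(T g \<star> s X) \<cdot> dlt (p \<diamondop> q) g X = dlt one_endo g X \<cdot> s (fob (T g) X)"
        using kd[OF gX] by (simp add: k_def cmp_assoc)
    qed (use s in simp)
  qed simp_all
  moreover have "autoequivalence C F'"
    unfolding autoequivalence_iff using F(2) F' s t by blast
  ultimately show ?thesis by (intro exI[of _ q]) simp
qed

lemma equivariant_inverse:
  assumes p [simp]: "endo p" and ap [simp]: "autoequivalence C (fst p)"
  shows "\<exists>q. endo q \<and> autoequivalence C (fst q) \<and> p \<diamondop> q \<approx> one_endo \<and> q \<diamondop> p \<approx> one_endo"
proof -
  obtain q where q [simp]: "endo q" "autoequivalence C (fst q)" and pq: "p \<diamondop> q \<approx> one_endo"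
    using equivariant_right_inverse[OF p ap] by blast
  obtain r where r [simp]: "endo r" and qr: "q \<diamondop> r \<approx> one_endo"
    using equivariant_right_inverse[OF q] by blast
  note [trans] = isomorphic_trans
  \<comment> \<open>A right inverse that itself has a right inverse is a left inverse.\<close>
  have "r \<approx> one_endo \<diamondop> r" by (rule isomorphic_sym) (simp add: comp_endo_one)
  also have "one_endo \<diamondop> r \<approx> p \<diamondop> q \<diamondop> r"
    by (intro comp_endo_cong isomorphic_sym[OF pq] isomorphic_refl) simp
  also have "p \<diamondop> q \<diamondop> r \<approx> p \<diamondop> (q \<diamondop> r)" by (rule comp_endo_assoc) simp_all
  also have "p \<diamondop> (q \<diamondop> r) \<approx> p \<diamondop> one_endo"
    by (intro comp_endo_cong qr isomorphic_refl) simp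
  also have "p \<diamondop> one_endo \<approx> p" by (simp add: comp_endo_one)
  finally have "r \<approx> p" .
  then have "q \<diamondop> p \<approx> q \<diamondop> r" by (rule comp_endo_cong[OF isomorphic_refl[OF q(1)] isomorphic_sym])
  then have "q \<diamondop> p \<approx> one_endo" using qr by (rule isomorphic_trans)
  then show ?thesis using q pq by blast
qed

lemma autoequivalence_if_inverse:
  assumes "p \<diamondop> q \<approx> one_endo" "q \<diamondop> p \<approx> one_endo" "endo p" "endo q"
  shows "autoequivalence C (fst p)"
proof -
  obtain t s where "intertwines (p \<diamondop> q) one_endo t" "intertwines (q \<diamondop> p) one_endo s"
    using assms by (auto simp: isomorphic_def)
  from this[THEN intertwinesD(1)] show ?thesis
    unfolding autoequivalence_iff fst_comp_endo fst_one_endo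
    using endo_functor[OF assms(3)] endo_functor[OF assms(4)] by blast
qed


section \<open>The group of equivariant autoequivalences\<close>

definition autos :: "('g, 'o, 'm) eq_fctr set" where
  "autos = {p. endo p \<and> autoequivalence C (fst p)}"

lemma eq_autoequivalences_eq: "eq_autoequivalences K C G A = autos"
  by (auto simp: eq_autoequivalences_def autos_def endo_def)

lemma eq_iso_rel_eq: "eq_iso_rel K C G A = {(p, q). p \<in> autos \<and> q \<in> autos \<and> p \<approx> q}"
  unfolding eq_iso_rel_def eq_autoequivalences_eq
  using equivariant_iso_iff by (auto simp: isomorphic_def autos_def)

abbreviation cls ("\<langle>_\<rangle>") where "\<langle>p\<rangle> \<equiv> eq_class K C G A p"

lemma equiv_autos: "equiv autos (eq_iso_rel K C G A)"
proof (rule equivI)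
  show "refl_on autos (eq_iso_rel K C G A)"
    by (auto simp: refl_on_def eq_iso_rel_eq autos_def intro: isomorphic_refl)
  show "sym (eq_iso_rel K C G A)"
    by (auto simp: sym_def eq_iso_rel_eq intro: isomorphic_sym)
  show "trans (eq_iso_rel K C G A)"
    unfolding trans_def eq_iso_rel_eq using isomorphic_trans by blast
  show "eq_iso_rel K C G A \<subseteq> autos \<times> autos" by (auto simp: eq_iso_rel_eq)
qed

lemma mem_cls: "p \<in> autos \<Longrightarrow> q \<in> \<langle>p\<rangle> \<longleftrightarrow> q \<in> autos \<and> p \<approx> q"
  by (auto simp: eq_iso_rel_eq)

lemma cls_eq_iff: "p \<in> autos \<Longrightarrow> q \<in> autos \<Longrightarrow> \<langle>p\<rangle> = \<langle>q\<rangle> \<longleftrightarrow> p \<approx> q"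
  using eq_equiv_class_iff[OF equiv_autos] by (simp add: eq_iso_rel_eq)

lemma carrier_Aut: "carrier (Aut K C G A) = (\<lambda>p. \<langle>p\<rangle>) ` autos"
  by (auto simp: Aut_def eq_autoequivalences_eq quotient_def)

lemma cls_closed: "p \<in> autos \<Longrightarrow> \<langle>p\<rangle> \<in> carrier (Aut K C G A)"
  by (auto simp: carrier_Aut)

lemma autos_comp: "p \<in> autos \<Longrightarrow> q \<in> autos \<Longrightarrow> p \<diamondop> q \<in> autos"
  by (simp add: autos_def autoequivalence_comp)

lemma autos_one: "one_endo \<in> autos"
  using autoequivalence_if_inverse[OF comp_endo_one(1) comp_endo_one(1)] by (simp add: autos_def)

lemma autos_cong:
  assumes p: "p \<in> autos" and pq: "p \<approx> q"
  shows "q \<in> autos"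
proof -
  obtain r where r: "endo r" "p \<diamondop> r \<approx> one_endo" "r \<diamondop> p \<approx> one_endo"
    using equivariant_inverse[of p] p by (auto simp: autos_def)
  have "q \<diamondop> r \<approx> one_endo"
    by (rule isomorphic_trans[OF comp_endo_cong[OF isomorphic_sym[OF pq] isomorphic_refl[OF r(1)]] r(2)])
  moreover have "r \<diamondop> q \<approx> one_endo"
    by (rule isomorphic_trans[OF comp_endo_cong[OF isomorphic_refl[OF r(1)] isomorphic_sym[OF pq]] r(3)])
  ultimately have "autoequivalence C (fst q)"
    by (rule autoequivalence_if_inverse[OF _ _ isomorphic_endo(2)[OF pq] r(1)])
  then show ?thesis using isomorphic_endo(2)[OF pq] by (simp add: autos_def)
qed

lemma one_Aut: "\<one>\<^bsub>Aut K C G A\<^esub> = \<langle>one_endo\<rangle>"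
  by (simp add: Aut_def)

lemma UN_cls_eq:
  assumes "p \<in> autos" "\<And>p'. p' \<in> \<langle>p\<rangle> \<Longrightarrow> f p' = B"
  shows "(\<Union>p' \<in> \<langle>p\<rangle>. f p') = B"
  using assms equiv_class_self[OF equiv_autos assms(1)] by blast

lemma mult_Aut:
  assumes "p \<in> autos" "q \<in> autos"
  shows "\<langle>p\<rangle> \<otimes>\<^bsub>Aut K C G A\<^esub> \<langle>q\<rangle> = \<langle>p \<diamondop> q\<rangle>"
proof -
  have "\<langle>p' \<diamondop> q'\<rangle> = \<langle>p \<diamondop> q\<rangle>" if "p' \<in> \<langle>p\<rangle>" "q' \<in> \<langle>q\<rangle>" for p' q'
  proof -
    have p': "p' \<in> autos" "p \<approx> p'" and q': "q' \<in> autos" "q \<approx> q'"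
      using that assms mem_cls by blast+
    then show ?thesis
      using assms by (subst cls_eq_iff) (auto intro: autos_comp comp_endo_cong isomorphic_sym)
  qed
  then have "(\<Union>p' \<in> \<langle>p\<rangle>. \<Union>q' \<in> \<langle>q\<rangle>. \<langle>p' \<diamondop> q'\<rangle>) = \<langle>p \<diamondop> q\<rangle>"
    using assms by (intro UN_cls_eq) auto
  then show ?thesis by (simp add: Aut_def)
qed

lemma group_Aut: "group (Aut K C G A)"
proof (rule groupI)
  have endo: "endo p" if "p \<in> autos" for p using that by (simp add: autos_def)
  fix x assume "x \<in> carrier (Aut K C G A)"
  then obtain p where p: "p \<in> autos" and x: "x = \<langle>p\<rangle>" by (auto simp: carrier_Aut)
  show "\<one>\<^bsub>Aut K C G A\<^esub> \<otimes>\<^bsub>Aut K C G A\<^esub> x = x"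
    by (simp add: x one_Aut mult_Aut p autos_one autos_comp cls_eq_iff comp_endo_one endo)
  obtain q where "endo q" "autoequivalence C (fst q)" and qp: "q \<diamondop> p \<approx> one_endo"
    using equivariant_inverse[of p] p by (auto simp: autos_def)
  then have q: "q \<in> autos" by (simp add: autos_def)
  show "\<exists>y \<in> carrier (Aut K C G A). y \<otimes>\<^bsub>Aut K C G A\<^esub> x = \<one>\<^bsub>Aut K C G A\<^esub>"
    by (rule bexI[of _ "\<langle>q\<rangle>"])
      (simp_all add: x one_Aut mult_Aut p q qp autos_one autos_comp cls_eq_iff cls_closed)
  fix y assume "y \<in> carrier (Aut K C G A)"
  then obtain q where q: "q \<in> autos" and y: "y = \<langle>q\<rangle>" by (auto simp: carrier_Aut)
  show "x \<otimes>\<^bsub>Aut K C G A\<^esub> y \<in> carrier (Aut K C G A)"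
    by (simp add: x y mult_Aut p q cls_closed autos_comp)
  fix z assume "z \<in> carrier (Aut K C G A)"
  then obtain r where r: "r \<in> autos" and z: "z = \<langle>r\<rangle>" by (auto simp: carrier_Aut)
  show "x \<otimes>\<^bsub>Aut K C G A\<^esub> y \<otimes>\<^bsub>Aut K C G A\<^esub> z = x \<otimes>\<^bsub>Aut K C G A\<^esub> (y \<otimes>\<^bsub>Aut K C G A\<^esub> z)"
    by (simp add: x y z mult_Aut p q r autos_comp cls_eq_iff comp_endo_assoc endo)
qed (simp add: one_Aut cls_closed autos_one)

end


section \<open>The equivariantization as a linear category\<close>

context linear_category begin

definition scale :: "'k \<Rightarrow> ('o, 'm) arrow \<Rightarrow> ('o, 'm) arrow" where
  "scale c a = Arrow (dm a) (cd a) (c \<odot>\<^bsub>Hom C (dm a) (cd a)\<^esub> mp a)"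

lemma scale_sel [simp]: "dm (scale c a) = dm a" "cd (scale c a) = cd a"
  by (simp_all add: scale_def)

lemma arr_scale [simp]: "c \<in> carrier K \<Longrightarrow> arrow a \<Longrightarrow> arrow (scale c a)"
  using Hom_module[of "dm a" "cd a"]
  by (auto simp: arr_def scale_def module.smult_closed simp del: arr_obj)

lemma cmp_scale_left [simp]:
  "c \<in> carrier K \<Longrightarrow> arrow a \<Longrightarrow> arrow b \<Longrightarrow> cd a = dm b \<Longrightarrow> scale c b \<cdot> a = scale c (b \<cdot> a)"
  by (simp add: arr_def cmp_def scale_def Comp_smult_left del: arr_obj)

lemma cmp_scale_right [simp]:
  "c \<in> carrier K \<Longrightarrow> arrow a \<Longrightarrow> arrow b \<Longrightarrow> cd a = dm b \<Longrightarrow> b \<cdot> scale c a = scale c (b \<cdot> a)"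
  by (simp add: arr_def cmp_def scale_def Comp_smult_right del: arr_obj)

lemma scale_scale [simp]:
  "c \<in> carrier K \<Longrightarrow> d \<in> carrier K \<Longrightarrow> arrow a \<Longrightarrow> scale c (scale d a) = scale (c \<otimes> d) a"
  using Hom_module[of "dm a" "cd a"] by (simp add: arr_def scale_def module.smult_assoc1 del: arr_obj)

lemma scale_one [simp]: "arrow a \<Longrightarrow> scale \<one> a = a"
  using Hom_module[of "dm a" "cd a"] by (cases a) (simp add: arr_def scale_def module.smult_one del: arr_obj)

lemma fap_scale:
  assumes "linear_functor K C C F" "c \<in> carrier K" "arrow a"
  shows "F \<star> scale c a = scale c (F \<star> a)"
  using assms by (simp add: linear_functor_def fap_def scale_def arr_def del: arr_obj)

lemma iso_scale:
  assumes c: "c \<in> carrier K" "c \<noteq> \<zero>" and a: "invertible a"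
  shows "invertible (scale c a)"
proof (rule isoI[where b = "scale (inv c) (inv_arr a)"])
  have i: "inv c \<in> carrier K" "inv c \<otimes> c = \<one>" "c \<otimes> inv c = \<one>"
    using c field_Units K.Units_inv_closed K.Units_l_inv K.Units_r_inv by auto
  show "scale (inv c) (inv_arr a) \<cdot> scale c a = ide (dm (scale c a))"
    "scale c a \<cdot> scale (inv c) (inv_arr a) = ide (cd (scale c a))"
    using i c a by simp_all
qed (use c a field_Units K.Units_inv_closed in auto)

lemma Comp_zero_right:
  assumes [simp]: "X \<in> Obj C" "Y \<in> Obj C" "Z \<in> Obj C" and g: "g \<in> Mor C Y Z"
  shows "Comp C X Y Z g \<zero>\<^bsub>Hom C X Y\<^esub> = \<zero>\<^bsub>Hom C X Z\<^esub>"
proof -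
  interpret XY: module K "Hom C X Y" by (rule Hom_module) simp_all
  interpret XZ: module K "Hom C X Z" by (rule Hom_module) simp_all
  show ?thesis
    using Comp_smult_right[of X Y Z \<zero> "\<zero>\<^bsub>Hom C X Y\<^esub>" g] g by (simp add: Comp_closed)
qed

lemma Comp_zero_left:
  assumes [simp]: "X \<in> Obj C" "Y \<in> Obj C" "Z \<in> Obj C" and f: "f \<in> Mor C X Y"
  shows "Comp C X Y Z \<zero>\<^bsub>Hom C Y Z\<^esub> f = \<zero>\<^bsub>Hom C X Z\<^esub>"
proof -
  interpret YZ: module K "Hom C Y Z" by (rule Hom_module) simp_all
  interpret XZ: module K "Hom C X Z" by (rule Hom_module) simp_all
  show ?thesis
    using Comp_smult_left[of X Y Z \<zero> f "\<zero>\<^bsub>Hom C Y Z\<^esub>"] f by (simp add: Comp_closed)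
qed

lemma linear_functor_zero:
  assumes F: "linear_functor K C C F" and [simp]: "X \<in> Obj C" "Y \<in> Obj C"
  shows "fmor F X Y \<zero>\<^bsub>Hom C X Y\<^esub> = \<zero>\<^bsub>Hom C (fob F X) (fob F Y)\<^esub>"
proof -
  have f [simp]: "functor F" using F by (simp add: linear_functor_def)
  interpret XY: module K "Hom C X Y" by (rule Hom_module) simp_all
  interpret FXY: module K "Hom C (fob F X) (fob F Y)" by (rule Hom_module) simp_all
  have "fmor F X Y (\<zero> \<odot>\<^bsub>Hom C X Y\<^esub> \<zero>\<^bsub>Hom C X Y\<^esub>) = \<zero> \<odot>\<^bsub>Hom C (fob F X) (fob F Y)\<^esub> fmor F X Y \<zero>\<^bsub>Hom C X Y\<^esub>"
    using F XY.zero_closed K.zero_closed assms(2,3) unfolding linear_functor_def by blast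
  moreover have "fmor F X Y \<zero>\<^bsub>Hom C X Y\<^esub> \<in> Mor C (fob F X) (fob F Y)"
    using f by (simp add: is_functor_def)
  ultimately show ?thesis by simp
qed

end

context acted_category begin

abbreviation "D \<equiv> equivariantization C G A"

text \<open>
  The structure isomorphisms of an equivariant object as arrows, and the forgetful functor on arrows.
\<close>

definition str_arrow :: "'o \<times> ('g \<Rightarrow> 'm) \<Rightarrow> 'g \<Rightarrow> ('o, 'm) arrow" ("\<sigma>") where
  "\<sigma> P g = Arrow (fst P) (fob (T g) (fst P)) (snd P g)"

definition und :: "('o \<times> ('g \<Rightarrow> 'm), 'm) arrow \<Rightarrow> ('o, 'm) arrow" where
  "und a = Arrow (fst (dm a)) (fst (cd a)) (mp a)"

lemma str_sel [simp]: "dm (\<sigma> P g) = fst P" "cd (\<sigma> P g) = fob (T g) (fst P)" "mp (\<sigma> P g) = snd P g"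
  by (simp_all add: str_arrow_def)

lemma und_sel [simp]: "dm (und a) = fst (dm a)" "cd (und a) = fst (cd a)"
  by (simp_all add: und_def)

text \<open>
  The morphisms of \<open>D\<close> are morphisms of \<open>C\<close>, so arrows of \<open>D\<close> with given domain and codomain are
  equal if the underlying arrows of \<open>C\<close> are; diagrams in \<open>D\<close> are always checked in \<open>C\<close>.
\<close>

lemma und_eqI: "und a = und b \<Longrightarrow> dm a = dm b \<Longrightarrow> cd a = cd b \<Longrightarrow> a = b"
  by (simp add: und_def arrow.expand)

lemma Obj_D: "P \<in> Obj D \<longleftrightarrow> fst P \<in> Obj C \<and> snd P \<in> extensional (carrier G) \<and>
    (\<forall>g \<in> carrier G. invertible (\<sigma> P g)) \<and>
    (\<forall>g \<in> carrier G. \<forall>h \<in> carrier G. \<sigma> P (g *\<^sub>G h) = eps g h (fst P) \<cdot> (T g \<star> \<sigma> P h) \<cdot> \<sigma> P g)"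
  by (cases P) (auto simp: equivariantization_def equivariant_object_def str_arrow_def iso_arr_iff
      eps_def components_def cmp_def fap_def)

lemma Obj_D_simps [simp]:
  assumes "P \<in> Obj D"
  shows "fst P \<in> Obj C" "g \<in> carrier G \<Longrightarrow> invertible (\<sigma> P g)" "g \<in> carrier G \<Longrightarrow> arrow (\<sigma> P g)"
  using assms by (auto simp: Obj_D)

lemma str_mult:
  "P \<in> Obj D \<Longrightarrow> g \<in> carrier G \<Longrightarrow> h \<in> carrier G \<Longrightarrow>
    \<sigma> P (g *\<^sub>G h) = eps g h (fst P) \<cdot> (T g \<star> \<sigma> P h) \<cdot> \<sigma> P g"
  using Obj_D by blast

lemma Obj_D_eqI:
  assumes "P \<in> Obj D" "Q \<in> Obj D" "fst P = fst Q" "\<And>g. g \<in> carrier G \<Longrightarrow> \<sigma> P g = \<sigma> Q g"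
  shows "P = Q"
proof (rule prod_eqI)
  show "snd P = snd Q"
  proof (rule extensionalityI[of _ "carrier G"])
    show "snd P \<in> extensional (carrier G)" "snd Q \<in> extensional (carrier G)"
      using assms(1,2) Obj_D by blast+
    show "snd P g = snd Q g" if "g \<in> carrier G" for g
      using assms(4)[OF that] by (simp add: str_arrow_def)
  qed
qed fact

lemma arr_D: "arr D a \<longleftrightarrow> dm a \<in> Obj D \<and> cd a \<in> Obj D \<and> arrow (und a) \<and>
    (\<forall>g \<in> carrier G. \<sigma> (cd a) g \<cdot> und a = (T g \<star> und a) \<cdot> \<sigma> (dm a) g)"
proof (cases "dm a \<in> Obj D \<and> cd a \<in> Obj D")
  case True
  then have "fst (dm a) \<in> Obj C" "fst (cd a) \<in> Obj C" by simp_all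
  then show ?thesis using True
    unfolding arr_def by (cases a) (auto simp: equivariantization_def und_def str_arrow_def
      cmp_def fap_def split: prod.splits)
next
  case False
  then show ?thesis by (auto simp: arr_def simp del: arr_obj)
qed

lemma arr_DI: "\<lbrakk>dm a \<in> Obj D; cd a \<in> Obj D; arrow (und a);
    \<And>g. g \<in> carrier G \<Longrightarrow> \<sigma> (cd a) g \<cdot> und a = (T g \<star> und a) \<cdot> \<sigma> (dm a) g\<rbrakk> \<Longrightarrow> arr D a"
  using arr_D by blast

lemma arrow_und [simp]: "arr D a \<Longrightarrow> arrow (und a)"
  using arr_D by blast

lemma und_str: "arr D a \<Longrightarrow> g \<in> carrier G \<Longrightarrow> \<sigma> (cd a) g \<cdot> und a = (T g \<star> und a) \<cdot> \<sigma> (dm a) g"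
  using arr_D by blast

lemma und_cmp [simp]: "und (cmp D b a) = und b \<cdot> und a"
  by (auto simp: und_def cmp_def equivariantization_def split: prod.splits)

lemma und_ida [simp]: "und (ida D P) = ide (fst P)"
  by (auto simp: und_def ida_def equivariantization_def split: prod.splits)

lemma category_D: "category D"
proof
  have und_closed: "arr D (cmp D b a)" if a: "arr D a" and b: "arr D b" and [simp]: "cd a = dm b" for a b
  proof -
    have "\<sigma> (cd b) g \<cdot> und b \<cdot> und a = ((T g \<star> und b) \<cdot> (T g \<star> und a)) \<cdot> \<sigma> (dm a) g"
      if [simp]: "g \<in> carrier G" for g
    proof -
      have "\<sigma> (cd b) g \<cdot> und b \<cdot> und a = (\<sigma> (cd b) g \<cdot> und b) \<cdot> und a"
        using a b by (simp add: cmp_assoc)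
      also have "\<dots> = (T g \<star> und b) \<cdot> \<sigma> (cd a) g \<cdot> und a"
        using a b by (simp add: und_str cmp_assoc)
      also have "\<dots> = (T g \<star> und b) \<cdot> (T g \<star> und a) \<cdot> \<sigma> (dm a) g"
        using a b by (simp only: und_str[OF a that])
      finally show ?thesis using a b by (simp add: cmp_assoc)
    qed
    then show ?thesis using a b by (intro arr_DI) (auto simp: fap_cmp)
  qed
  fix X Y Z W f g h
  {
    assume "X \<in> Obj D" "Y \<in> Obj D" "Z \<in> Obj D" "f \<in> Mor D X Y" "g \<in> Mor D Y Z"
    then show "Comp D X Y Z g f \<in> Mor D X Z"
      using und_closed[of "Arrow X Y f" "Arrow Y Z g"] by (simp add: arr_def cmp_def)
  next
    assume A: "W \<in> Obj D" "X \<in> Obj D" "Y \<in> Obj D" "Z \<in> Obj D"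
      "f \<in> Mor D W X" "g \<in> Mor D X Y" "h \<in> Mor D Y Z"
    then have B: "arr D (Arrow W X f)" "arr D (Arrow X Y g)" "arr D (Arrow Y Z h)" by (simp_all add: arr_def)
    have "cmp D (cmp D (Arrow Y Z h) (Arrow X Y g)) (Arrow W X f) = cmp D (Arrow Y Z h) (cmp D (Arrow X Y g) (Arrow W X f))"
      using B by (intro und_eqI) (simp_all add: cmp_assoc)
    then show "Comp D W X Z (Comp D X Y Z h g) f = Comp D W Y Z h (Comp D W X Y g f)"
      by (simp add: cmp_def)
  next
    assume "X \<in> Obj D"
    then have "arr D (ida D X)" by (intro arr_DI) auto
    then show "Id D X \<in> Mor D X X" by (simp add: ida_def arr_def)
  next
    assume "X \<in> Obj D" "Y \<in> Obj D" "f \<in> Mor D X Y"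
    then have B: "arr D (Arrow X Y f)" by (simp add: arr_def)
    have "cmp D (ida D Y) (Arrow X Y f) = Arrow X Y f" "cmp D (Arrow X Y f) (ida D X) = Arrow X Y f"
      using B by (auto intro!: und_eqI)
    then show "Comp D X Y Y (Id D Y) f = f" "Comp D X X Y f (Id D X) = f"
      by (simp_all add: cmp_def ida_def)
  }
qed

lemma Hom_D_sel:
  "add (Hom D P Q) = add (Hom C (fst P) (fst Q))" "smult (Hom D P Q) = smult (Hom C (fst P) (fst Q))"
  "zero (Hom D P Q) = zero (Hom C (fst P) (fst Q))"
  "Comp D P Q R = Comp C (fst P) (fst Q) (fst R)"
  by (auto simp: equivariantization_def split: prod.splits)

lemma Mor_D_subset: "Mor D P Q \<subseteq> Mor C (fst P) (fst Q)"
  by (auto simp: equivariantization_def split: prod.splits)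

lemma Mor_D:
  "m \<in> Mor D P Q \<longleftrightarrow> m \<in> Mor C (fst P) (fst Q) \<and>
     (\<forall>g \<in> carrier G. Comp C (fst P) (fst Q) (fob (T g) (fst Q)) (snd Q g) m =
       Comp C (fst P) (fob (T g) (fst P)) (fob (T g) (fst Q)) (fmor (T g) (fst P) (fst Q) m) (snd P g))"
  by (auto simp: equivariantization_def split: prod.splits)

lemma snd_mor: "P \<in> Obj D \<Longrightarrow> g \<in> carrier G \<Longrightarrow> snd P g \<in> Mor C (fst P) (fob (T g) (fst P))"
  using Obj_D_simps(3)[of P g] by (simp add: arr_def)

lemma act_mor: "g \<in> carrier G \<Longrightarrow> X \<in> Obj C \<Longrightarrow> Y \<in> Obj C \<Longrightarrow> f \<in> Mor C X Y \<Longrightarrow>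
    fmor (T g) X Y f \<in> Mor C (fob (T g) X) (fob (T g) Y)"
  using act_functor[of g] unfolding is_functor_def by blast

lemma act_add: "g \<in> carrier G \<Longrightarrow> X \<in> Obj C \<Longrightarrow> Y \<in> Obj C \<Longrightarrow> f \<in> Mor C X Y \<Longrightarrow> f' \<in> Mor C X Y \<Longrightarrow>
    fmor (T g) X Y (f \<oplus>\<^bsub>Hom C X Y\<^esub> f') =
      fmor (T g) X Y f \<oplus>\<^bsub>Hom C (fob (T g) X) (fob (T g) Y)\<^esub> fmor (T g) X Y f'"
  using act_linear[of g] unfolding linear_functor_def by blast

lemma act_smult: "g \<in> carrier G \<Longrightarrow> X \<in> Obj C \<Longrightarrow> Y \<in> Obj C \<Longrightarrow> f \<in> Mor C X Y \<Longrightarrow> c \<in> carrier K \<Longrightarrow>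
    fmor (T g) X Y (c \<odot>\<^bsub>Hom C X Y\<^esub> f) = c \<odot>\<^bsub>Hom C (fob (T g) X) (fob (T g) Y)\<^esub> fmor (T g) X Y f"
  using act_linear[of g] unfolding linear_functor_def by blast

lemma Hom_D_module:
  assumes P: "P \<in> Obj D" and Q: "Q \<in> Obj D"
  shows "module K (Hom D P Q)"
proof -
  note [simp] = Obj_D_simps(1)[OF P] Obj_D_simps(1)[OF Q]
  interpret H: module K "Hom C (fst P) (fst Q)" by (rule Hom_module) simp_all
  have eq: "Hom D P Q = (Hom C (fst P) (fst Q))\<lparr>carrier := Mor D P Q\<rparr>"
    by (auto simp: equivariantization_def split: prod.splits)
  have smult: "c \<odot>\<^bsub>Hom C (fst P) (fst Q)\<^esub> m \<in> Mor D P Q" if "c \<in> carrier K" "m \<in> Mor D P Q" for c m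
    using that P Q unfolding Mor_D
    by (auto simp: Comp_smult_left Comp_smult_right act_smult act_mor snd_mor)
  have "submodule (Mor D P Q) K (Hom C (fst P) (fst Q))"
  proof (rule H.submoduleI)
    show "Mor D P Q \<subseteq> Mor C (fst P) (fst Q)" by (rule Mor_D_subset)
    show "\<zero>\<^bsub>Hom C (fst P) (fst Q)\<^esub> \<in> Mor D P Q"
      using P Q by (auto simp: Mor_D Comp_zero_left Comp_zero_right linear_functor_zero act_linear snd_mor)
    show "\<ominus>\<^bsub>Hom C (fst P) (fst Q)\<^esub> a \<in> Mor D P Q" if "a \<in> Mor D P Q" for a
      using smult[OF _ that, of "\<ominus> \<one>"] that Mor_D_subset[of P Q] by (auto simp: H.smult_l_minus)
    show "a \<oplus>\<^bsub>Hom C (fst P) (fst Q)\<^esub> b \<in> Mor D P Q" if "a \<in> Mor D P Q" "b \<in> Mor D P Q" for a b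
      using that P Q unfolding Mor_D
      by (auto simp: Comp_add_left Comp_add_right act_add act_mor snd_mor)
  qed (rule smult)
  then show ?thesis by (subst eq) (rule submodule.submodule_is_module[OF _ H.module_axioms])
qed

lemma linear_category_D: "linear_category K D"
proof (intro linear_category.intro category_D K.field_axioms linear_category_axioms.intro, goal_cases)
  case (1 P Q)
  then show ?case by (rule Hom_D_module)
next
  case (2 P Q R f g g')
  then show ?case using Mor_D_subset[of P Q] Mor_D_subset[of Q R]
    by (simp add: Hom_D_sel Comp_add_left subset_iff)
next
  case (3 P Q R f f' g)
  then show ?case using Mor_D_subset[of P Q] Mor_D_subset[of Q R]
    by (simp add: Hom_D_sel Comp_add_right subset_iff)
next
  case (4 P Q R c f g)
  then show ?case using Mor_D_subset[of P Q] Mor_D_subset[of Q R]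
    by (simp add: Hom_D_sel Comp_smult_left subset_iff)
next
  case (5 P Q R c f g)
  then show ?case using Mor_D_subset[of P Q] Mor_D_subset[of Q R]
    by (simp add: Hom_D_sel Comp_smult_right subset_iff)
qed

end


section \<open>The dual action\<close>

context acted_category begin

abbreviation "DA \<equiv> dual_action K C G A"

abbreviation "S \<equiv> dual_fctr C G A"

lemma act_DA [simp]: "act DA \<chi> = S \<chi>"
  by (simp add: dual_action_def)

lemma fst_S [simp]: "fst (fob (S \<chi>) P) = fst P"
  by (simp add: dual_fctr_def split: prod.split)

lemma und_S [simp]: "und (S \<chi> \<star> a) = und a"
  by (simp add: dual_fctr_def fap_def und_def split: prod.split)

lemma str_S [simp]:
  "g \<in> carrier G \<Longrightarrow> \<sigma> (fob (S \<chi>) P) g = scale (\<chi> (inv\<^bsub>G\<^esub> g)) (\<sigma> P g)"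
  by (simp add: dual_fctr_def str_arrow_def scale_def split: prod.split)

lemma S_closed:
  assumes \<chi>: "\<chi> \<in> carrier DG" and P: "P \<in> Obj D"
  shows "fob (S \<chi>) P \<in> Obj D"
  unfolding Obj_D
proof (intro conjI ballI)
  show "fst (fob (S \<chi>) P) \<in> Obj C" using P by simp
  show "snd (fob (S \<chi>) P) \<in> extensional (carrier G)" by (simp add: dual_fctr_def split: prod.split)
  fix g assume g [simp]: "g \<in> carrier G"
  show "invertible (\<sigma> (fob (S \<chi>) P) g)"
    using P \<chi> by (simp add: iso_scale dual_char)
  fix h assume h [simp]: "h \<in> carrier G"
  show "\<sigma> (fob (S \<chi>) P) (g *\<^sub>G h) = eps g h (fst (fob (S \<chi>) P)) \<cdot> (T g \<star> \<sigma> (fob (S \<chi>) P) h) \<cdot> \<sigma> (fob (S \<chi>) P) g"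
    using P \<chi> by (simp add: str_mult dual_char fap_scale[OF act_linear] G.inv_mult_group m_comm)
qed

lemma S_functor:
  assumes \<chi>: "\<chi> \<in> carrier DG"
  shows "is_functor D D (S \<chi>)"
proof (rule category.functorI[OF category_D])
  interpret D: category D by (rule category_D)
  show arr: "arr D (S \<chi> \<star> a)" if "arr D a" for a
    using that \<chi> by (intro arr_DI) (auto simp: S_closed dual_char und_str)
  show "S \<chi> \<star> ida D P = ida D (fob (S \<chi>) P)" for P by (rule und_eqI) simp_all
  show "S \<chi> \<star> cmp D b a = cmp D (S \<chi> \<star> b) (S \<chi> \<star> a)" for a b by (rule und_eqI) simp_all
qed (rule S_closed[OF \<chi>])

lemma S_linear:
  assumes \<chi>: "\<chi> \<in> carrier DG"
  shows "linear_functor K D D (S \<chi>)"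
  using S_functor[OF \<chi>] unfolding linear_functor_def
  by (simp add: Hom_D_sel) (simp add: dual_fctr_def)

lemma S_comp:
  assumes \<chi>: "\<chi> \<in> carrier DG" and \<psi>: "\<psi> \<in> carrier DG" and P: "P \<in> Obj D"
  shows "fob (S \<chi>) (fob (S \<psi>) P) = fob (S (\<chi> \<otimes>\<^bsub>DG\<^esub> \<psi>)) P"
  using assms by (intro Obj_D_eqI) (auto simp: S_closed dual_mult_closed dual_mult dual_char)

lemma S_one:
  assumes P: "P \<in> Obj D"
  shows "fob (S \<one>\<^bsub>DG\<^esub>) P = P"
  using assms group.is_monoid[OF group_DG]
  by (intro Obj_D_eqI) (auto simp: S_closed dual_one monoid.one_closed)

lemma S_autoequivalence:
  assumes \<chi>: "\<chi> \<in> carrier DG"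
  shows "autoequivalence D (S \<chi>)"
proof -
  interpret D: category D by (rule category_D)
  interpret DG: group DG by (rule group_DG)
  let ?\<psi> = "inv\<^bsub>DG\<^esub> \<chi>"
  have [simp]: "D.functor (S \<chi>)" "D.functor (S ?\<psi>)" using \<chi> S_functor by simp_all
  have "D.nat_iso (S ?\<psi> \<circ>\<^sub>F S \<chi>) id_fctr (ida D)" "D.nat_iso (S \<chi> \<circ>\<^sub>F S ?\<psi>) id_fctr (ida D)"
    using \<chi> by (auto intro!: D.nat_isoI und_eqI simp: S_comp S_one)
  then show ?thesis unfolding D.autoequivalence_iff
    using \<open>D.functor (S \<chi>)\<close> \<open>D.functor (S ?\<psi>)\<close> by blast
qed

lemma linear_action_DA: "linear_action K D DG DA"
proof -
  interpret D: category D by (rule category_D)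
  interpret DG: group DG by (rule group_DG)
  have nat: "natural_iso D D (S \<chi> \<circ>\<^sub>F S \<psi>) (S (\<chi> \<otimes>\<^bsub>DG\<^esub> \<psi>)) (str DA \<chi> \<psi>)"
    if [simp]: "\<chi> \<in> carrier DG" "\<psi> \<in> carrier DG" for \<chi> \<psi>
  proof (subst D.natural_iso_iff)
    have e: "D.components (S \<chi> \<circ>\<^sub>F S \<psi>) (S (\<chi> \<otimes>\<^bsub>DG\<^esub> \<psi>)) (str DA \<chi> \<psi>) P = ida D (fob (S (\<chi> \<otimes>\<^bsub>DG\<^esub> \<psi>)) P)"
      if "P \<in> Obj D" for P
      using that by (simp add: D.components_def ida_def dual_action_def S_comp)
    have "D.nat_iso (S \<chi> \<circ>\<^sub>F S \<psi>) (S (\<chi> \<otimes>\<^bsub>DG\<^esub> \<psi>)) (\<lambda>P. ida D (fob (S (\<chi> \<otimes>\<^bsub>DG\<^esub> \<psi>)) P))"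
      by (auto intro!: D.nat_isoI und_eqI simp: S_comp S_functor S_closed)
    then show "D.nat_iso (S \<chi> \<circ>\<^sub>F S \<psi>) (S (\<chi> \<otimes>\<^bsub>DG\<^esub> \<psi>)) (D.components (S \<chi> \<circ>\<^sub>F S \<psi>) (S (\<chi> \<otimes>\<^bsub>DG\<^esub> \<psi>)) (str DA \<chi> \<psi>))"
      by (rule D.nat_iso_cong) (simp add: e)
  qed (simp_all add: S_functor)
  show ?thesis
    unfolding linear_action_def is_action_def
  proof (intro conjI ballI)
    fix \<chi> \<psi> \<xi> P
    assume [simp]: "\<chi> \<in> carrier DG" "\<psi> \<in> carrier DG" "\<xi> \<in> carrier DG" "P \<in> Obj D"
    show "let Sa = fob (act DA \<chi>) (fob (act DA \<psi>) (fob (act DA \<xi>) P));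
             Ta = fob (act DA (\<chi> \<otimes>\<^bsub>DG\<^esub> \<psi> \<otimes>\<^bsub>DG\<^esub> \<xi>)) P
         in Comp D Sa (fob (act DA (\<chi> \<otimes>\<^bsub>DG\<^esub> \<psi>)) (fob (act DA \<xi>) P)) Ta
              (str DA (\<chi> \<otimes>\<^bsub>DG\<^esub> \<psi>) \<xi> P) (str DA \<chi> \<psi> (fob (act DA \<xi>) P)) =
            Comp D Sa (fob (act DA \<chi>) (fob (act DA (\<psi> \<otimes>\<^bsub>DG\<^esub> \<xi>)) P)) Ta
              (str DA \<chi> (\<psi> \<otimes>\<^bsub>DG\<^esub> \<xi>) P)
              (fmor (act DA \<chi>) (fob (act DA \<psi>) (fob (act DA \<xi>) P)) (fob (act DA (\<psi> \<otimes>\<^bsub>DG\<^esub> \<xi>)) P)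
                (str DA \<psi> \<xi> P))"
      by (simp add: Let_def S_comp S_closed DG.m_assoc) (simp add: dual_action_def dual_fctr_def
        equivariantization_def split: prod.split)
  qed (simp_all add: S_autoequivalence S_linear nat)
qed

end

text \<open>
  The results on categories with an action apply to the dual action as well. A locale of its own
  keeps the passage to the dual action from being iterated.
\<close>

locale dual_category = acted_category K C G A
  for K :: "('k, 'e) ring_scheme" (structure) and C :: "('k, 'o, 'm) lin_cat"
    and G :: "('g, 'f) monoid_scheme" and A :: "('g, 'o, 'm) cat_action"

sublocale dual_category \<subseteq> D: acted_category K D DG DA
  by (intro acted_category.intro acted_category_axioms.intro characters.intro linear_category_D
      K.field_axioms group_DG linear_action_DA)

context dual_category begin

notation D.cmp_C (infixr \<open>\<cdot>\<^sub>D\<close> 70)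
notation D.isomorphic (infix \<open>\<approx>\<^sub>D\<close> 50)

lemma eps_D: "\<chi> \<in> carrier DG \<Longrightarrow> \<psi> \<in> carrier DG \<Longrightarrow> P \<in> Obj D \<Longrightarrow>
    D.eps \<chi> \<psi> P = D.ide (fob (S (\<chi> \<otimes>\<^bsub>DG\<^esub> \<psi>)) P)"
  by (simp add: D.eps_def D.components_def ida_def S_comp) (simp add: dual_action_def)


section \<open>Lifting equivariant functors\<close>

lemma iso_DI:
  assumes a: "arr D a" and i: "invertible (und a)"
  shows "D.invertible a"
proof -
  define b where "b = Arrow (cd a) (dm a) (mp (inv_arr (und a)))"
  have [simp]: "dm b = cd a" "cd b = dm a" by (simp_all add: b_def)
  have ub [simp]: "und b = inv_arr (und a)"
    using i by (intro arrow.expand) (simp add: b_def und_def)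
  have "arr D b"
  proof (rule arr_DI)
    fix g assume [simp]: "g \<in> carrier G"
    have "inv_arr (T g \<star> und a) \<cdot> \<sigma> (cd a) g = \<sigma> (dm a) g \<cdot> inv_arr (und a)"
      using a i by (intro inva_switch) (simp_all add: und_str)
    then show "\<sigma> (cd b) g \<cdot> und b = (T g \<star> und b) \<cdot> \<sigma> (dm b) g"
      using i by (simp add: fap_inva)
  qed (use a i in simp_all)
  then show ?thesis using a i by (intro D.isoI[where b = b]) (auto intro!: und_eqI)
qed

lemma fst_eq_lift [simp]: "fst (eq_lift C G A p) = eq_fctr_lift C G A p"
  by (simp add: eq_lift_def)

abbreviation "lift \<equiv> eq_fctr_lift C G A"
abbreviation "elift \<equiv> eq_lift C G A"

lemma fst_lift [simp]: "fst (fob (lift p) P) = fob (fst p) (fst P)"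
  by (simp add: eq_fctr_lift_def split: prod.split)

lemma und_lift [simp]: "und (lift p \<star> a) = fst p \<star> und a"
  by (simp add: eq_fctr_lift_def fap_def und_def split: prod.split)

lemma str_lift [simp]:
  "g \<in> carrier G \<Longrightarrow> \<sigma> (fob (lift p) P) g = dlt p g (fst P) \<cdot> fst p \<star> \<sigma> P g"
  by (simp add: eq_fctr_lift_def str_arrow_def fap_def dlt_def components_def cmp_def split: prod.split)

lemma dlt_elift:
  "fob (lift p) (fob (S \<chi>) P) = fob (S \<chi>) (fob (lift p) P) \<Longrightarrow>
   D.dlt (elift p) \<chi> P = D.ide (fob (S \<chi>) (fob (lift p) P))"
  by (simp add: D.dlt_def D.components_def eq_lift_def ida_def)

text \<open>
  The cocycle condition for \<open>\<delta> \<circ> F \<alpha>\<close> combines those for \<open>\<alpha>\<close> and for \<open>\<delta>\<close> with the naturality of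
  \<open>\<delta>\<^sub>g\<close> at \<open>\<alpha>\<^sub>h\<close>.
\<close>

lemma lift_closed:
  assumes p [simp]: "endo p" and P [simp]: "P \<in> Obj D"
  shows "fob (lift p) P \<in> Obj D"
  unfolding Obj_D
proof (intro conjI ballI)
  show "snd (fob (lift p) P) \<in> extensional (carrier G)" by (simp add: eq_fctr_lift_def split: prod.split)
  fix g assume g [simp]: "g \<in> carrier G"
  show "invertible (\<sigma> (fob (lift p) P) g)" by simp
  fix h assume h [simp]: "h \<in> carrier G"
  have "\<sigma> (fob (lift p) P) (g *\<^sub>G h) = (dlt p (g *\<^sub>G h) (fst P) \<cdot> fst p \<star> eps g h (fst P)) \<cdot>
      (fst p \<star> T g \<star> \<sigma> P h) \<cdot> fst p \<star> \<sigma> P g"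
    by (simp add: str_mult fap_cmp cmp_assoc)
  also have "\<dots> = eps g h (fob (fst p) (fst P)) \<cdot> (T g \<star> dlt p h (fst P)) \<cdot>
      (dlt p g (cd (\<sigma> P h)) \<cdot> fst p \<star> T g \<star> \<sigma> P h) \<cdot> fst p \<star> \<sigma> P g"
    by (simp add: endoD(4)[OF p] cmp_assoc)
  also have "\<dots> = eps g h (fob (fst p) (fst P)) \<cdot> (T g \<star> dlt p h (fst P)) \<cdot>
      ((T g \<star> fst p \<star> \<sigma> P h) \<cdot> dlt p g (fst P)) \<cdot> fst p \<star> \<sigma> P g"
    by (subst dlt_natural) simp_all
  finally show "\<sigma> (fob (lift p) P) (g *\<^sub>G h) = eps g h (fst (fob (lift p) P)) \<cdot>
      (T g \<star> \<sigma> (fob (lift p) P) h) \<cdot> \<sigma> (fob (lift p) P) g"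
    by (simp add: fap_cmp cmp_assoc)
qed simp

lemma lift_functor:
  assumes p [simp]: "endo p"
  shows "D.functor (lift p)"
proof (rule D.functorI)
  show "arr D (lift p \<star> a)" if a: "arr D a" for a
  proof (rule arr_DI)
    fix g assume g [simp]: "g \<in> carrier G"
    have "\<sigma> (cd (lift p \<star> a)) g \<cdot> und (lift p \<star> a) = dlt p g (fst (cd a)) \<cdot> fst p \<star> (\<sigma> (cd a) g \<cdot> und a)"
      using a by (simp add: fap_cmp cmp_assoc)
    also have "\<dots> = (dlt p g (cd (und a)) \<cdot> fst p \<star> T g \<star> und a) \<cdot> fst p \<star> \<sigma> (dm a) g"
      using a by (simp add: und_str fap_cmp cmp_assoc)
    also have "\<dots> = ((T g \<star> fst p \<star> und a) \<cdot> dlt p g (dm (und a))) \<cdot> fst p \<star> \<sigma> (dm a) g"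
      using a by (subst dlt_natural) simp_all
    finally show "\<sigma> (cd (lift p \<star> a)) g \<cdot> und (lift p \<star> a) = (T g \<star> und (lift p \<star> a)) \<cdot> \<sigma> (dm (lift p \<star> a)) g"
      using a by (simp add: cmp_assoc)
  qed (use a in \<open>auto intro: lift_closed\<close>)
  show "lift p \<star> D.ide P = D.ide (fob (lift p) P)" if "P \<in> Obj D" for P
    using that by (intro und_eqI) simp_all
  show "lift p \<star> (b \<cdot>\<^sub>D a) = (lift p \<star> b) \<cdot>\<^sub>D (lift p \<star> a)"
    if "arr D a" "arr D b" "cd a = dm b" for a b
    using that by (intro und_eqI) (simp_all add: fap_cmp)
qed (rule lift_closed[OF p])

lemma lift_S:
  assumes [simp]: "endo p" "\<chi> \<in> carrier DG" "P \<in> Obj D"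
  shows "fob (lift p) (fob (S \<chi>) P) = fob (S \<chi>) (fob (lift p) P)"
proof (rule Obj_D_eqI)
  show "\<sigma> (fob (lift p) (fob (S \<chi>) P)) g = \<sigma> (fob (S \<chi>) (fob (lift p) P)) g" if [simp]: "g \<in> carrier G" for g
    by (simp add: dual_char fap_scale[OF endoD(2)])
qed (simp_all add: S_closed lift_closed)

lemma linear_functor_lift:
  assumes p: "endo p"
  shows "linear_functor K D D (lift p)"
proof -
  have "fmor (lift p) P Q m = fmor (fst p) (fst P) (fst Q) m" for P Q m
    by (simp add: eq_fctr_lift_def split: prod.split)
  then show ?thesis using lift_functor[OF p] endoD(2)[OF p] Mor_D_subset Obj_D_simps(1)
    unfolding linear_functor_def Hom_D_sel by (simp add: subset_iff)
qed

lemma endo_elift: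
  assumes p [simp]: "endo p"
  shows "D.endo (elift p)"
proof -
  note [simp] = lift_functor lift_closed
  have "D.coherent (lift p) (\<lambda>\<chi> P. D.ide (fob (S \<chi>) (fob (lift p) P)))"
    unfolding D.coherent_def
    by (auto intro!: D.nat_isoI und_eqI simp: S_closed S_functor eps_D S_comp lift_S)
  then have "D.coherent (lift p) (D.dlt (elift p))"
    by (rule D.coherent_cong[rotated]) (simp_all add: dlt_elift lift_S)
  then show ?thesis
    by (simp add: D.endo_def D.equivariant_functor_iff linear_functor_lift)
qed

lemma elift_comp:
  assumes [simp]: "endo p" "endo q"
  shows "elift (p \<diamondop> q) \<approx>\<^sub>D eq_comp D DA (elift p) (elift q)"
proof (rule D.isomorphic_if_eq)
  note [simp] = lift_functor lift_closed S_closed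
  show e: "fob (fst (elift (p \<diamondop> q))) P = fob (fst (eq_comp D DA (elift p) (elift q))) P" if [simp]: "P \<in> Obj D" for P
    by (rule Obj_D_eqI) (simp_all add: fap_cmp cmp_assoc)
  then show "fst (elift (p \<diamondop> q)) \<star> a = fst (eq_comp D DA (elift p) (elift q)) \<star> a" if "arr D a" for a
    using that by (intro und_eqI) simp_all
  show "D.dlt (elift (p \<diamondop> q)) \<chi> P = D.dlt (eq_comp D DA (elift p) (elift q)) \<chi> P"
    if [simp]: "\<chi> \<in> carrier DG" "P \<in> Obj D" for \<chi> P
    using e[of P] by (intro und_eqI) (simp_all add: dlt_elift lift_S)
qed (simp_all add: endo_elift)

lemma elift_one: "elift one_endo \<approx>\<^sub>D D.one_endo"
proof (rule D.isomorphic_if_eq)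
  note [simp] = lift_functor lift_closed S_closed
  show e: "fob (fst (elift one_endo)) P = fob (fst D.one_endo) P" if [simp]: "P \<in> Obj D" for P
    by (rule Obj_D_eqI) simp_all
  then show "fst (elift one_endo) \<star> a = fst D.one_endo \<star> a" if "arr D a" for a
    using that by (intro und_eqI) simp_all
  show "D.dlt (elift one_endo) \<chi> P = D.dlt D.one_endo \<chi> P"
    if [simp]: "\<chi> \<in> carrier DG" "P \<in> Obj D" for \<chi> P
    using e[of P] by (intro und_eqI) (simp_all add: dlt_elift lift_S)
qed (simp_all add: endo_elift)

lemma elift_cong:
  assumes "p \<approx> q"
  shows "elift p \<approx>\<^sub>D elift q"
proof -
  from assms obtain t where pq [simp]: "endo p" "endo q" and t: "intertwines p q t"
    by (auto simp: isomorphic_def)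
  note n = intertwinesD(1)[OF t]
  note [simp] = nat_isoD(1-4)[OF n] lift_functor lift_closed S_closed endo_elift
  define s where "s P = Arrow (fob (lift p) P) (fob (lift q) P) (mp (t (fst P)))" for P
  have [simp]: "dm (s P) = fob (lift p) P" "cd (s P) = fob (lift q) P" for P by (simp_all add: s_def)
  have und_s [simp]: "und (s P) = t (fst P)" if "P \<in> Obj D" for P
    using that by (intro arrow.expand) (simp add: s_def und_def)
  have arr_s [simp]: "arr D (s P)" if [simp]: "P \<in> Obj D" for P
  proof (rule arr_DI)
    fix g assume [simp]: "g \<in> carrier G"
    have "(dlt q g (fst P) \<cdot> fst q \<star> \<sigma> P g) \<cdot> t (fst P) = dlt q g (fst P) \<cdot> t (fob (T g) (fst P)) \<cdot> fst p \<star> \<sigma> P g"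
      using nat_isoD(5)[OF n, of "\<sigma> P g"] by (simp add: cmp_assoc)
    also have "\<dots> = ((T g \<star> t (fst P)) \<cdot> dlt p g (fst P)) \<cdot> fst p \<star> \<sigma> P g"
      by (simp add: intertwinesD(2)[OF t] cmp_assoc)
    finally show "\<sigma> (cd (s P)) g \<cdot> und (s P) = (T g \<star> und (s P)) \<cdot> \<sigma> (dm (s P)) g"
      by (simp add: cmp_assoc)
  qed simp_all
  have "D.nat_iso (lift p) (lift q) s"
  proof (rule D.nat_isoI)
    fix P assume P [simp]: "P \<in> Obj D"
    show "D.invertible (s P)" by (rule iso_DI) simp_all
  next
    fix a assume a: "arr D a"
    show "s (cd a) \<cdot>\<^sub>D lift p \<star> a = (lift q \<star> a) \<cdot>\<^sub>D s (dm a)"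
      using a nat_isoD(5)[OF n, of "und a"] by (intro und_eqI) simp_all
  qed simp_all
  moreover have "D.dlt (elift q) \<chi> P \<cdot>\<^sub>D s (fob (S \<chi>) P) = (S \<chi> \<star> s P) \<cdot>\<^sub>D D.dlt (elift p) \<chi> P"
    if "\<chi> \<in> carrier DG" "P \<in> Obj D" for \<chi> P
    using that by (intro und_eqI) (simp_all add: dlt_elift lift_S)
  ultimately show ?thesis
    by (intro D.isomorphicI[of _ _ s] D.intertwinesI) simp_all
qed

end


section \<open>Sums of arrows\<close>

lemma (in abelian_monoid) finsum_swap:
  assumes "finite A" "finite B" "\<And>x y. x \<in> A \<Longrightarrow> y \<in> B \<Longrightarrow> f x y \<in> carrier G"
  shows "(\<Oplus>x \<in> A. \<Oplus>y \<in> B. f x y) = (\<Oplus>y \<in> B. \<Oplus>x \<in> A. f x y)"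
  using assms(1,3)
proof (induction A rule: finite_induct)
  case empty
  then show ?case by simp
next
  case (insert x A)
  have "(\<Oplus>y \<in> B. \<Oplus>x \<in> insert x A. f x y) = (\<Oplus>y \<in> B. f x y \<oplus> (\<Oplus>x \<in> A. f x y))"
    using insert by (intro finsum_cong') (auto intro!: finsum_closed a_closed)
  also have "\<dots> = (\<Oplus>y \<in> B. f x y) \<oplus> (\<Oplus>y \<in> B. \<Oplus>x \<in> A. f x y)"
    using insert by (intro finsum_addf) (auto intro!: finsum_closed)
  finally show ?case using insert by (auto intro!: finsum_closed)
qed

lemma (in module) smult_finsum_left:
  assumes "finite A" "x \<in> carrier M" "\<And>i. i \<in> A \<Longrightarrow> f i \<in> carrier R"
  shows "(\<Oplus>i \<in> A. f i) \<odot>\<^bsub>M\<^esub> x = (\<Oplus>\<^bsub>M\<^esub>i \<in> A. f i \<odot>\<^bsub>M\<^esub> x)"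
  using assms
proof (induction A rule: finite_induct)
  case (insert i A)
  have "(\<Oplus>i \<in> insert i A. f i) = f i \<oplus> (\<Oplus>i \<in> A. f i)"
    using insert by (intro R.finsum_insert) auto
  moreover have "(\<Oplus>\<^bsub>M\<^esub>i \<in> insert i A. f i \<odot>\<^bsub>M\<^esub> x) = f i \<odot>\<^bsub>M\<^esub> x \<oplus>\<^bsub>M\<^esub> (\<Oplus>\<^bsub>M\<^esub>i \<in> A. f i \<odot>\<^bsub>M\<^esub> x)"
    using insert by (intro M.finsum_insert) auto
  moreover have "(\<Oplus>i \<in> A. f i) \<in> carrier R" using insert by (intro R.finsum_closed) auto
  ultimately show ?case using insert by (simp add: smult_l_distr)
qed simp

context linear_category begin

definition homs :: "'o \<Rightarrow> 'o \<Rightarrow> ('o, 'm) arrow set" where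
  "homs X Y = {a. arrow a \<and> dm a = X \<and> cd a = Y}"

definition add_arr (infixl \<open>\<boxplus>\<close> 65) where
  "a \<boxplus> b = Arrow (dm a) (cd a) (mp a \<oplus>\<^bsub>Hom C (dm a) (cd a)\<^esub> mp b)"

definition sum_arr :: "'o \<Rightarrow> 'o \<Rightarrow> ('i \<Rightarrow> ('o, 'm) arrow) \<Rightarrow> 'i set \<Rightarrow> ('o, 'm) arrow" where
  "sum_arr X Y f I = Arrow X Y (finsum (Hom C X Y) (\<lambda>i. mp (f i)) I)"

lemma homsI: "arrow a \<Longrightarrow> dm a = X \<Longrightarrow> cd a = Y \<Longrightarrow> a \<in> homs X Y"
  by (simp add: homs_def)

lemma homsD [simp]: "a \<in> homs X Y \<Longrightarrow> arrow a" "a \<in> homs X Y \<Longrightarrow> dm a = X" "a \<in> homs X Y \<Longrightarrow> cd a = Y"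
  by (simp_all add: homs_def)

lemma homs_obj: "a \<in> homs X Y \<Longrightarrow> X \<in> Obj C" "a \<in> homs X Y \<Longrightarrow> Y \<in> Obj C"
  by (metis homsD arr_obj)+

lemma homs_mp: "a \<in> homs X Y \<Longrightarrow> mp a \<in> Mor C X Y"
  by (metis homsD arr_def)

lemma homs_eqI: "a \<in> homs X Y \<Longrightarrow> b \<in> homs X Y \<Longrightarrow> mp a = mp b \<Longrightarrow> a = b"
  by (rule arrow.expand) simp

lemma mp_add: "a \<in> homs X Y \<Longrightarrow> mp (a \<boxplus> b) = mp a \<oplus>\<^bsub>Hom C X Y\<^esub> mp b"
  by (simp add: add_arr_def)

lemma Arrow_homs: "m \<in> Mor C X Y \<Longrightarrow> X \<in> Obj C \<Longrightarrow> Y \<in> Obj C \<Longrightarrow> Arrow X Y m \<in> homs X Y"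
  by (simp add: homs_def arr_def del: arr_obj homsD)

lemma add_arr_sel [simp]: "dm (a \<boxplus> b) = dm a" "cd (a \<boxplus> b) = cd a"
  by (simp_all add: add_arr_def)

lemma sum_arr_sel [simp]: "dm (sum_arr X Y f I) = X" "cd (sum_arr X Y f I) = Y"
  by (simp_all add: sum_arr_def)

lemma arr_add [simp]:
  assumes "arrow a" "arrow b" "dm a = dm b" "cd a = cd b"
  shows "arrow (a \<boxplus> b)"
proof -
  interpret H: module K "Hom C (dm b) (cd b)" using assms by (intro Hom_module) simp_all
  show ?thesis using assms by (auto simp: arr_def add_arr_def simp del: arr_obj)
qed

lemma add_homs: "a \<in> homs X Y \<Longrightarrow> b \<in> homs X Y \<Longrightarrow> a \<boxplus> b \<in> homs X Y"
  by (rule homsI) simp_all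

lemma scale_homs: "c \<in> carrier K \<Longrightarrow> a \<in> homs X Y \<Longrightarrow> scale c a \<in> homs X Y"
  by (rule homsI) simp_all

lemma sum_homs:
  assumes "X \<in> Obj C" "Y \<in> Obj C" "\<And>i. i \<in> I \<Longrightarrow> f i \<in> homs X Y"
  shows "sum_arr X Y f I \<in> homs X Y"
proof -
  interpret H: module K "Hom C X Y" using assms by (intro Hom_module) simp_all
  show ?thesis unfolding sum_arr_def
    using assms by (intro Arrow_homs H.finsum_closed) (auto intro: homs_mp)
qed

lemma cmp_homs: "a \<in> homs X Y \<Longrightarrow> b \<in> homs Y Z \<Longrightarrow> b \<cdot> a \<in> homs X Z"
  by (rule homsI) simp_all

lemma cmp_add_left [simp]:
  "\<lbrakk>arrow a; arrow b; arrow b'; cd a = dm b; dm b = dm b'; cd b = cd b'\<rbrakk> \<Longrightarrow> (b \<boxplus> b') \<cdot> a = b \<cdot> a \<boxplus> b' \<cdot> a"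
  by (simp add: arr_def cmp_def add_arr_def Comp_add_left del: arr_obj)

lemma cmp_add_right [simp]:
  "\<lbrakk>arrow a; arrow a'; arrow b; cd a = dm b; dm a = dm a'; cd a = cd a'\<rbrakk> \<Longrightarrow> b \<cdot> (a \<boxplus> a') = b \<cdot> a \<boxplus> b \<cdot> a'"
  by (simp add: arr_def cmp_def add_arr_def Comp_add_right del: arr_obj)

lemma fap_add:
  "\<lbrakk>linear_functor K C C F; arrow a; arrow b; dm a = dm b; cd a = cd b\<rbrakk> \<Longrightarrow> F \<star> (a \<boxplus> b) = F \<star> a \<boxplus> F \<star> b"
  by (simp add: linear_functor_def arr_def fap_def add_arr_def del: arr_obj)

text \<open>
  Linear maps between spaces of morphisms, as operations on arrows: in this form they can be
  composed from the composition of arrows and the application of functors.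
\<close>

definition linear_op :: "'o \<Rightarrow> 'o \<Rightarrow> 'o \<Rightarrow> 'o \<Rightarrow> (('o, 'm) arrow \<Rightarrow> ('o, 'm) arrow) \<Rightarrow> bool" where
  "linear_op X Y X' Y' \<phi> \<longleftrightarrow> X' \<in> Obj C \<and> Y' \<in> Obj C \<and> (\<forall>a \<in> homs X Y. \<phi> a \<in> homs X' Y') \<and>
     (\<forall>a \<in> homs X Y. \<forall>b \<in> homs X Y. \<phi> (a \<boxplus> b) = \<phi> a \<boxplus> \<phi> b) \<and>
     (\<forall>c \<in> carrier K. \<forall>a \<in> homs X Y. \<phi> (scale c a) = scale c (\<phi> a))"

lemma linear_opI:
  assumes "X' \<in> Obj C" "Y' \<in> Obj C" "\<And>a. a \<in> homs X Y \<Longrightarrow> \<phi> a \<in> homs X' Y'"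
    "\<And>a b. a \<in> homs X Y \<Longrightarrow> b \<in> homs X Y \<Longrightarrow> \<phi> (a \<boxplus> b) = \<phi> a \<boxplus> \<phi> b"
    "\<And>c a. c \<in> carrier K \<Longrightarrow> a \<in> homs X Y \<Longrightarrow> \<phi> (scale c a) = scale c (\<phi> a)"
  shows "linear_op X Y X' Y' \<phi>"
  using assms by (simp add: linear_op_def)

lemma linear_opD:
  assumes "linear_op X Y X' Y' \<phi>"
  shows "a \<in> homs X Y \<Longrightarrow> \<phi> a \<in> homs X' Y'" "a \<in> homs X Y \<Longrightarrow> b \<in> homs X Y \<Longrightarrow> \<phi> (a \<boxplus> b) = \<phi> a \<boxplus> \<phi> b"
    "c \<in> carrier K \<Longrightarrow> a \<in> homs X Y \<Longrightarrow> \<phi> (scale c a) = scale c (\<phi> a)"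
    "X' \<in> Obj C" "Y' \<in> Obj C"
  using assms by (auto simp: linear_op_def)

lemma sum_arr_empty:
  assumes "a \<in> homs X Y"
  shows "sum_arr X Y f {} = scale \<zero> a"
proof -
  interpret H: module K "Hom C X Y" using homs_obj[OF assms(1)] by (rule Hom_module)
  show ?thesis using homs_mp[OF assms(1)] assms by (simp add: scale_def sum_arr_def)
qed

lemma sum_arr_insert:
  assumes "finite I" "i \<notin> I" "\<And>j. j \<in> insert i I \<Longrightarrow> f j \<in> homs X Y"
  shows "sum_arr X Y f (insert i I) = f i \<boxplus> sum_arr X Y f I"
proof -
  have i: "f i \<in> homs X Y" using assms by simp
  interpret H: module K "Hom C X Y" using homs_obj[OF i] by (rule Hom_module)
  show ?thesis using assms homs_mp by (simp add: add_arr_def sum_arr_def homsD(2,3)[OF i])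
qed

lemma sum_arr_cong:
  assumes "X \<in> Obj C" "Y \<in> Obj C" "\<And>i. i \<in> I \<Longrightarrow> f i \<in> homs X Y" "\<And>i. i \<in> I \<Longrightarrow> f i = f' i"
  shows "sum_arr X Y f I = sum_arr X Y f' I"
proof -
  interpret H: module K "Hom C X Y" using assms by (intro Hom_module) simp_all
  have "mp (f' i) \<in> Mor C X Y" if "i \<in> I" for i
    using homs_mp[OF assms(3)[OF that]] assms(4)[OF that] by simp
  then have "finsum (Hom C X Y) (\<lambda>i. mp (f i)) I = finsum (Hom C X Y) (\<lambda>i. mp (f' i)) I"
    by (intro H.finsum_cong') (auto simp: assms(4))
  then show ?thesis by (simp add: sum_arr_def)
qed

lemma linear_op_sum:
  assumes \<phi>: "linear_op X Y X' Y' \<phi>" and I: "finite I" and f: "\<And>i. i \<in> I \<Longrightarrow> f i \<in> homs X Y"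
    and X: "X \<in> Obj C" "Y \<in> Obj C"
  shows "\<phi> (sum_arr X Y f I) = sum_arr X' Y' (\<lambda>i. \<phi> (f i)) I"
  using I f
proof (induction I rule: finite_induct)
  case empty
  interpret H: module K "Hom C X Y" by (rule Hom_module[OF X])
  have z: "sum_arr X Y f {} \<in> homs X Y" by (rule sum_homs) (use X in auto)
  then show ?case
    by (metis sum_arr_empty linear_opD(1,3)[OF \<phi>] K.zero_closed)
next
  case (insert i I)
  then have "sum_arr X Y f I \<in> homs X Y" using X by (intro sum_homs) auto
  then show ?case using insert X
    by (subst (1 2) sum_arr_insert) (auto simp: linear_opD[OF \<phi>])
qed

lemma linear_op_comp:
  "linear_op X Y X' Y' \<phi> \<Longrightarrow> linear_op X' Y' X'' Y'' \<psi> \<Longrightarrow> linear_op X Y X'' Y'' (\<lambda>a. \<psi> (\<phi> a))"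
  by (simp add: linear_op_def)

lemma linear_op_scale: "c \<in> carrier K \<Longrightarrow> X \<in> Obj C \<Longrightarrow> Y \<in> Obj C \<Longrightarrow> linear_op X Y X Y (scale c)"
proof (rule linear_opI)
  fix a b assume c: "c \<in> carrier K" and ab: "a \<in> homs X Y" "b \<in> homs X Y"
  interpret H: module K "Hom C X Y" using homs_obj[OF ab(1)] by (rule Hom_module)
  show "scale c (a \<boxplus> b) = scale c a \<boxplus> scale c b"
    using c ab homs_mp by (simp add: scale_def add_arr_def H.smult_r_distr)
qed (auto simp: scale_homs m_comm)

lemma linear_op_left: "b \<in> homs Y Z \<Longrightarrow> X \<in> Obj C \<Longrightarrow> linear_op X Y X Z (\<lambda>a. b \<cdot> a)"
  by (rule linear_opI) (auto simp: homs_obj intro: cmp_homs)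

lemma linear_op_right: "b \<in> homs Z X \<Longrightarrow> Y \<in> Obj C \<Longrightarrow> linear_op X Y Z Y (\<lambda>a. a \<cdot> b)"
  by (rule linear_opI) (auto simp: homs_obj intro: cmp_homs)

lemma linear_op_fap: "linear_functor K C C F \<Longrightarrow> X \<in> Obj C \<Longrightarrow> Y \<in> Obj C \<Longrightarrow>
    linear_op X Y (fob F X) (fob F Y) (\<lambda>a. F \<star> a)"
  by (rule linear_opI) (auto simp: fap_add fap_scale linear_functor_def intro: homsI)

lemma linear_op_sum_fun:
  assumes I: "finite I" and \<phi>: "\<And>i. i \<in> I \<Longrightarrow> linear_op X Y X' Y' (\<phi> i)" and X: "X' \<in> Obj C" "Y' \<in> Obj C"
  shows "linear_op X Y X' Y' (\<lambda>a. sum_arr X' Y' (\<lambda>i. \<phi> i a) I)"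
proof (rule linear_opI)
  interpret H: module K "Hom C X' Y'" using X by (rule Hom_module)
  fix a b c assume a: "a \<in> homs X Y"
  then show "sum_arr X' Y' (\<lambda>i. \<phi> i a) I \<in> homs X' Y'"
    using X linear_opD(1)[OF \<phi>] by (intro sum_homs) auto
  have mem: "mp (\<phi> i x) \<in> Mor C X' Y'" if "i \<in> I" "x \<in> homs X Y" for i x
    using linear_opD(1)[OF \<phi>] that homs_mp by blast
  {
    assume b: "b \<in> homs X Y"
    have "finsum (Hom C X' Y') (\<lambda>i. mp (\<phi> i (a \<boxplus> b))) I =
       finsum (Hom C X' Y') (\<lambda>i. mp (\<phi> i a) \<oplus>\<^bsub>Hom C X' Y'\<^esub> mp (\<phi> i b)) I"
      using a b mem by (intro H.finsum_cong') (auto simp: linear_opD(2)[OF \<phi>] mp_add[OF linear_opD(1)[OF \<phi>]])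
    also have "\<dots> = finsum (Hom C X' Y') (\<lambda>i. mp (\<phi> i a)) I \<oplus>\<^bsub>Hom C X' Y'\<^esub> finsum (Hom C X' Y') (\<lambda>i. mp (\<phi> i b)) I"
      using a b mem by (intro H.finsum_addf) auto
    finally show "sum_arr X' Y' (\<lambda>i. \<phi> i (a \<boxplus> b)) I = sum_arr X' Y' (\<lambda>i. \<phi> i a) I \<boxplus> sum_arr X' Y' (\<lambda>i. \<phi> i b) I"
      by (simp add: sum_arr_def add_arr_def)
  next
    assume c: "c \<in> carrier K"
    have "scale c (sum_arr X' Y' (\<lambda>i. \<phi> i a) I) = sum_arr X' Y' (\<lambda>i. scale c (\<phi> i a)) I"
      using linear_opD(1)[OF \<phi> a] I X c by (intro linear_op_sum linear_op_scale) auto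
    then show "sum_arr X' Y' (\<lambda>i. \<phi> i (scale c a)) I = scale c (sum_arr X' Y' (\<lambda>i. \<phi> i a) I)"
      using a c X scale_homs[OF c a] linear_opD[OF \<phi>]
      by (auto intro!: sum_arr_cong)
  }
qed (use X in auto)

definition zero_arr where "zero_arr X Y = Arrow X Y \<zero>\<^bsub>Hom C X Y\<^esub>"

lemma zero_arr_sel [simp]: "dm (zero_arr X Y) = X" "cd (zero_arr X Y) = Y"
  by (simp_all add: zero_arr_def)

lemma zero_homs: "X \<in> Obj C \<Longrightarrow> Y \<in> Obj C \<Longrightarrow> zero_arr X Y \<in> homs X Y"
  unfolding zero_arr_def using Hom_module by (intro Arrow_homs) (auto simp: module_def abelian_group_def abelian_monoid.zero_closed)

lemma cmp_zero_right: "b \<in> homs Y Z \<Longrightarrow> X \<in> Obj C \<Longrightarrow> b \<cdot> zero_arr X Y = zero_arr X Z"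
  using homs_obj[of b Y Z] homs_mp[of b Y Z] by (simp add: zero_arr_def cmp_def Comp_zero_right)

lemma cmp_zero_left: "a \<in> homs X Y \<Longrightarrow> Z \<in> Obj C \<Longrightarrow> zero_arr Y Z \<cdot> a = zero_arr X Z"
  using homs_obj[of a X Y] homs_mp[of a X Y] by (simp add: zero_arr_def cmp_def Comp_zero_left)

lemma fap_zero: "linear_functor K C C F \<Longrightarrow> X \<in> Obj C \<Longrightarrow> Y \<in> Obj C \<Longrightarrow>
    F \<star> zero_arr X Y = zero_arr (fob F X) (fob F Y)"
  by (simp add: zero_arr_def fap_def linear_functor_zero)

lemma scale_zero_eq:
  assumes "a \<in> homs X Y"
  shows "scale \<zero> a = zero_arr X Y"
proof -
  interpret M: module K "Hom C X Y" using homs_obj[OF assms] by (rule Hom_module)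
  show ?thesis using homs_mp[OF assms] assms by (simp add: scale_def zero_arr_def)
qed

lemma sum_arr_single:
  assumes "finite I" "j \<in> I" "a \<in> homs X Y"
  shows "sum_arr X Y (\<lambda>i. if j = i then a else zero_arr X Y) I = a"
proof (rule homs_eqI[OF sum_homs assms(3)])
  interpret M: module K "Hom C X Y" using homs_obj[OF assms(3)] by (rule Hom_module)
  have "mp (sum_arr X Y (\<lambda>i. if j = i then a else zero_arr X Y) I) =
      (\<Oplus>\<^bsub>Hom C X Y\<^esub>i \<in> I. if j = i then mp a else \<zero>\<^bsub>Hom C X Y\<^esub>)"
    unfolding sum_arr_def using homs_mp[OF assms(3)] by (auto intro!: M.finsum_cong' simp: zero_arr_def)
  also have "\<dots> = mp a" using assms homs_mp[OF assms(3)] by (intro M.finsum_singleton) auto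
  finally show "mp (sum_arr X Y (\<lambda>i. if j = i then a else zero_arr X Y) I) = mp a" .
qed (use assms(3) homs_obj[OF assms(3)] zero_homs in auto)

lemma linear_functorI:
  assumes F: "functor F" and "\<And>X Y. X \<in> Obj C \<Longrightarrow> Y \<in> Obj C \<Longrightarrow> linear_op X Y (fob F X) (fob F Y) (\<lambda>a. F \<star> a)"
  shows "linear_functor K C C F"
  unfolding linear_functor_def
proof (intro conjI ballI)
  fix X Y f assume XY: "X \<in> Obj C" "Y \<in> Obj C" and f: "f \<in> Mor C X Y"
  note L = linear_opD[OF assms(2)[OF XY]]
  note f' = Arrow_homs[OF f XY]
  {
    fix g assume g: "g \<in> Mor C X Y"
    show "fmor F X Y (f \<oplus>\<^bsub>Hom C X Y\<^esub> g) = fmor F X Y f \<oplus>\<^bsub>Hom C (fob F X) (fob F Y)\<^esub> fmor F X Y g"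
      using L(2)[OF f' Arrow_homs[OF g XY]] by (simp add: add_arr_def fap_def)
  next
    fix c assume c: "c \<in> carrier K"
    show "fmor F X Y (c \<odot>\<^bsub>Hom C X Y\<^esub> f) = c \<odot>\<^bsub>Hom C (fob F X) (fob F Y)\<^esub> fmor F X Y f"
      using L(3)[OF c f'] by (simp add: scale_def fap_def)
  }
qed (rule F)

end


section \<open>Decomposing arrows of \<open>C\<close> into homogeneous arrows of the equivariantization\<close>

locale split_category = dual_category K C G A
  for K :: "('k, 'e) ring_scheme" (structure) and C :: "('k, 'o, 'm) lin_cat"
    and G :: "('g, 'f) monoid_scheme" and A :: "('g, 'o, 'm) cat_action" +
  assumes finite_G: "finite (carrier G)" and split: "splits_over K G"
begin

lemma normalisation: "\<exists>c. c \<in> carrier K \<and> finite (carrier DG) \<and>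
    (\<forall>g \<in> carrier G. c \<otimes> (\<Oplus>\<chi> \<in> carrier DG. \<chi> g) = (if g = \<one>\<^bsub>G\<^esub> then \<one> else \<zero>)) \<and>
    (\<forall>\<chi> \<in> carrier DG. \<forall>\<psi> \<in> carrier DG.
      c \<otimes> (\<Oplus>g \<in> carrier G. \<chi> g \<otimes> \<psi> (inv\<^bsub>G\<^esub> g)) = (if \<chi> = \<psi> then \<one> else \<zero>))"
  using character_sums[OF finite_G split] by blast

text \<open>The inverse of the order of \<open>G\<close> in \<open>K\<close>.\<close>

definition nrm :: 'k where
  "nrm = (SOME c. c \<in> carrier K \<and> finite (carrier DG) \<and>
    (\<forall>g \<in> carrier G. c \<otimes> (\<Oplus>\<chi> \<in> carrier DG. \<chi> g) = (if g = \<one>\<^bsub>G\<^esub> then \<one> else \<zero>)) \<and>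
    (\<forall>\<chi> \<in> carrier DG. \<forall>\<psi> \<in> carrier DG.
      c \<otimes> (\<Oplus>g \<in> carrier G. \<chi> g \<otimes> \<psi> (inv\<^bsub>G\<^esub> g)) = (if \<chi> = \<psi> then \<one> else \<zero>)))"

lemma nrm [simp]: "nrm \<in> carrier K" and finite_DG: "finite (carrier DG)"
  and sum_characters: "g \<in> carrier G \<Longrightarrow>
    nrm \<otimes> (\<Oplus>\<chi> \<in> carrier DG. \<chi> g) = (if g = \<one>\<^bsub>G\<^esub> then \<one> else \<zero>)"
  and character_orthogonality: "\<chi> \<in> carrier DG \<Longrightarrow> \<psi> \<in> carrier DG \<Longrightarrow>
    nrm \<otimes> (\<Oplus>g \<in> carrier G. \<chi> g \<otimes> \<psi> (inv\<^bsub>G\<^esub> g)) = (if \<chi> = \<psi> then \<one> else \<zero>)"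
  using someI_ex[OF normalisation] unfolding nrm_def[symmetric] by auto

text \<open>The action of \<open>g\<close> on the morphisms \<open>U P \<rightarrow> U Q\<close>.\<close>

definition conj_act where
  "conj_act P Q g a = inv_arr (\<sigma> Q g) \<cdot> (T g \<star> a) \<cdot> \<sigma> P g"

lemma conj_sel [simp]: "dm (conj_act P Q g a) = fst P"
  "Q \<in> Obj D \<Longrightarrow> g \<in> carrier G \<Longrightarrow> cd (conj_act P Q g a) = fst Q"
  by (simp_all add: conj_act_def)

lemma conj_homs:
  assumes "P \<in> Obj D" "Q \<in> Obj D" "g \<in> carrier G" "a \<in> homs (fst P) (fst Q)"
  shows "conj_act P Q g a \<in> homs (fst P) (fst Q)"
  unfolding conj_act_def using assms by (intro homsI) simp_all

lemma str_conj:
  assumes "P \<in> Obj D" "Q \<in> Obj D" "g \<in> carrier G" "a \<in> homs (fst P) (fst Q)"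
  shows "\<sigma> Q g \<cdot> conj_act P Q g a = (T g \<star> a) \<cdot> \<sigma> P g"
  unfolding conj_act_def using assms by simp

lemma conj_unique:
  assumes "P \<in> Obj D" "Q \<in> Obj D" "g \<in> carrier G" "b \<in> homs (fst P) (fst Q)"
    and "\<sigma> Q g \<cdot> b = (T g \<star> a) \<cdot> \<sigma> P g"
  shows "conj_act P Q g a = b"
  unfolding conj_act_def assms(5)[symmetric] using assms(1-4) by simp

lemma linear_op_conj:
  assumes "P \<in> Obj D" "Q \<in> Obj D" "g \<in> carrier G"
  shows "linear_op (fst P) (fst Q) (fst P) (fst Q) (conj_act P Q g)"
proof -
  note [simp] = assms
  have 1: "linear_op (fst P) (fst Q) (fob (T g) (fst P)) (fob (T g) (fst Q)) (\<lambda>a. T g \<star> a)"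
    by (rule linear_op_fap[OF act_linear]) simp_all
  have 2: "linear_op (fob (T g) (fst P)) (fob (T g) (fst Q)) (fst P) (fob (T g) (fst Q)) (\<lambda>a. a \<cdot> \<sigma> P g)"
    by (rule linear_op_right) (auto intro: homsI)
  have 3: "linear_op (fst P) (fob (T g) (fst Q)) (fst P) (fst Q) (\<lambda>a. inv_arr (\<sigma> Q g) \<cdot> a)"
    by (rule linear_op_left) (auto intro: homsI)
  from linear_op_comp[OF linear_op_comp[OF 1 2] 3] show ?thesis
    by (simp add: conj_act_def[abs_def])
qed

lemma conj_mult:
  assumes "P \<in> Obj D" "Q \<in> Obj D" "g \<in> carrier G" "h \<in> carrier G" "a \<in> homs (fst P) (fst Q)"
  shows "conj_act P Q g (conj_act P Q h a) = conj_act P Q (g *\<^sub>G h) a"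
proof (rule conj_unique[symmetric])
  note [simp] = assms
  have b: "conj_act P Q h a \<in> homs (fst P) (fst Q)" by (rule conj_homs) simp_all
  note [simp] = homsD[OF b] homsD[OF conj_homs[OF assms(1-3) b]] homsD[OF assms(5)]
  have "\<sigma> Q (g *\<^sub>G h) \<cdot> conj_act P Q g (conj_act P Q h a) = eps g h (fst Q) \<cdot> (T g \<star> \<sigma> Q h) \<cdot> \<sigma> Q g \<cdot> conj_act P Q g (conj_act P Q h a)"
    by (simp add: str_mult cmp_assoc)
  also have "\<dots> = eps g h (fst Q) \<cdot> T g \<star> (\<sigma> Q h \<cdot> conj_act P Q h a) \<cdot> \<sigma> P g"
    by (simp add: str_conj[OF _ _ _ b] fap_cmp cmp_assoc)
  also have "\<dots> = (eps g h (cd a) \<cdot> T g \<star> T h \<star> a) \<cdot> (T g \<star> \<sigma> P h) \<cdot> \<sigma> P g"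
    by (simp add: str_conj[OF _ _ _ assms(5)] fap_cmp cmp_assoc)
  also have "\<dots> = ((T (g *\<^sub>G h) \<star> a) \<cdot> eps g h (dm a)) \<cdot> (T g \<star> \<sigma> P h) \<cdot> \<sigma> P g"
    by (subst eps_natural) simp_all
  finally show "\<sigma> Q (g *\<^sub>G h) \<cdot> conj_act P Q g (conj_act P Q h a) = (T (g *\<^sub>G h) \<star> a) \<cdot> \<sigma> P (g *\<^sub>G h)"
    by (simp add: str_mult cmp_assoc)
qed (use assms in \<open>auto intro: conj_homs\<close>)

text \<open>
  The operator of the unit element is idempotent, and it is injective because \<open>F\<^sub>1\<close> is faithful.
\<close>

lemma conj_one:
  assumes "P \<in> Obj D" "Q \<in> Obj D" "a \<in> homs (fst P) (fst Q)"
  shows "conj_act P Q \<one>\<^bsub>G\<^esub> a = a"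
proof -
  note [simp] = assms(1,2) homsD[OF assms(3)]
  have b: "conj_act P Q \<one>\<^bsub>G\<^esub> a \<in> homs (fst P) (fst Q)" using assms by (intro conj_homs) simp_all
  note [simp] = homsD[OF b]
  have "conj_act P Q \<one>\<^bsub>G\<^esub> (conj_act P Q \<one>\<^bsub>G\<^esub> a) = conj_act P Q \<one>\<^bsub>G\<^esub> a"
    using assms by (simp add: conj_mult)
  then have "(T \<one>\<^bsub>G\<^esub> \<star> conj_act P Q \<one>\<^bsub>G\<^esub> a) \<cdot> \<sigma> P \<one>\<^bsub>G\<^esub> = (T \<one>\<^bsub>G\<^esub> \<star> a) \<cdot> \<sigma> P \<one>\<^bsub>G\<^esub>"
    using str_conj[OF assms(1,2) G.one_closed b] str_conj[OF assms(1,2) G.one_closed assms(3)] by simp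
  then have "T \<one>\<^bsub>G\<^esub> \<star> conj_act P Q \<one>\<^bsub>G\<^esub> a = T \<one>\<^bsub>G\<^esub> \<star> a"
    by (rule iso_cancel_right) simp_all
  then show ?thesis
    by (rule autoequivalence_faithful[OF act_autoequivalence[OF G.one_closed]]) simp_all
qed

text \<open>A partial inverse of \<open>und\<close>: an arrow between the equivariant objects \<open>P\<close> and \<open>Q\<close>.\<close>

definition hom_arrow where "hom_arrow P Q a = Arrow P Q (mp a)"

lemma hom_arrow_sel [simp]: "dm (hom_arrow P Q a) = P" "cd (hom_arrow P Q a) = Q"
  by (simp_all add: hom_arrow_def)

lemma und_hom_arrow [simp]: "a \<in> homs (fst P) (fst Q) \<Longrightarrow> und (hom_arrow P Q a) = a"
  by (rule arrow.expand) (simp add: und_def hom_arrow_def)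

lemma hom_arrow_und: "dm b = P \<Longrightarrow> cd b = Q \<Longrightarrow> hom_arrow P Q (und b) = b"
  by (rule arrow.expand) (simp add: und_def hom_arrow_def)

lemma und_add: "und (D.add_arr a b) = und a \<boxplus> und b"
  by (simp add: und_def D.add_arr_def add_arr_def Hom_D_sel)

lemma und_scale: "und (D.scale c a) = scale c (und a)"
  by (simp add: und_def D.scale_def scale_def Hom_D_sel)

lemma hom_arrow_add: "a \<in> homs (fst P) (fst Q) \<Longrightarrow> hom_arrow P Q (a \<boxplus> b) = D.add_arr (hom_arrow P Q a) (hom_arrow P Q b)"
  by (simp add: hom_arrow_def D.add_arr_def add_arr_def Hom_D_sel)

lemma hom_arrow_scale: "a \<in> homs (fst P) (fst Q) \<Longrightarrow> hom_arrow P Q (scale c a) = D.scale c (hom_arrow P Q a)"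
  by (simp add: hom_arrow_def D.scale_def scale_def Hom_D_sel)

lemma hom_arrow_zero: "hom_arrow P Q (zero_arr (fst P) (fst Q)) = D.zero_arr P Q"
  by (simp add: hom_arrow_def D.zero_arr_def zero_arr_def Hom_D_sel)

lemma und_zero: "und (D.zero_arr P Q) = zero_arr (fst P) (fst Q)"
  by (simp add: und_def D.zero_arr_def zero_arr_def Hom_D_sel)

text \<open>
  This lemma and the next one identify the morphisms \<open>P \<rightarrow> F\<^sub>\<chi> Q\<close> of \<open>D\<close> with the morphisms
  \<open>U P \<rightarrow> U Q\<close> on which each \<open>g\<close> acts by \<open>\<chi>(g\<^sup>-\<^sup>1)\<close>. Such morphisms are called homogeneous of degree
  \<open>\<chi>\<close>.
\<close>

lemma conj_homogeneous:
  assumes b: "arr D b" "dm b = P" "cd b = fob (S \<chi>) Q" and Q: "Q \<in> Obj D" and \<chi>: "\<chi> \<in> carrier DG"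
    and g: "g \<in> carrier G"
  shows "conj_act P Q g (und b) = scale (\<chi> (inv\<^bsub>G\<^esub> g)) (und b)"
proof (rule conj_unique)
  have P: "P \<in> Obj D" using b by auto
  show "\<sigma> Q g \<cdot> scale (\<chi> (inv\<^bsub>G\<^esub> g)) (und b) = (T g \<star> und b) \<cdot> \<sigma> P g"
    using und_str[OF b(1) g] b P Q \<chi> g by (simp add: dual_char)
qed (use b Q g dual_char[OF \<chi>] in \<open>auto intro!: homsI\<close>)

lemma homogeneous_arrow:
  assumes P: "P \<in> Obj D" and Q: "Q \<in> Obj D" and \<chi>: "\<chi> \<in> carrier DG" and a: "a \<in> homs (fst P) (fst Q)"
    and h: "\<And>g. g \<in> carrier G \<Longrightarrow> conj_act P Q g a = scale (\<chi> (inv\<^bsub>G\<^esub> g)) a"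
  shows "arr D (hom_arrow P (fob (S \<chi>) Q) a)"
proof (rule arr_DI)
  have u [simp]: "und (hom_arrow P (fob (S \<chi>) Q) a) = a" using a by simp
  fix g assume g: "g \<in> carrier G"
  show "\<sigma> (cd (hom_arrow P (fob (S \<chi>) Q) a)) g \<cdot> und (hom_arrow P (fob (S \<chi>) Q) a) =
      (T g \<star> und (hom_arrow P (fob (S \<chi>) Q) a)) \<cdot> \<sigma> (dm (hom_arrow P (fob (S \<chi>) Q) a)) g"
    using str_conj[OF P Q g a] P Q g a dual_char[OF \<chi>] by (simp add: h)
qed (use assms in \<open>auto simp: S_closed\<close>)

text \<open>The projection to the homogeneous part of degree \<open>\<chi>\<close>.\<close>

definition proj where
  "proj P Q \<chi> a = scale nrm (sum_arr (fst P) (fst Q) (\<lambda>g. scale (\<chi> g) (conj_act P Q g a)) (carrier G))"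

lemma linear_op_proj:
  assumes P: "P \<in> Obj D" and Q: "Q \<in> Obj D" and \<chi>: "\<chi> \<in> carrier DG"
  shows "linear_op (fst P) (fst Q) (fst P) (fst Q) (proj P Q \<chi>)"
proof -
  have "linear_op (fst P) (fst Q) (fst P) (fst Q) (\<lambda>a. scale (\<chi> g) (conj_act P Q g a))" if "g \<in> carrier G" for g
    by (rule linear_op_comp[OF linear_op_conj linear_op_scale]) (use assms that dual_char(1)[OF \<chi>] in auto)
  then have "linear_op (fst P) (fst Q) (fst P) (fst Q)
      (\<lambda>a. sum_arr (fst P) (fst Q) (\<lambda>g. scale (\<chi> g) (conj_act P Q g a)) (carrier G))"
    using P Q finite_G by (intro linear_op_sum_fun) auto
  from linear_op_comp[OF this linear_op_scale[OF nrm]] show ?thesis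
    using P Q by (simp add: proj_def[abs_def])
qed

lemma proj_homogeneous:
  assumes P: "P \<in> Obj D" and Q: "Q \<in> Obj D" and \<chi>: "\<chi> \<in> carrier DG" and a: "a \<in> homs (fst P) (fst Q)"
    and h: "h \<in> carrier G"
  shows "conj_act P Q h (proj P Q \<chi> a) = scale (\<chi> (inv\<^bsub>G\<^esub> h)) (proj P Q \<chi> a)"
proof -
  let ?X = "fst P" and ?Y = "fst Q"
  note [simp] = dual_char[OF \<chi>]
  interpret H: module K "Hom C ?X ?Y" using P Q by (intro Hom_module) simp_all
  have conj_act: "conj_act P Q g a \<in> homs ?X ?Y" if "g \<in> carrier G" for g using that P Q a by (intro conj_homs)
  have summand: "scale (\<chi> g) (conj_act P Q g a) \<in> homs ?X ?Y" if "g \<in> carrier G" for g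
    using that conj_act by (intro scale_homs) auto
  have lin: "linear_op ?X ?Y ?X ?Y (\<lambda>b. conj_act P Q h (scale nrm b))"
    by (rule linear_op_comp[OF linear_op_scale linear_op_conj]) (use P Q h in auto)
  have lin': "linear_op ?X ?Y ?X ?Y (\<lambda>b. scale (\<chi> (inv\<^bsub>G\<^esub> h)) (scale nrm b))"
    by (rule linear_op_comp[OF linear_op_scale linear_op_scale]) (use P Q h in auto)
  have inj: "inj_on (\<lambda>g. h *\<^sub>G g) (carrier G)" using h by (intro inj_onI) simp
  have im: "(\<lambda>g. h *\<^sub>G g) ` carrier G = carrier G" using h by (intro G.surj_const_mult)
  define f where "f g = scale (nrm \<otimes> \<chi> (inv\<^bsub>G\<^esub> h *\<^sub>G g)) (conj_act P Q g a)" for g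
  have f: "f g \<in> homs ?X ?Y" if "g \<in> carrier G" for g
    unfolding f_def using that h conj_act by (intro scale_homs) auto
  have "conj_act P Q h (proj P Q \<chi> a) = sum_arr ?X ?Y (\<lambda>g. conj_act P Q h (scale nrm (scale (\<chi> g) (conj_act P Q g a)))) (carrier G)"
    unfolding proj_def using P Q summand finite_G by (intro linear_op_sum[OF lin]) auto
  also have "\<dots> = sum_arr ?X ?Y (\<lambda>g. f (h *\<^sub>G g)) (carrier G)"
  proof (rule sum_arr_cong)
    fix g assume g: "g \<in> carrier G"
    show "conj_act P Q h (scale nrm (scale (\<chi> g) (conj_act P Q g a))) = f (h *\<^sub>G g)"
      using g h conj_act[OF g] P Q a by (simp add: linear_opD(3)[OF linear_op_conj] conj_mult f_def
         G.m_assoc[symmetric] scale_homs)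
    show "conj_act P Q h (scale nrm (scale (\<chi> g) (conj_act P Q g a))) \<in> homs ?X ?Y"
      using conj_homs[OF P Q h scale_homs[OF nrm summand[OF g]]] .
  qed (use P Q in auto)
  also have "\<dots> = sum_arr ?X ?Y f ((\<lambda>g. h *\<^sub>G g) ` carrier G)"
    unfolding sum_arr_def using f by (subst H.finsum_reindex[OF _ inj]) (auto simp: im homs_mp)
  also have "\<dots> = sum_arr ?X ?Y (\<lambda>g. scale (\<chi> (inv\<^bsub>G\<^esub> h)) (scale nrm (scale (\<chi> g) (conj_act P Q g a)))) (carrier G)"
    unfolding im
  proof (rule sum_arr_cong)
    fix g assume g: "g \<in> carrier G"
    show "f g = scale (\<chi> (inv\<^bsub>G\<^esub> h)) (scale nrm (scale (\<chi> g) (conj_act P Q g a)))"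
      using g h conj_act[OF g] by (simp add: f_def m_lcomm)
  qed (use P Q f in auto)
  also have "\<dots> = scale (\<chi> (inv\<^bsub>G\<^esub> h)) (proj P Q \<chi> a)"
    unfolding proj_def using P Q summand finite_G by (intro linear_op_sum[OF lin', symmetric]) auto
  finally show ?thesis .
qed

text \<open>
  Exchanging the two summations leaves the term of \<open>g = 1\<close> only, by the formula for \<open>\<Sum>\<^sub>\<chi> \<chi>(g)\<close>.
\<close>

lemma sum_proj:
  assumes P: "P \<in> Obj D" and Q: "Q \<in> Obj D" and a: "a \<in> homs (fst P) (fst Q)"
  shows "sum_arr (fst P) (fst Q) (\<lambda>\<chi>. proj P Q \<chi> a) (carrier DG) = a"
proof -
  let ?X = "fst P" and ?Y = "fst Q"
  interpret H: module K "Hom C ?X ?Y" using P Q by (intro Hom_module) simp_all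
  have conj_act: "conj_act P Q g a \<in> homs ?X ?Y" if "g \<in> carrier G" for g using that P Q a by (intro conj_homs)
  define m where "m g = mp (conj_act P Q g a)" for g
  have m: "m g \<in> Mor C ?X ?Y" if "g \<in> carrier G" for g unfolding m_def using conj_act[OF that] by (rule homs_mp)
  have char: "\<chi> g \<in> carrier K" if "\<chi> \<in> carrier DG" "g \<in> carrier G" for \<chi> g using that by (rule dual_char)
  have mp_proj: "mp (proj P Q \<chi> a) = (\<Oplus>\<^bsub>Hom C ?X ?Y\<^esub>g \<in> carrier G. (nrm \<otimes> \<chi> g) \<odot>\<^bsub>Hom C ?X ?Y\<^esub> m g)"
    if \<chi>: "\<chi> \<in> carrier DG" for \<chi>
  proof -
    have "mp (proj P Q \<chi> a) = nrm \<odot>\<^bsub>Hom C ?X ?Y\<^esub> (\<Oplus>\<^bsub>Hom C ?X ?Y\<^esub>g \<in> carrier G. \<chi> g \<odot>\<^bsub>Hom C ?X ?Y\<^esub> m g)"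
      using Q conj_act by (auto simp: proj_def scale_def sum_arr_def m_def char[OF \<chi>] intro!: arg_cong[where f = "\<lambda>x. nrm \<odot>\<^bsub>Hom C ?X ?Y\<^esub> x"] H.finsum_cong' homs_mp)
    also have "\<dots> = (\<Oplus>\<^bsub>Hom C ?X ?Y\<^esub>g \<in> carrier G. nrm \<odot>\<^bsub>Hom C ?X ?Y\<^esub> (\<chi> g \<odot>\<^bsub>Hom C ?X ?Y\<^esub> m g))"
      using m char[OF \<chi>] finite_G by (intro H.finsum_smult_ldistr) auto
    also have "\<dots> = (\<Oplus>\<^bsub>Hom C ?X ?Y\<^esub>g \<in> carrier G. (nrm \<otimes> \<chi> g) \<odot>\<^bsub>Hom C ?X ?Y\<^esub> m g)"
      using m char[OF \<chi>] by (intro H.finsum_cong') (auto simp: H.smult_assoc1)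
    finally show ?thesis .
  qed
  have "(\<Oplus>\<^bsub>Hom C ?X ?Y\<^esub>\<chi> \<in> carrier DG. mp (proj P Q \<chi> a)) =
      (\<Oplus>\<^bsub>Hom C ?X ?Y\<^esub>\<chi> \<in> carrier DG. \<Oplus>\<^bsub>Hom C ?X ?Y\<^esub>g \<in> carrier G. (nrm \<otimes> \<chi> g) \<odot>\<^bsub>Hom C ?X ?Y\<^esub> m g)"
    using m char by (intro H.finsum_cong') (auto simp: mp_proj intro!: H.finsum_closed)
  also have "\<dots> = (\<Oplus>\<^bsub>Hom C ?X ?Y\<^esub>g \<in> carrier G. \<Oplus>\<^bsub>Hom C ?X ?Y\<^esub>\<chi> \<in> carrier DG. (nrm \<otimes> \<chi> g) \<odot>\<^bsub>Hom C ?X ?Y\<^esub> m g)"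
    using m char finite_G finite_DG by (intro H.finsum_swap) auto
  also have "\<dots> = (\<Oplus>\<^bsub>Hom C ?X ?Y\<^esub>g \<in> carrier G. if \<one>\<^bsub>G\<^esub> = g then m g else \<zero>\<^bsub>Hom C ?X ?Y\<^esub>)"
  proof (rule H.finsum_cong')
    fix g assume g: "g \<in> carrier G"
    have "(\<Oplus>\<^bsub>Hom C ?X ?Y\<^esub>\<chi> \<in> carrier DG. (nrm \<otimes> \<chi> g) \<odot>\<^bsub>Hom C ?X ?Y\<^esub> m g) =
        (\<Oplus>\<chi> \<in> carrier DG. nrm \<otimes> \<chi> g) \<odot>\<^bsub>Hom C ?X ?Y\<^esub> m g"
      using finite_DG m[OF g] char[OF _ g] by (intro H.smult_finsum_left[symmetric]) auto
    also have "(\<Oplus>\<chi> \<in> carrier DG. nrm \<otimes> \<chi> g) = nrm \<otimes> (\<Oplus>\<chi> \<in> carrier DG. \<chi> g)"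
      using finite_DG char[OF _ g] by (intro finsum_rdistr[symmetric]) auto
    also have "\<dots> \<odot>\<^bsub>Hom C ?X ?Y\<^esub> m g = (if \<one>\<^bsub>G\<^esub> = g then m g else \<zero>\<^bsub>Hom C ?X ?Y\<^esub>)"
      using m[OF g] by (auto simp: sum_characters[OF g])
    finally show "(\<Oplus>\<^bsub>Hom C ?X ?Y\<^esub>\<chi> \<in> carrier DG. (nrm \<otimes> \<chi> g) \<odot>\<^bsub>Hom C ?X ?Y\<^esub> m g) =
      (if \<one>\<^bsub>G\<^esub> = g then m g else \<zero>\<^bsub>Hom C ?X ?Y\<^esub>)" .
  qed (use m in auto)
  also have "\<dots> = m \<one>\<^bsub>G\<^esub>" using m finite_G by (intro H.finsum_singleton) auto
  also have "\<dots> = mp a" using conj_one[OF P Q a] by (simp add: m_def)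
  finally show ?thesis
    using a P Q by (intro homs_eqI[of _ ?X ?Y] sum_homs linear_opD(1)[OF linear_op_proj[OF P Q] a]) (auto simp: sum_arr_def)
qed

text \<open>
  The tool by which statements about \<open>D\<close> and the dual action are turned into statements about all
  morphisms of \<open>C\<close> between underlying objects.
\<close>

lemma homogeneous_ext:
  assumes P: "P \<in> Obj D" and Q: "Q \<in> Obj D"
    and \<phi>: "linear_op (fst P) (fst Q) X Y \<phi>" and \<phi>': "linear_op (fst P) (fst Q) X Y \<phi>'"
    and eq: "\<And>\<chi> b. \<chi> \<in> carrier DG \<Longrightarrow> arr D b \<Longrightarrow> dm b = P \<Longrightarrow> cd b = fob (S \<chi>) Q \<Longrightarrow> \<phi> (und b) = \<phi>' (und b)"
    and a: "a \<in> homs (fst P) (fst Q)"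
  shows "\<phi> a = \<phi>' a"
proof -
  have proj: "proj P Q \<chi> a \<in> homs (fst P) (fst Q)" if "\<chi> \<in> carrier DG" for \<chi>
    using linear_opD(1)[OF linear_op_proj[OF P Q that] a] .
  have e: "\<phi> (proj P Q \<chi> a) = \<phi>' (proj P Q \<chi> a)" if \<chi>: "\<chi> \<in> carrier DG" for \<chi>
  proof -
    have "arr D (hom_arrow P (fob (S \<chi>) Q) (proj P Q \<chi> a))"
      using P Q \<chi> a proj[OF \<chi>] by (intro homogeneous_arrow proj_homogeneous)
    then show ?thesis using eq[OF \<chi>] proj[OF \<chi>] by fastforce
  qed
  have "\<phi> (sum_arr (fst P) (fst Q) (\<lambda>\<chi>. proj P Q \<chi> a) (carrier DG)) =
      sum_arr X Y (\<lambda>\<chi>. \<phi> (proj P Q \<chi> a)) (carrier DG)"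
    using P Q proj by (intro linear_op_sum[OF \<phi> finite_DG]) auto
  also have "\<dots> = sum_arr X Y (\<lambda>\<chi>. \<phi>' (proj P Q \<chi> a)) (carrier DG)"
    using linear_opD(4,5)[OF \<phi>] linear_opD(1)[OF \<phi> proj] by (intro sum_arr_cong e) auto
  also have "\<dots> = \<phi>' (sum_arr (fst P) (fst Q) (\<lambda>\<chi>. proj P Q \<chi> a) (carrier DG))"
    using P Q proj by (intro linear_op_sum[OF \<phi>' finite_DG, symmetric]) auto
  finally show ?thesis by (simp add: sum_proj[OF P Q a])
qed

lemma proj_of_homogeneous:
  assumes b: "arr D b" "dm b = P" "cd b = fob (S \<psi>) Q" and Q: "Q \<in> Obj D"
    and \<psi>: "\<psi> \<in> carrier DG" and \<chi>: "\<chi> \<in> carrier DG"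
  shows "proj P Q \<chi> (und b) = scale (if \<chi> = \<psi> then \<one> else \<zero>) (und b)"
proof -
  have P: "P \<in> Obj D" using b by auto
  let ?X = "fst P" and ?Y = "fst Q"
  interpret H: module K "Hom C ?X ?Y" using P Q by (intro Hom_module) simp_all
  have a: "und b \<in> homs ?X ?Y" using b by (intro homsI) simp_all
  have m: "mp (und b) \<in> Mor C ?X ?Y" using a by (rule homs_mp)
  note [simp] = dual_char[OF \<chi>] dual_char[OF \<psi>]
  have "proj P Q \<chi> (und b) = scale nrm (sum_arr ?X ?Y (\<lambda>g. scale (\<chi> g \<otimes> \<psi> (inv\<^bsub>G\<^esub> g)) (und b)) (carrier G))"
    unfolding proj_def using P Q b \<psi> a
    by (intro arg_cong[where f = "scale nrm"] sum_arr_cong) (auto simp: conj_homogeneous intro!: scale_homs)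
  also have "sum_arr ?X ?Y (\<lambda>g. scale (\<chi> g \<otimes> \<psi> (inv\<^bsub>G\<^esub> g)) (und b)) (carrier G) =
      scale (\<Oplus>g \<in> carrier G. \<chi> g \<otimes> \<psi> (inv\<^bsub>G\<^esub> g)) (und b)"
    using finite_G m b by (subst scale_def) (simp add: sum_arr_def scale_def H.smult_finsum_left)
  also have "scale nrm \<dots> = scale (nrm \<otimes> (\<Oplus>g \<in> carrier G. \<chi> g \<otimes> \<psi> (inv\<^bsub>G\<^esub> g))) (und b)"
    using a by (intro scale_scale finsum_closed) auto
  finally show ?thesis using character_orthogonality[OF \<chi> \<psi>] by simp
qed

end


section \<open>Induced objects\<close>

context linear_category begin

definition finite_biproduct ::
  "'i set \<Rightarrow> ('i \<Rightarrow> 'o) \<Rightarrow> 'o \<Rightarrow> ('i \<Rightarrow> ('o, 'm) arrow) \<Rightarrow> ('i \<Rightarrow> ('o, 'm) arrow) \<Rightarrow> bool" where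
  "finite_biproduct I F B \<iota> \<pi> \<longleftrightarrow> finite I \<and> B \<in> Obj C \<and> (\<forall>s \<in> I. \<iota> s \<in> homs (F s) B \<and> \<pi> s \<in> homs B (F s)) \<and>
     (\<forall>s \<in> I. \<forall>t \<in> I. \<pi> s \<cdot> \<iota> t = (if s = t then ide (F s) else zero_arr (F t) (F s))) \<and>
     sum_arr B B (\<lambda>s. \<iota> s \<cdot> \<pi> s) I = ide B"

lemma finite_biproductD:
  assumes "finite_biproduct I F B \<iota> \<pi>"
  shows "finite I" "B \<in> Obj C" "s \<in> I \<Longrightarrow> \<iota> s \<in> homs (F s) B" "s \<in> I \<Longrightarrow> \<pi> s \<in> homs B (F s)"
    "s \<in> I \<Longrightarrow> t \<in> I \<Longrightarrow> \<pi> s \<cdot> \<iota> t = (if s = t then ide (F s) else zero_arr (F t) (F s))"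
    "sum_arr B B (\<lambda>s. \<iota> s \<cdot> \<pi> s) I = ide B" "s \<in> I \<Longrightarrow> F s \<in> Obj C"
  using assms homs_obj unfolding finite_biproduct_def by blast+

lemma finite_biproduct_joint_epi:
  assumes B: "finite_biproduct I F B \<iota> \<pi>" and a: "a \<in> homs B Z" "b \<in> homs B Z"
    and eq: "\<And>s. s \<in> I \<Longrightarrow> a \<cdot> \<iota> s = b \<cdot> \<iota> s"
  shows "a = b"
proof -
  note BD = finite_biproductD[OF B]
  have expand: "c = sum_arr B Z (\<lambda>s. (c \<cdot> \<iota> s) \<cdot> \<pi> s) I" if c: "c \<in> homs B Z" for c
  proof -
    have "c = c \<cdot> sum_arr B B (\<lambda>s. \<iota> s \<cdot> \<pi> s) I" using c by (simp add: BD(6))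
    also have "\<dots> = sum_arr B Z (\<lambda>s. c \<cdot> \<iota> s \<cdot> \<pi> s) I"
      by (rule linear_op_sum[OF linear_op_left[OF c BD(2)]]) (use BD cmp_homs[OF BD(4) BD(3)] in auto)
    also have "\<dots> = sum_arr B Z (\<lambda>s. (c \<cdot> \<iota> s) \<cdot> \<pi> s) I"
      using c BD homs_obj[OF c]
      by (intro sum_arr_cong cmp_homs[OF cmp_homs c]) (auto simp: cmp_assoc homsD[OF BD(3)] homsD[OF BD(4)])
    finally show ?thesis .
  qed
  have "sum_arr B Z (\<lambda>s. (a \<cdot> \<iota> s) \<cdot> \<pi> s) I = sum_arr B Z (\<lambda>s. (b \<cdot> \<iota> s) \<cdot> \<pi> s) I"
    using BD homs_obj[OF a(1)] by (intro sum_arr_cong cmp_homs[OF BD(4) cmp_homs[OF BD(3) a(1)]]) (auto simp: eq)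
  then show ?thesis using expand[OF a(1)] expand[OF a(2)] by simp
qed

lemma finite_biproduct_copair:
  assumes B: "finite_biproduct I F B \<iota> \<pi>" and f: "\<And>s. s \<in> I \<Longrightarrow> f s \<in> homs (F s) Z" and Z: "Z \<in> Obj C"
  shows "\<exists>a \<in> homs B Z. \<forall>s \<in> I. a \<cdot> \<iota> s = f s"
proof (intro bexI ballI)
  note BD = finite_biproductD[OF B]
  let ?a = "sum_arr B Z (\<lambda>s. f s \<cdot> \<pi> s) I"
  show "?a \<in> homs B Z" using BD(2) Z by (intro sum_homs cmp_homs[OF BD(4) f])
  fix t assume t: "t \<in> I"
  have "?a \<cdot> \<iota> t = sum_arr (F t) Z (\<lambda>s. (f s \<cdot> \<pi> s) \<cdot> \<iota> t) I"
    by (rule linear_op_sum[OF linear_op_right[OF BD(3)[OF t] Z]]) (use BD(1,2,7) Z t cmp_homs[OF BD(4) f] in auto)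
  also have "\<dots> = sum_arr (F t) Z (\<lambda>s. if t = s then f t else zero_arr (F t) Z) I"
  proof (rule sum_arr_cong)
    fix s assume s: "s \<in> I"
    show "(f s \<cdot> \<pi> s) \<cdot> \<iota> t \<in> homs (F t) Z"
      by (rule cmp_homs[OF BD(3)[OF t] cmp_homs[OF BD(4)[OF s] f[OF s]]])
    have "(f s \<cdot> \<pi> s) \<cdot> \<iota> t = f s \<cdot> \<pi> s \<cdot> \<iota> t"
      using homsD[OF f[OF s]] homsD[OF BD(4)[OF s]] homsD[OF BD(3)[OF t]] by (simp add: cmp_assoc)
    then show "(f s \<cdot> \<pi> s) \<cdot> \<iota> t = (if t = s then f t else zero_arr (F t) Z)"
      using BD(5)[OF s t] homsD[OF f[OF s]] cmp_zero_right[OF f[OF s] BD(7)[OF t]] by auto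
  qed (use BD t Z in auto)
  also have "\<dots> = f t" by (rule sum_arr_single[OF BD(1) t f[OF t]])
  finally show "?a \<cdot> \<iota> t = f t" .
qed

lemma finite_biproduct_functor:
  assumes B: "finite_biproduct I F B \<iota> \<pi>" and L: "linear_functor K C C L"
  shows "finite_biproduct I (\<lambda>s. fob L (F s)) (fob L B) (\<lambda>s. L \<star> \<iota> s) (\<lambda>s. L \<star> \<pi> s)"
  unfolding finite_biproduct_def
proof (intro conjI ballI)
  note BD = finite_biproductD[OF B]
  have [simp]: "functor L" using L by (simp add: linear_functor_def)
  show "finite I" "fob L B \<in> Obj C" using BD by simp_all
  fix s assume s: "s \<in> I"
  show "L \<star> \<iota> s \<in> homs (fob L (F s)) (fob L B)" "L \<star> \<pi> s \<in> homs (fob L B) (fob L (F s))"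
    using homsD[OF BD(3)[OF s]] homsD[OF BD(4)[OF s]] by (auto intro: homsI)
  fix t assume t: "t \<in> I"
  have "(L \<star> \<pi> s) \<cdot> L \<star> \<iota> t = L \<star> (\<pi> s \<cdot> \<iota> t)"
    using homsD[OF BD(4)[OF s]] homsD[OF BD(3)[OF t]] by (simp add: fap_cmp)
  then show "(L \<star> \<pi> s) \<cdot> L \<star> \<iota> t =
      (if s = t then ide (fob L (F s)) else zero_arr (fob L (F t)) (fob L (F s)))"
    using BD(5)[OF s t] BD(7)[OF s] BD(7)[OF t] by (simp add: fap_zero[OF L])
next
  note BD = finite_biproductD[OF B]
  have [simp]: "functor L" using L by (simp add: linear_functor_def)
  have "L \<star> sum_arr B B (\<lambda>s. \<iota> s \<cdot> \<pi> s) I = sum_arr (fob L B) (fob L B) (\<lambda>s. L \<star> (\<iota> s \<cdot> \<pi> s)) I"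
    by (rule linear_op_sum[OF linear_op_fap[OF L]]) (use BD cmp_homs[OF BD(4) BD(3)] in auto)
  also have "\<dots> = sum_arr (fob L B) (fob L B) (\<lambda>s. (L \<star> \<iota> s) \<cdot> L \<star> \<pi> s) I"
    using BD by (intro sum_arr_cong) (auto simp: fap_cmp homsD[OF BD(3)] homsD[OF BD(4)] intro!: homsI)
  finally show "sum_arr (fob L B) (fob L B) (\<lambda>s. (L \<star> \<iota> s) \<cdot> L \<star> \<pi> s) I = ide (fob L B)"
    using BD by simp
qed

end

context additive_linear_category begin

lemma finite_biproduct_exists:
  fixes I :: "'i set"
  assumes "finite I" "\<And>s. s \<in> I \<Longrightarrow> F s \<in> Obj C"
  shows "\<exists>B \<iota> \<pi>. finite_biproduct I F B \<iota> \<pi>"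
  using assms
proof (induction I rule: finite_induct)
  case empty
  obtain Z where Z: "zero_object C Z" using zero_object_exists by blast
  then have [simp]: "Z \<in> Obj C" by (simp add: zero_object_def)
  have "\<exists>!f. f \<in> Mor C Z Z" using Z by (simp add: zero_object_def)
  then have "sum_arr Z Z (\<lambda>s. f s) {} = ide Z" for f :: "'i \<Rightarrow> _"
    using homs_mp[OF sum_homs[of Z Z "{}" f]] Id_closed[of Z] by (auto simp: sum_arr_def ida_def)
  then show ?case by (intro exI[of _ Z]) (simp add: finite_biproduct_def)
next
  case (insert i I)
  then obtain B \<iota> \<pi> where B: "finite_biproduct I F B \<iota> \<pi>" by auto
  note BD = finite_biproductD[OF B]
  have Fi [simp]: "F i \<in> Obj C" using insert by simp
  obtain B' i' j' p' q' where bi: "biproduct C (F i) B B' i' j' p' q'"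
    using biproduct_exists[OF Fi BD(2)] by blast
  define i1 where "i1 = Arrow (F i) B' i'"
  define j where "j = Arrow B B' j'"
  define p where "p = Arrow B' (F i) p'"
  define q where "q = Arrow B' B q'"
  have B' [simp]: "B' \<in> Obj C" using bi by (simp add: biproduct_def)
  have mem: "i1 \<in> homs (F i) B'" "j \<in> homs B B'" "p \<in> homs B' (F i)" "q \<in> homs B' B"
    using bi BD(2) unfolding i1_def j_def p_def q_def biproduct_def by (auto intro!: Arrow_homs)
  note [simp] = homsD[OF mem(1)] homsD[OF mem(2)] homsD[OF mem(3)] homsD[OF mem(4)]
  have eqs: "p \<cdot> i1 = ide (F i)" "q \<cdot> j = ide B" "p \<cdot> j = zero_arr B (F i)" "q \<cdot> i1 = zero_arr (F i) B"
    "i1 \<cdot> p \<boxplus> j \<cdot> q = ide B'"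
    using bi unfolding i1_def j_def p_def q_def biproduct_def
    by (simp_all add: cmp_def ida_def zero_arr_def add_arr_def)
  define \<iota>' where "\<iota>' s = (if s = i then i1 else j \<cdot> \<iota> s)" for s
  define \<pi>' where "\<pi>' s = (if s = i then p else \<pi> s \<cdot> q)" for s
  have I: "\<iota>' s = j \<cdot> \<iota> s" "\<pi>' s = \<pi> s \<cdot> q" "arrow (\<iota> s)" "arrow (\<pi> s)" "dm (\<iota> s) = F s" "cd (\<iota> s) = B"
    "dm (\<pi> s) = B" "cd (\<pi> s) = F s" "F s \<in> Obj C" if "s \<in> I" for s
    using that insert(2) homsD[OF BD(3)[OF that]] homsD[OF BD(4)[OF that]] BD(7)[OF that]
    by (auto simp: \<iota>'_def \<pi>'_def)
  have i: "\<iota>' i = i1" "\<pi>' i = p" by (simp_all add: \<iota>'_def \<pi>'_def)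
  have "finite_biproduct (insert i I) F B' \<iota>' \<pi>'"
    unfolding finite_biproduct_def
  proof (intro conjI ballI)
    show "finite (insert i I)" using insert by simp
    fix s assume s: "s \<in> insert i I"
    show "\<iota>' s \<in> homs (F s) B'" "\<pi>' s \<in> homs B' (F s)"
      using s I i mem by (auto intro!: homsI)
    fix t assume t: "t \<in> insert i I"
    have 1: "(\<pi> s \<cdot> q) \<cdot> j \<cdot> \<iota> t = \<pi> s \<cdot> \<iota> t" if "s \<in> I" "t \<in> I" for s t
    proof -
      have "(\<pi> s \<cdot> q) \<cdot> j \<cdot> \<iota> t = \<pi> s \<cdot> (q \<cdot> j) \<cdot> \<iota> t" using I that by (simp add: cmp_assoc)
      then show ?thesis using I that by (simp add: eqs)
    qed
    have 2: "p \<cdot> j \<cdot> \<iota> t = zero_arr (F t) (F i)" if "t \<in> I" for t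
    proof -
      have "p \<cdot> j \<cdot> \<iota> t = (p \<cdot> j) \<cdot> \<iota> t" using I that by (simp add: cmp_assoc)
      then show ?thesis using BD(3)[OF that] by (simp add: eqs cmp_zero_left)
    qed
    have 3: "(\<pi> s \<cdot> q) \<cdot> i1 = zero_arr (F i) (F s)" if "s \<in> I" for s
      using I that BD(4)[OF that] by (simp add: cmp_assoc eqs cmp_zero_right)
    show "\<pi>' s \<cdot> \<iota>' t = (if s = t then ide (F s) else zero_arr (F t) (F s))"
      using s t insert(2) I i 1 2 3 BD(5) eqs(1) by auto
  next
    have "sum_arr B' B' (\<lambda>s. \<iota>' s \<cdot> \<pi>' s) (insert i I) = i1 \<cdot> p \<boxplus> sum_arr B' B' (\<lambda>s. \<iota>' s \<cdot> \<pi>' s) I"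
      using insert I i mem by (subst sum_arr_insert) (auto intro!: homsI)
    also have "sum_arr B' B' (\<lambda>s. \<iota>' s \<cdot> \<pi>' s) I = sum_arr B' B' (\<lambda>s. j \<cdot> (\<iota> s \<cdot> \<pi> s) \<cdot> q) I"
      using I by (intro sum_arr_cong) (auto simp: cmp_assoc intro!: homsI)
    also have "\<dots> = j \<cdot> sum_arr B B (\<lambda>s. \<iota> s \<cdot> \<pi> s) I \<cdot> q"
      by (rule linear_op_sum[OF linear_op_comp[OF linear_op_right[OF mem(4)] linear_op_left[OF mem(2)]], symmetric])
        (use BD I in \<open>auto intro!: homsI\<close>)
    also have "\<dots> = j \<cdot> q" by (simp add: BD(6))
    finally show "sum_arr B' B' (\<lambda>s. \<iota>' s \<cdot> \<pi>' s) (insert i I) = ide B'" by (simp add: eqs)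
  qed (rule B')
  then show ?case by blast
qed

end

locale equivariantization_setting = split_category K C G A + additive_linear_category K C
  for K :: "('k, 'e) ring_scheme" (structure) and C :: "('k, 'o, 'm) lin_cat"
    and G :: "('g, 'f) monoid_scheme" and A :: "('g, 'o, 'm) cat_action" +
  assumes idempotents_split: "idempotent_complete C"
begin

text \<open>
  The group permutes the summands of \<open>\<Oplus>\<^sub>g F\<^sub>g Y\<close>: the structure isomorphism \<open>\<alpha>\<^sub>h\<close> is the
  arrow with \<open>\<alpha>\<^sub>h \<circ> \<iota>\<^bsub>hg\<^esub> \<circ> \<epsilon>\<^bsub>h,g\<^esub> = F\<^sub>h \<iota>\<^sub>g\<close>. As \<open>F\<^sub>h\<close> preserves
  biproducts, everything can be tested on summands.
\<close>

lemma induced_object: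
  assumes Y [simp]: "Y \<in> Obj C"
  shows "\<exists>P \<iota> \<pi>. P \<in> Obj D \<and> finite_biproduct (carrier G) (\<lambda>g. fob (T g) Y) (fst P) \<iota> \<pi>"
proof -
  obtain B \<iota> \<pi> where B: "finite_biproduct (carrier G) (\<lambda>g. fob (T g) Y) B \<iota> \<pi>"
    using finite_biproduct_exists[OF finite_G, of "\<lambda>g. fob (T g) Y"] by auto
  note BD = finite_biproductD[OF B]
  note [simp] = BD(2) homsD[OF BD(3)] homsD[OF BD(4)]
  have TB: "finite_biproduct (carrier G) (\<lambda>g. fob (T h) (fob (T g) Y)) (fob (T h) B) (\<lambda>g. T h \<star> \<iota> g) (\<lambda>g. T h \<star> \<pi> g)"
    if "h \<in> carrier G" for h
    by (rule finite_biproduct_functor[OF B act_linear[OF that]])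
  have "\<exists>a \<in> homs B (fob (T h) B). \<forall>k \<in> carrier G. a \<cdot> \<iota> k =
      (T h \<star> \<iota> (inv\<^bsub>G\<^esub> h *\<^sub>G k)) \<cdot> inv_arr (eps h (inv\<^bsub>G\<^esub> h *\<^sub>G k) Y)" if [simp]: "h \<in> carrier G" for h
    by (rule finite_biproduct_copair[OF B]) (auto intro!: homsI simp: G.m_assoc[symmetric])
  then obtain \<alpha> where \<alpha>: "\<And>h. h \<in> carrier G \<Longrightarrow> \<alpha> h \<in> homs B (fob (T h) B)"
    and \<alpha>_\<iota>: "\<And>h k. h \<in> carrier G \<Longrightarrow> k \<in> carrier G \<Longrightarrow> \<alpha> h \<cdot> \<iota> k =
      (T h \<star> \<iota> (inv\<^bsub>G\<^esub> h *\<^sub>G k)) \<cdot> inv_arr (eps h (inv\<^bsub>G\<^esub> h *\<^sub>G k) Y)"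
    by metis
  note [simp] = homsD[OF \<alpha>]
  have \<alpha>_eps: "\<alpha> h \<cdot> \<iota> (h *\<^sub>G g) \<cdot> eps h g Y = T h \<star> \<iota> g" if [simp]: "h \<in> carrier G" "g \<in> carrier G" for h g
  proof -
    have [simp]: "inv\<^bsub>G\<^esub> h *\<^sub>G (h *\<^sub>G g) = g" by (simp add: G.m_assoc[symmetric])
    have "\<alpha> h \<cdot> \<iota> (h *\<^sub>G g) \<cdot> eps h g Y = (\<alpha> h \<cdot> \<iota> (h *\<^sub>G g)) \<cdot> eps h g Y"
      by (simp add: cmp_assoc)
    then show ?thesis by (simp add: \<alpha>_\<iota> cmp_assoc)
  qed
  have iso: "invertible (\<alpha> h)" if [simp]: "h \<in> carrier G" for h
  proof -
    have "\<exists>b \<in> homs (fob (T h) B) B. \<forall>g \<in> carrier G. b \<cdot> T h \<star> \<iota> g = \<iota> (h *\<^sub>G g) \<cdot> eps h g Y"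
      by (rule finite_biproduct_copair[OF TB]) (auto intro!: homsI)
    then obtain b where b: "b \<in> homs (fob (T h) B) B"
      and b_\<iota>: "\<And>g. g \<in> carrier G \<Longrightarrow> b \<cdot> T h \<star> \<iota> g = \<iota> (h *\<^sub>G g) \<cdot> eps h g Y" by blast
    note [simp] = homsD[OF b]
    have "b \<cdot> \<alpha> h = ide B"
    proof (rule finite_biproduct_joint_epi[OF B])
      fix k assume [simp]: "k \<in> carrier G"
      have e [simp]: "h *\<^sub>G (inv\<^bsub>G\<^esub> h *\<^sub>G k) = k" by (simp add: G.m_assoc[symmetric])
      have "(b \<cdot> \<alpha> h) \<cdot> \<iota> k = (b \<cdot> T h \<star> \<iota> (inv\<^bsub>G\<^esub> h *\<^sub>G k)) \<cdot> inv_arr (eps h (inv\<^bsub>G\<^esub> h *\<^sub>G k) Y)"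
        by (simp add: \<alpha>_\<iota> cmp_assoc)
      then show "(b \<cdot> \<alpha> h) \<cdot> \<iota> k = ide B \<cdot> \<iota> k" by (simp add: b_\<iota> cmp_assoc)
    qed (auto intro!: homsI)
    moreover have "\<alpha> h \<cdot> b = ide (fob (T h) B)"
    proof (rule finite_biproduct_joint_epi[OF TB])
      fix g assume [simp]: "g \<in> carrier G"
      show "(\<alpha> h \<cdot> b) \<cdot> T h \<star> \<iota> g = ide (fob (T h) B) \<cdot> T h \<star> \<iota> g"
        by (simp add: cmp_assoc b_\<iota> \<alpha>_eps)
    qed (auto intro!: homsI)
    ultimately show ?thesis by (intro isoI[of _ b]) simp_all
  qed
  define P where "P = (B, \<lambda>g \<in> carrier G. mp (\<alpha> g))"
  have [simp]: "fst P = B" by (simp add: P_def)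
  have \<sigma> [simp]: "\<sigma> P g = \<alpha> g" if [simp]: "g \<in> carrier G" for g
    by (rule arrow.expand) (simp add: str_arrow_def P_def)
  have "\<alpha> (h *\<^sub>G l) = eps h l B \<cdot> (T h \<star> \<alpha> l) \<cdot> \<alpha> h" if [simp]: "h \<in> carrier G" "l \<in> carrier G" for h l
  proof (rule finite_biproduct_joint_epi[OF B])
    fix k assume [simp]: "k \<in> carrier G"
    define g where "g = inv\<^bsub>G\<^esub> (h *\<^sub>G l) *\<^sub>G k"
    have [simp]: "g \<in> carrier G" and k: "k = h *\<^sub>G l *\<^sub>G g"
      by (simp_all add: g_def G.m_assoc[symmetric])
    have "(\<alpha> (h *\<^sub>G l) \<cdot> \<iota> k) \<cdot> eps (h *\<^sub>G l) g Y \<cdot> eps h l (fob (T g) Y) =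
        (\<alpha> (h *\<^sub>G l) \<cdot> \<iota> (h *\<^sub>G l *\<^sub>G g) \<cdot> eps (h *\<^sub>G l) g Y) \<cdot> eps h l (fob (T g) Y)"
      by (simp add: k cmp_assoc)
    also have "\<dots> = eps h l B \<cdot> T h \<star> T l \<star> \<iota> g"
      using eps_natural[of h l "\<iota> g"] by (simp add: \<alpha>_eps)
    also have "\<dots> = eps h l B \<cdot> T h \<star> (\<alpha> l \<cdot> \<iota> (l *\<^sub>G g) \<cdot> eps l g Y)"
      by (simp add: \<alpha>_eps)
    also have "\<dots> = eps h l B \<cdot> (T h \<star> \<alpha> l) \<cdot> (T h \<star> \<iota> (l *\<^sub>G g)) \<cdot> T h \<star> eps l g Y"
      by (simp add: fap_cmp)
    also have "\<dots> = eps h l B \<cdot> (T h \<star> \<alpha> l) \<cdot> (\<alpha> h \<cdot> \<iota> (h *\<^sub>G (l *\<^sub>G g)) \<cdot> eps h (l *\<^sub>G g) Y) \<cdot> T h \<star> eps l g Y"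
      by (simp only: \<alpha>_eps G.m_closed that \<open>g \<in> carrier G\<close>)
    also have "\<dots> = ((eps h l B \<cdot> (T h \<star> \<alpha> l) \<cdot> \<alpha> h) \<cdot> \<iota> k) \<cdot> eps h (l *\<^sub>G g) Y \<cdot> T h \<star> eps l g Y"
      by (simp add: k G.m_assoc cmp_assoc)
    also have "eps h (l *\<^sub>G g) Y \<cdot> T h \<star> eps l g Y = eps (h *\<^sub>G l) g Y \<cdot> eps h l (fob (T g) Y)"
      by (rule eps_assoc[symmetric]) simp_all
    finally show "\<alpha> (h *\<^sub>G l) \<cdot> \<iota> k = (eps h l B \<cdot> (T h \<star> \<alpha> l) \<cdot> \<alpha> h) \<cdot> \<iota> k"
      by (rule iso_cancel_right) (simp_all add: k)
  qed (auto intro!: homsI)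
  then have "P \<in> Obj D"
    unfolding Obj_D by (simp add: iso) (simp add: P_def)
  then show ?thesis using B by (intro exI[of _ P]) auto
qed

text \<open>
  As \<open>F\<^sub>1\<close> is an equivalence, \<open>X \<cong> F\<^sub>1 Y\<close> for some \<open>Y\<close>, and \<open>F\<^sub>1 Y\<close> is a summand of the object
  induced from \<open>Y\<close>.
\<close>

lemma retract_exists:
  assumes X: "X \<in> Obj C"
  shows "\<exists>P i p. P \<in> Obj D \<and> i \<in> homs X (fst P) \<and> p \<in> homs (fst P) X \<and> p \<cdot> i = ide X"
proof -
  obtain Y a where Y: "Y \<in> Obj C" and a [simp]: "invertible a" "dm a = fob (T \<one>\<^bsub>G\<^esub>) Y" "cd a = X"
    using autoequivalence_surj[OF act_autoequivalence[OF G.one_closed] X] by blast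
  obtain P \<iota> \<pi> where P: "P \<in> Obj D" and B: "finite_biproduct (carrier G) (\<lambda>g. fob (T g) Y) (fst P) \<iota> \<pi>"
    using induced_object[OF Y] by blast
  note BD = finite_biproductD[OF B]
  note [simp] = homsD[OF BD(3)[OF G.one_closed]] homsD[OF BD(4)[OF G.one_closed]] Y X
  let ?i = "\<iota> \<one>\<^bsub>G\<^esub> \<cdot> inv_arr a" and ?p = "a \<cdot> \<pi> \<one>\<^bsub>G\<^esub>"
  have "?p \<cdot> ?i = a \<cdot> (\<pi> \<one>\<^bsub>G\<^esub> \<cdot> \<iota> \<one>\<^bsub>G\<^esub>) \<cdot> inv_arr a"
    by (simp add: cmp_assoc)
  also have "\<dots> = ide X" using BD(5)[OF G.one_closed G.one_closed] by simp
  finally show ?thesis using P by (intro exI[of _ P] exI[of _ ?i] exI[of _ ?p]) (auto intro!: homsI)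
qed

end


section \<open>Extending natural transformations from the image of the forgetful functor\<close>

context equivariantization_setting begin

text \<open>
  For every \<open>X\<close> an equivariant object \<open>cover X\<close> is chosen such that \<open>X\<close> is a retract of its
  underlying object, by \<open>emb X\<close> and \<open>ret X\<close>.
\<close>

definition retract_data where
  "retract_data X = (SOME t. fst t \<in> Obj D \<and> fst (snd t) \<in> homs X (fst (fst t)) \<and>
     snd (snd t) \<in> homs (fst (fst t)) X \<and> snd (snd t) \<cdot> fst (snd t) = ide X)"

definition cover where "cover X = fst (retract_data X)"
definition emb where "emb X = fst (snd (retract_data X))"
definition ret where "ret X = snd (snd (retract_data X))"

lemma cover_simps [simp]:
  assumes "X \<in> Obj C"
  shows "cover X \<in> Obj D" "arrow (emb X)" "dm (emb X) = X" "cd (emb X) = fst (cover X)"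
    "arrow (ret X)" "dm (ret X) = fst (cover X)" "cd (ret X) = X" "ret X \<cdot> emb X = ide X"
proof -
  obtain P i p where "P \<in> Obj D" "i \<in> homs X (fst P)" "p \<in> homs (fst P) X" "p \<cdot> i = ide X"
    using retract_exists[OF assms] by blast
  then have "\<exists>t. fst t \<in> Obj D \<and> fst (snd t) \<in> homs X (fst (fst t)) \<and>
     snd (snd t) \<in> homs (fst (fst t)) X \<and> snd (snd t) \<cdot> fst (snd t) = ide X"
    by (intro exI[of _ "(P, i, p)"]) simp
  from someI_ex[OF this] have c: "cover X \<in> Obj D" "emb X \<in> homs X (fst (cover X))"
    "ret X \<in> homs (fst (cover X)) X" "ret X \<cdot> emb X = ide X"
    unfolding retract_data_def[symmetric] cover_def emb_def ret_def by auto
  then show "cover X \<in> Obj D" "arrow (emb X)" "dm (emb X) = X" "cd (emb X) = fst (cover X)"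
    "arrow (ret X)" "dm (ret X) = fst (cover X)" "cd (ret X) = X" "ret X \<cdot> emb X = ide X"
    by (simp_all add: homsD[OF c(2)] homsD[OF c(3)])
qed

lemma ret_emb_cancel [simp]:
  "X \<in> Obj C \<Longrightarrow> arrow a \<Longrightarrow> cd a = X \<Longrightarrow> ret X \<cdot> emb X \<cdot> a = a"
  by (simp add: cmp_assoc[symmetric])

text \<open>The component of a natural transformation at a retract is determined by that at the object.\<close>

lemma natural_ext:
  assumes F [simp]: "functor F" "functor F'" and t: "natural F F' t" and s: "natural F F' s"
    and eq: "\<And>P. P \<in> Obj D \<Longrightarrow> t (fst P) = s (fst P)" and X [simp]: "X \<in> Obj C"
  shows "t X = s X"
proof -
  have u: "u X = (F' \<star> ret X) \<cdot> u (fst (cover X)) \<cdot> F \<star> emb X" if u: "natural F F' u" for u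
  proof -
    have [simp]: "arrow (u Y)" "dm (u Y) = fob F Y" "cd (u Y) = fob F' Y" if "Y \<in> Obj C" for Y
      using u that by (auto simp: natural_def)
    have "u X = (u X \<cdot> F \<star> ret X) \<cdot> F \<star> emb X"
      by (simp add: cmp_assoc fap_cmp[symmetric])
    also have "u X \<cdot> F \<star> ret X = (F' \<star> ret X) \<cdot> u (fst (cover X))"
      using u X cover_simps[OF X] unfolding natural_def by metis
    finally show ?thesis by (simp add: cmp_assoc)
  qed
  show ?thesis by (subst u[OF t], subst u[OF s]) (simp add: eq)
qed

definition extend where
  "extend F F' t X = (F' \<star> ret X) \<cdot> t (cover X) \<cdot> F \<star> emb X"

text \<open>
  The family has to be natural for all morphisms of \<open>C\<close> between underlying objects; this makes the
  extension independent of the chosen retractions.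
\<close>

lemma extend:
  assumes F [simp]: "functor F" "functor F'"
    and t: "\<And>P. P \<in> Obj D \<Longrightarrow> invertible (t P)" "\<And>P. P \<in> Obj D \<Longrightarrow> dm (t P) = fob F (fst P)"
      "\<And>P. P \<in> Obj D \<Longrightarrow> cd (t P) = fob F' (fst P)"
    and nat: "\<And>P Q a. P \<in> Obj D \<Longrightarrow> Q \<in> Obj D \<Longrightarrow> a \<in> homs (fst P) (fst Q) \<Longrightarrow> t Q \<cdot> F \<star> a = (F' \<star> a) \<cdot> t P"
  shows "nat_iso F F' (extend F F' t)" "P \<in> Obj D \<Longrightarrow> extend F F' t (fst P) = t P"
proof -
  note [simp] = t
  have sel [simp]: "arrow (extend F F' t X)" "dm (extend F F' t X) = fob F X" "cd (extend F F' t X) = fob F' X"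
    if "X \<in> Obj C" for X
    using that by (simp_all add: extend_def)
  show ext: "extend F F' t (fst P) = t P" if P [simp]: "P \<in> Obj D" for P
  proof -
    have "extend F F' t (fst P) = ((F' \<star> ret (fst P)) \<cdot> t (cover (fst P))) \<cdot> F \<star> emb (fst P)"
      by (simp add: extend_def cmp_assoc)
    also have "\<dots> = (t P \<cdot> F \<star> ret (fst P)) \<cdot> F \<star> emb (fst P)"
      by (subst nat[symmetric]) (auto intro: homsI)
    also have "\<dots> = t P" by (simp add: cmp_assoc fap_cmp[symmetric])
    finally show ?thesis .
  qed
  have conj: "t (cover (cd a)) \<cdot> F \<star> (emb (cd a) \<cdot> a \<cdot> ret (dm a)) = (F' \<star> (emb (cd a) \<cdot> a \<cdot> ret (dm a))) \<cdot> t (cover (dm a))"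
    if "arrow a" for a
    using that by (intro nat) (auto intro!: homsI)
  have natural: "extend F F' t (cd a) \<cdot> F \<star> a = (F' \<star> a) \<cdot> extend F F' t (dm a)" if a [simp]: "arrow a" for a
  proof -
    have "extend F F' t (cd a) \<cdot> F \<star> a =
        (F' \<star> ret (cd a)) \<cdot> (t (cover (cd a)) \<cdot> F \<star> (emb (cd a) \<cdot> a \<cdot> ret (dm a))) \<cdot> F \<star> emb (dm a)"
      by (simp add: extend_def cmp_assoc fap_cmp[symmetric])
    also have "\<dots> = (F' \<star> (ret (cd a) \<cdot> emb (cd a) \<cdot> a \<cdot> ret (dm a))) \<cdot> t (cover (dm a)) \<cdot> F \<star> emb (dm a)"
      unfolding conj[OF a] by (subst fap_cmp[of F' _ "ret (cd a)"]) (simp_all add: cmp_assoc)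
    finally show ?thesis by (simp add: extend_def fap_cmp cmp_assoc)
  qed
  have iso: "invertible (extend F F' t X)" if X [simp]: "X \<in> Obj C" for X
  proof (rule isoI)
    have e: "t (cover X) \<cdot> F \<star> (emb X \<cdot> ret X) = (F' \<star> (emb X \<cdot> ret X)) \<cdot> t (cover X)"
      by (intro nat) (auto intro!: homsI)
    let ?b = "(F \<star> ret X) \<cdot> inv_arr (t (cover X)) \<cdot> F' \<star> emb X"
    show "arrow ?b" "dm ?b = cd (extend F F' t X)" "cd ?b = dm (extend F F' t X)" by simp_all
    have e': "inv_arr (t (cover X)) \<cdot> F' \<star> (emb X \<cdot> ret X) = (F \<star> (emb X \<cdot> ret X)) \<cdot> inv_arr (t (cover X))"
      by (rule inva_switch[OF e[symmetric]]) simp_all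
    have "?b \<cdot> extend F F' t X = (F \<star> ret X) \<cdot> (inv_arr (t (cover X)) \<cdot> F' \<star> (emb X \<cdot> ret X)) \<cdot> t (cover X) \<cdot> F \<star> emb X"
      by (simp add: extend_def cmp_assoc fap_cmp)
    also have "\<dots> = F \<star> (ret X \<cdot> (emb X \<cdot> ret X) \<cdot> emb X)"
      unfolding e' by (simp add: fap_cmp[symmetric] cmp_assoc)
    finally show "?b \<cdot> extend F F' t X = ide (dm (extend F F' t X))" by (simp add: cmp_assoc)
    have "extend F F' t X \<cdot> ?b = (F' \<star> ret X) \<cdot> (t (cover X) \<cdot> F \<star> (emb X \<cdot> ret X)) \<cdot> inv_arr (t (cover X)) \<cdot> F' \<star> emb X"
      by (simp add: extend_def cmp_assoc fap_cmp)
    also have "\<dots> = F' \<star> (ret X \<cdot> (emb X \<cdot> ret X) \<cdot> emb X)"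
      unfolding e by (simp add: fap_cmp[symmetric] cmp_assoc)
    finally show "extend F F' t X \<cdot> ?b = ide (cd (extend F F' t X))" by (simp add: cmp_assoc)
  qed simp
  show "nat_iso F F' (extend F F' t)"
    by (rule nat_isoI) (auto intro: iso natural)
qed


section \<open>Injectivity\<close>

lemma und_invertible:
  assumes "D.invertible a"
  shows "invertible (und a)"
proof (rule isoI)
  have "und (D.inv_arr a \<cdot>\<^sub>D a) = und (D.ide (dm a))" "und (a \<cdot>\<^sub>D D.inv_arr a) = und (D.ide (cd a))"
    using assms by simp_all
  then show "und (D.inv_arr a) \<cdot> und a = ide (dm (und a))" "und a \<cdot> und (D.inv_arr a) = ide (cd (und a))"
    by simp_all
qed (use assms in auto)

text \<open>
  The dual action is strict and leaves underlying morphisms unchanged, so equivariance of \<open>\<theta>\<close> means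
  that its components at \<open>F\<^sub>\<chi> P\<close> and \<open>P\<close> agree. This makes \<open>\<theta>\<close> natural for homogeneous morphisms of
  every degree, hence natural on \<open>C\<close>.
\<close>

lemma elift_reflects_isomorphic:
  assumes p [simp]: "endo p" and q [simp]: "endo q" and pq: "elift p \<approx>\<^sub>D elift q"
  shows "p \<approx> q"
proof -
  obtain \<theta> where \<theta>: "D.intertwines (elift p) (elift q) \<theta>"
    using pq by (auto simp: D.isomorphic_def)
  have n: "D.nat_iso (lift p) (lift q) \<theta>" using D.intertwinesD(1)[OF \<theta>] by simp
  note [simp] = D.nat_isoD(1-4)[OF n] lift_functor lift_closed S_closed S_functor
  have und_\<theta> [simp]: "invertible (und (\<theta> P))" if "P \<in> Obj D" for P
    using that by (intro und_invertible) simp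
  have \<theta>_S: "und (\<theta> (fob (S \<chi>) P)) = und (\<theta> P)" if [simp]: "\<chi> \<in> carrier DG" "P \<in> Obj D" for \<chi> P
  proof -
    have "und ((S \<chi> \<star> \<theta> P) \<cdot>\<^sub>D D.dlt (elift p) \<chi> P) = und (D.dlt (elift q) \<chi> P \<cdot>\<^sub>D \<theta> (fob (S \<chi>) P))"
      using D.intertwinesD(2)[OF \<theta>, of \<chi> P] by simp
    then show ?thesis by (simp add: dlt_elift lift_S)
  qed
  have nat: "und (\<theta> Q) \<cdot> fst p \<star> a = (fst q \<star> a) \<cdot> und (\<theta> P)"
    if PQ [simp]: "P \<in> Obj D" "Q \<in> Obj D" and a: "a \<in> homs (fst P) (fst Q)" for P Q a
  proof (rule homogeneous_ext[OF PQ _ _ _ a])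
    show "linear_op (fst P) (fst Q) (fob (fst p) (fst P)) (fob (fst q) (fst Q)) (\<lambda>a. und (\<theta> Q) \<cdot> fst p \<star> a)"
      by (rule linear_op_comp[OF linear_op_fap[OF endoD(2)[OF p]] linear_op_left]) (auto intro!: homsI)
    show "linear_op (fst P) (fst Q) (fob (fst p) (fst P)) (fob (fst q) (fst Q)) (\<lambda>a. (fst q \<star> a) \<cdot> und (\<theta> P))"
      by (rule linear_op_comp[OF linear_op_fap[OF endoD(2)[OF q]] linear_op_right]) (auto intro!: homsI)
    fix \<chi> b assume b: "\<chi> \<in> carrier DG" "arr D b" "dm b = P" "cd b = fob (S \<chi>) Q"
    have "und (\<theta> (cd b) \<cdot>\<^sub>D lift p \<star> b) = und ((lift q \<star> b) \<cdot>\<^sub>D \<theta> (dm b))"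
      using D.nat_isoD(5)[OF n b(2)] by simp
    then show "und (\<theta> Q) \<cdot> fst p \<star> und b = (fst q \<star> und b) \<cdot> und (\<theta> P)"
      using b by (simp add: \<theta>_S)
  qed
  define u where "u = extend (fst p) (fst q) (\<lambda>P. und (\<theta> P))"
  have u: "nat_iso (fst p) (fst q) u" and u_fst: "\<And>P. P \<in> Obj D \<Longrightarrow> u (fst P) = und (\<theta> P)"
    unfolding u_def by (intro extend nat; simp)+
  note [simp] = nat_isoD(1-4)[OF u]
  have "(T g \<star> u X) \<cdot> dlt p g X = dlt q g X \<cdot> u (fob (T g) X)"
    if g [simp]: "g \<in> carrier G" and X: "X \<in> Obj C" for g X
  proof (rule natural_ext[OF _ _ _ _ _ X])
    show "natural (fst p \<circ>\<^sub>F T g) (T g \<circ>\<^sub>F fst q) (\<lambda>X. (T g \<star> u X) \<cdot> dlt p g X)"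
      using nat_iso_vcomp[OF _ _ _ endoD(3)[OF p g] nat_iso_whisker_left[OF _ _ _ u]] by (simp add: nat_iso_def)
    show "natural (fst p \<circ>\<^sub>F T g) (T g \<circ>\<^sub>F fst q) (\<lambda>X. dlt q g X \<cdot> u (fob (T g) X))"
      using nat_iso_vcomp[OF _ _ _ nat_iso_whisker_right[OF _ u] endoD(3)[OF q g]] by (simp add: nat_iso_def)
    fix P assume P [simp]: "P \<in> Obj D"
    have "((T g \<star> u (fst P)) \<cdot> dlt p g (fst P)) \<cdot> fst p \<star> \<sigma> P g = (T g \<star> und (\<theta> P)) \<cdot> \<sigma> (fob (lift p) P) g"
      by (simp add: u_fst cmp_assoc)
    also have "\<dots> = \<sigma> (fob (lift q) P) g \<cdot> und (\<theta> P)"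
      using und_str[of "\<theta> P" g] by simp
    also have "\<dots> = dlt q g (fst P) \<cdot> (fst q \<star> \<sigma> P g) \<cdot> u (fst P)"
      by (simp add: u_fst cmp_assoc)
    also have "(fst q \<star> \<sigma> P g) \<cdot> u (fst P) = u (fob (T g) (fst P)) \<cdot> fst p \<star> \<sigma> P g"
      using nat_isoD(5)[OF u, of "\<sigma> P g"] by simp
    finally have "((T g \<star> u (fst P)) \<cdot> dlt p g (fst P)) \<cdot> fst p \<star> \<sigma> P g =
        (dlt q g (fst P) \<cdot> u (fob (T g) (fst P))) \<cdot> fst p \<star> \<sigma> P g"
      by (simp add: cmp_assoc)
    then show "(T g \<star> u (fst P)) \<cdot> dlt p g (fst P) = dlt q g (fst P) \<cdot> u (fob (T g) (fst P))"
      by (rule iso_cancel_right) simp_all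
  qed simp_all
  then show ?thesis using u by (intro isomorphicI[of _ _ u] intertwinesI) simp_all
qed

end


section \<open>Extending an equivariant endofunctor to all arrows between underlying objects\<close>

locale dual_endofunctor = equivariantization_setting K C G A
  for K :: "('k, 'e) ring_scheme" (structure) and C :: "('k, 'o, 'm) lin_cat"
    and G :: "('g, 'f) monoid_scheme" and A :: "('g, 'o, 'm) cat_action" +
  fixes q :: "('g \<Rightarrow> 'k, 'o \<times> ('g \<Rightarrow> 'm), 'm) eq_fctr"
  assumes endo_q [simp]: "D.endo q"
begin

abbreviation "H \<equiv> fst q"
abbreviation "\<delta> \<equiv> D.dlt q"

lemma d_natural: "\<chi> \<in> carrier DG \<Longrightarrow> arr D a \<Longrightarrow>
    und (\<delta> \<chi> (cd a)) \<cdot> und (H \<star> S \<chi> \<star> a) = und (H \<star> a) \<cdot> und (\<delta> \<chi> (dm a))"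
  using arg_cong[OF D.dlt_natural[OF endo_q, of \<chi> a], of und] by simp

lemma d_mult: "\<chi> \<in> carrier DG \<Longrightarrow> \<psi> \<in> carrier DG \<Longrightarrow> P \<in> Obj D \<Longrightarrow>
    und (\<delta> (\<chi> \<otimes>\<^bsub>DG\<^esub> \<psi>) P) = und (\<delta> \<psi> P) \<cdot> und (\<delta> \<chi> (fob (S \<psi>) P))"
  using arg_cong[OF D.endoD(4)[OF endo_q, of \<chi> \<psi> P], of und]
  by (simp add: eps_D S_closed S_comp S_functor dual_mult_closed)

text \<open>By the cocycle condition at \<open>(1, 1)\<close> this arrow is idempotent, and it is invertible.\<close>

lemma d_one: "P \<in> Obj D \<Longrightarrow> und (\<delta> \<one>\<^bsub>DG\<^esub> P) = ide (fst (fob H P))"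
proof -
  assume P [simp]: "P \<in> Obj D"
  have [simp]: "\<one>\<^bsub>DG\<^esub> \<in> carrier DG" by (rule D.G.one_closed)
  have i: "invertible (und (\<delta> \<one>\<^bsub>DG\<^esub> P))" by (intro und_invertible) simp
  have "und (\<delta> \<one>\<^bsub>DG\<^esub> P) \<cdot> und (\<delta> \<one>\<^bsub>DG\<^esub> P) = und (\<delta> \<one>\<^bsub>DG\<^esub> P) \<cdot> ide (fst (fob H P))"
    using d_mult[of "\<one>\<^bsub>DG\<^esub>" "\<one>\<^bsub>DG\<^esub>" P] by (simp add: S_one)
  then show ?thesis by (rule iso_cancel_left[OF _ i]) (simp_all add: S_one)
qed

text \<open>
  The extension \<open>hat\<close> of \<open>H\<close> to morphisms \<open>U P \<rightarrow> U Q\<close> of \<open>C\<close>: a morphism \<open>b : P \<rightarrow> F\<^sub>\<chi> Q\<close> of \<open>D\<close> is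
  sent to \<open>\<delta>\<^sub>\<chi> \<circ> H b : H P \<rightarrow> F\<^sub>\<chi> H Q\<close>, which is again homogeneous of degree \<open>\<chi>\<close>.
\<close>

definition summand where
  "summand P Q \<chi> a = und (\<delta> \<chi> Q) \<cdot> und (H \<star> hom_arrow P (fob (S \<chi>) Q) (proj P Q \<chi> a))"

definition hat where
  "hat P Q a = sum_arr (fst (fob H P)) (fst (fob H Q)) (\<lambda>\<chi>. summand P Q \<chi> a) (carrier DG)"

lemma hom_arrow_proj:
  assumes "P \<in> Obj D" "Q \<in> Obj D" "\<chi> \<in> carrier DG" "a \<in> homs (fst P) (fst Q)"
  shows "arr D (hom_arrow P (fob (S \<chi>) Q) (proj P Q \<chi> a))"
  using assms linear_opD(1)[OF linear_op_proj] by (intro homogeneous_arrow proj_homogeneous) auto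

lemma linear_op_summand:
  assumes P [simp]: "P \<in> Obj D" and Q [simp]: "Q \<in> Obj D" and \<chi> [simp]: "\<chi> \<in> carrier DG"
  shows "linear_op (fst P) (fst Q) (fst (fob H P)) (fst (fob H Q)) (summand P Q \<chi>)"
proof (rule linear_opI)
  note L = linear_opD[OF linear_op_proj[OF P Q \<chi>]]
  note [simp] = S_closed
  fix a b c assume a: "a \<in> homs (fst P) (fst Q)"
  note arr = hom_arrow_proj[OF P Q \<chi>]
  have in_homs: "proj P Q \<chi> x \<in> homs (fst P) (fst (fob (S \<chi>) Q))" if "x \<in> homs (fst P) (fst Q)" for x
    using L(1)[OF that] by simp
  show "summand P Q \<chi> a \<in> homs (fst (fob H P)) (fst (fob H Q))"
    unfolding summand_def using arr[OF a] by (intro homsI) simp_all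
  {
    assume b: "b \<in> homs (fst P) (fst Q)"
    show "summand P Q \<chi> (a \<boxplus> b) = summand P Q \<chi> a \<boxplus> summand P Q \<chi> b"
      using arr[OF a] arr[OF b]
      by (simp add: summand_def L(2)[OF a b] hom_arrow_add[OF in_homs[OF a]] D.fap_add[OF D.endoD(2)[OF endo_q]] und_add)
  next
    assume c: "c \<in> carrier K"
    show "summand P Q \<chi> (scale c a) = scale c (summand P Q \<chi> a)"
      using arr[OF a] c
      by (simp add: summand_def L(3)[OF c a] hom_arrow_scale[OF in_homs[OF a]] D.fap_scale[OF D.endoD(2)[OF endo_q]] und_scale)
  }
qed simp_all

lemma linear_op_hat:
  assumes "P \<in> Obj D" "Q \<in> Obj D"
  shows "linear_op (fst P) (fst Q) (fst (fob H P)) (fst (fob H Q)) (hat P Q)"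
  unfolding hat_def[abs_def]
  using assms finite_DG by (intro linear_op_sum_fun linear_op_summand) auto

lemma hat_homs: "P \<in> Obj D \<Longrightarrow> Q \<in> Obj D \<Longrightarrow> a \<in> homs (fst P) (fst Q) \<Longrightarrow> hat P Q a \<in> homs (fst (fob H P)) (fst (fob H Q))"
  by (rule linear_opD(1)[OF linear_op_hat])

lemma hat_homogeneous:
  assumes b: "arr D b" "dm b = P" "cd b = fob (S \<psi>) Q" and Q [simp]: "Q \<in> Obj D" and \<psi> [simp]: "\<psi> \<in> carrier DG"
  shows "hat P Q (und b) = und (\<delta> \<psi> Q) \<cdot> und (H \<star> b)"
proof -
  have P [simp]: "P \<in> Obj D" using b by auto
  note [simp] = S_closed b
  have u: "und b \<in> homs (fst P) (fst Q)" by (intro homsI) simp_all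
  let ?X = "fst (fob H P)" and ?Y = "fst (fob H Q)"
  let ?f = "\<lambda>\<chi>. if \<psi> = \<chi> then und (\<delta> \<psi> Q) \<cdot> und (H \<star> b) else zero_arr ?X ?Y"
  have f: "und (\<delta> \<psi> Q) \<cdot> und (H \<star> b) \<in> homs ?X ?Y" by (intro homsI) simp_all
  have "hat P Q (und b) = sum_arr ?X ?Y ?f (carrier DG)"
    unfolding hat_def
  proof (rule sum_arr_cong)
    fix \<chi> assume \<chi> [simp]: "\<chi> \<in> carrier DG"
    show "summand P Q \<chi> (und b) \<in> homs ?X ?Y" by (rule linear_opD(1)[OF linear_op_summand]) (use u in auto)
    show "summand P Q \<chi> (und b) = ?f \<chi>"
    proof (cases "\<chi> = \<psi>")
      case True
      then show ?thesis
        using proj_of_homogeneous[OF b Q \<psi> \<psi>] by (simp add: summand_def hom_arrow_und)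
    next
      case False
      then have "proj P Q \<chi> (und b) = zero_arr (fst P) (fst (fob (S \<chi>) Q))"
        using proj_of_homogeneous[OF b Q \<psi> \<chi>] scale_zero_eq[OF u] by simp
      moreover have "und (\<delta> \<chi> Q) \<in> homs (fst (fob H (fob (S \<chi>) Q))) ?Y" by (intro homsI) simp_all
      ultimately show ?thesis using False hom_arrow_zero[of P "fob (S \<chi>) Q"]
        by (simp add: summand_def D.fap_zero[OF D.endoD(2)[OF endo_q]] und_zero cmp_zero_right)
    qed
  qed simp_all
  also have "\<dots> = und (\<delta> \<psi> Q) \<cdot> und (H \<star> b)"
    using f finite_DG by (intro sum_arr_single) auto
  finally show ?thesis .
qed

text \<open>
  For homogeneous morphisms of degrees \<open>\<psi>\<close> and \<open>\<chi>\<close> this is the naturality of \<open>\<delta>\<^sub>\<psi>\<close> together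
  with the cocycle condition for \<open>\<delta>\<close>.
\<close>

lemma hat_cmp:
  assumes P [simp]: "P \<in> Obj D" and Q [simp]: "Q \<in> Obj D" and R [simp]: "R \<in> Obj D"
    and a: "a \<in> homs (fst P) (fst Q)" and b: "b \<in> homs (fst Q) (fst R)"
  shows "hat P R (b \<cdot> a) = hat Q R b \<cdot> hat P Q a"
proof (rule homogeneous_ext[OF Q R _ _ _ b])
  show "linear_op (fst Q) (fst R) (fst (fob H P)) (fst (fob H R)) (\<lambda>b. hat P R (b \<cdot> a))"
    by (rule linear_op_comp[OF linear_op_right[OF a] linear_op_hat]) simp_all
  show "linear_op (fst Q) (fst R) (fst (fob H P)) (fst (fob H R)) (\<lambda>b. hat Q R b \<cdot> hat P Q a)"
    by (rule linear_op_comp[OF linear_op_hat linear_op_right[OF hat_homs[OF P Q a]]]) simp_all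
  fix \<chi> n assume \<chi> [simp]: "\<chi> \<in> carrier DG" and n: "arr D n" "dm n = Q" "cd n = fob (S \<chi>) R"
  note [simp] = S_closed S_functor n dual_mult_closed
  have un: "und n \<in> homs (fst Q) (fst R)" by (intro homsI) simp_all
  show "hat P R (und n \<cdot> a) = hat Q R (und n) \<cdot> hat P Q a"
  proof (rule homogeneous_ext[OF P Q _ _ _ a])
    show "linear_op (fst P) (fst Q) (fst (fob H P)) (fst (fob H R)) (\<lambda>a. hat P R (und n \<cdot> a))"
      by (rule linear_op_comp[OF linear_op_left[OF un] linear_op_hat]) simp_all
    show "linear_op (fst P) (fst Q) (fst (fob H P)) (fst (fob H R)) (\<lambda>a. hat Q R (und n) \<cdot> hat P Q a)"
      by (rule linear_op_comp[OF linear_op_hat linear_op_left[OF hat_homs[OF Q R un]]]) simp_all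
    fix \<psi> m assume \<psi> [simp]: "\<psi> \<in> carrier DG" and m: "arr D m" "dm m = P" "cd m = fob (S \<psi>) Q"
    note [simp] = m
    have "und n \<cdot> und m = und ((S \<psi> \<star> n) \<cdot>\<^sub>D m)" by simp
    also have "hat P R \<dots> = und (\<delta> (\<psi> \<otimes>\<^bsub>DG\<^esub> \<chi>) R) \<cdot> und (H \<star> ((S \<psi> \<star> n) \<cdot>\<^sub>D m))"
      by (rule hat_homogeneous) (simp_all add: S_comp)
    also have "\<dots> = und (\<delta> \<chi> R) \<cdot> (und (\<delta> \<psi> (cd n)) \<cdot> und (H \<star> S \<psi> \<star> n)) \<cdot> und (H \<star> m)"
      by (simp add: d_mult D.fap_cmp cmp_assoc S_comp)
    also have "\<dots> = (und (\<delta> \<chi> R) \<cdot> und (H \<star> n)) \<cdot> (und (\<delta> \<psi> Q) \<cdot> und (H \<star> m))"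
      by (subst d_natural) (simp_all add: cmp_assoc)
    also have "\<dots> = hat Q R (und n) \<cdot> hat P Q (und m)"
      by (simp add: hat_homogeneous[OF n] hat_homogeneous[OF m])
    finally show "hat P R (und n \<cdot> und m) = hat Q R (und n) \<cdot> hat P Q (und m)" .
  qed
qed

lemma hat_und:
  assumes "arr D b"
  shows "hat (dm b) (cd b) (und b) = und (H \<star> b)"
proof -
  have "hat (dm b) (cd b) (und b) = und (\<delta> \<one>\<^bsub>DG\<^esub> (cd b)) \<cdot> und (H \<star> b)"
    using assms by (intro hat_homogeneous) (simp_all add: S_one)
  then show ?thesis using assms by (simp add: d_one)
qed

lemma hat_ide:
  assumes "P \<in> Obj D"
  shows "hat P P (ide (fst P)) = ide (fst (fob H P))"
  using hat_und[of "D.ide P"] assms by simp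

text \<open>The extension preserves degrees, so it commutes with the action of \<open>G\<close>.\<close>

lemma hat_conj:
  assumes P [simp]: "P \<in> Obj D" and Q [simp]: "Q \<in> Obj D" and g [simp]: "g \<in> carrier G" and a: "a \<in> homs (fst P) (fst Q)"
  shows "conj_act (fob H P) (fob H Q) g (hat P Q a) = hat P Q (conj_act P Q g a)"
proof (rule homogeneous_ext[OF P Q _ _ _ a])
  show "linear_op (fst P) (fst Q) (fst (fob H P)) (fst (fob H Q)) (\<lambda>a. conj_act (fob H P) (fob H Q) g (hat P Q a))"
    by (rule linear_op_comp[OF linear_op_hat linear_op_conj]) simp_all
  show "linear_op (fst P) (fst Q) (fst (fob H P)) (fst (fob H Q)) (\<lambda>a. hat P Q (conj_act P Q g a))"
    by (rule linear_op_comp[OF linear_op_conj linear_op_hat]) simp_all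
  fix \<chi> b assume \<chi> [simp]: "\<chi> \<in> carrier DG" and b: "arr D b" "dm b = P" "cd b = fob (S \<chi>) Q"
  note [simp] = S_closed S_functor b
  have "hat P Q (und b) = und (\<delta> \<chi> Q \<cdot>\<^sub>D H \<star> b)"
    by (simp add: hat_homogeneous[OF b])
  then have "conj_act (fob H P) (fob H Q) g (hat P Q (und b)) = scale (\<chi> (inv\<^bsub>G\<^esub> g)) (hat P Q (und b))"
    using conj_homogeneous[of "\<delta> \<chi> Q \<cdot>\<^sub>D H \<star> b" "fob H P" \<chi> "fob H Q" g] by simp
  also have "\<dots> = hat P Q (scale (\<chi> (inv\<^bsub>G\<^esub> g)) (und b))"
    by (intro linear_opD(3)[OF linear_op_hat, symmetric]) (auto simp: dual_char intro: homsI)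
  also have "scale (\<chi> (inv\<^bsub>G\<^esub> g)) (und b) = conj_act P Q g (und b)"
    by (intro conj_homogeneous[symmetric]) simp_all
  finally show "conj_act (fob H P) (fob H Q) g (hat P Q (und b)) = hat P Q (conj_act P Q g (und b))" .
qed

text \<open>
  The identity of \<open>U P\<close> is homogeneous of degree \<open>\<chi>\<close> as a morphism from \<open>F\<^sub>\<chi> P\<close> to \<open>P\<close>, and the
  extension maps it to \<open>\<delta>\<^sub>\<chi>\<close>.
\<close>

lemma hat_S:
  assumes P [simp]: "P \<in> Obj D" and Q [simp]: "Q \<in> Obj D" and \<chi> [simp]: "\<chi> \<in> carrier DG" and a: "a \<in> homs (fst Q) (fst P)"
  shows "und (\<delta> \<chi> P) \<cdot> hat Q (fob (S \<chi>) P) a = hat Q P a"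
proof -
  note [simp] = S_closed S_functor
  have "hat (fob (S \<chi>) P) P (und (D.ide (fob (S \<chi>) P))) = und (\<delta> \<chi> P) \<cdot> und (H \<star> D.ide (fob (S \<chi>) P))"
    by (rule hat_homogeneous) simp_all
  then have "und (\<delta> \<chi> P) = hat (fob (S \<chi>) P) P (ide (fst P))" by simp
  moreover have "hat Q P (ide (fst P) \<cdot> a) = hat (fob (S \<chi>) P) P (ide (fst P)) \<cdot> hat Q (fob (S \<chi>) P) a"
    by (rule hat_cmp) (use a in \<open>auto intro: homsI\<close>)
  ultimately show ?thesis using a by simp
qed


section \<open>Descending an endofunctor of the equivariantization\<close>

text \<open>
  The object \<open>img X\<close> is the image of the idempotent of \<open>U H (cover X)\<close> that corresponds to the
  retract \<open>X\<close> of \<open>U (cover X)\<close>.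
\<close>

definition image_data where
  "image_data X = (SOME t. fst t \<in> Obj C \<and> fst (snd t) \<in> homs (fst t) (fst (fob H (cover X))) \<and>
     snd (snd t) \<in> homs (fst (fob H (cover X))) (fst t) \<and> snd (snd t) \<cdot> fst (snd t) = ide (fst t) \<and>
     fst (snd t) \<cdot> snd (snd t) = hat (cover X) (cover X) (emb X \<cdot> ret X))"

definition img where "img X = fst (image_data X)"
definition incl where "incl X = fst (snd (image_data X))"
definition quot where "quot X = snd (snd (image_data X))"

lemma image_simps [simp]:
  assumes X [simp]: "X \<in> Obj C"
  shows "img X \<in> Obj C" "arrow (incl X)" "dm (incl X) = img X" "cd (incl X) = fst (fob H (cover X))"
    "arrow (quot X)" "dm (quot X) = fst (fob H (cover X))" "cd (quot X) = img X" "quot X \<cdot> incl X = ide (img X)"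
    "incl X \<cdot> quot X = hat (cover X) (cover X) (emb X \<cdot> ret X)"
proof -
  let ?P = "cover X" and ?V = "fst (fob H (cover X))"
  define e where "e = hat ?P ?P (emb X \<cdot> ret X)"
  have er: "emb X \<cdot> ret X \<in> homs (fst ?P) (fst ?P)" by (intro homsI) simp_all
  have e: "e \<in> homs ?V ?V" unfolding e_def by (rule hat_homs) (simp_all add: er)
  have "e \<cdot> e = hat ?P ?P ((emb X \<cdot> ret X) \<cdot> emb X \<cdot> ret X)"
    unfolding e_def by (rule hat_cmp[symmetric]) (simp_all add: er)
  then have "e \<cdot> e = e" by (simp add: cmp_assoc e_def)
  from arg_cong[OF this, of mp] have "Comp C ?V ?V ?V (mp e) (mp e) = mp e"
    using homsD[OF e] by (simp add: cmp_def)
  moreover have "mp e \<in> Mor C ?V ?V" "?V \<in> Obj C" using homs_mp[OF e] homs_obj[OF e] by auto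
  ultimately obtain Y p i where Y: "Y \<in> Obj C" and p: "p \<in> Mor C ?V Y" and i: "i \<in> Mor C Y ?V"
    and ip: "Comp C ?V Y ?V i p = mp e" "Comp C Y ?V Y p i = Id C Y"
    using idempotents_split unfolding idempotent_complete_def by metis
  have "Arrow Y ?V i \<in> homs Y ?V" "Arrow ?V Y p \<in> homs ?V Y"
    using i p Y \<open>?V \<in> Obj C\<close> by (auto intro: Arrow_homs)
  moreover have "Arrow ?V Y p \<cdot> Arrow Y ?V i = ide Y" using ip by (simp add: cmp_def ida_def)
  moreover have "Arrow Y ?V i \<cdot> Arrow ?V Y p = e"
    by (rule arrow.expand) (use ip homsD[OF e] in \<open>simp add: cmp_def\<close>)
  ultimately have "\<exists>t. fst t \<in> Obj C \<and> fst (snd t) \<in> homs (fst t) (fst (fob H (cover X))) \<and>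
     snd (snd t) \<in> homs (fst (fob H (cover X))) (fst t) \<and> snd (snd t) \<cdot> fst (snd t) = ide (fst t) \<and>
     fst (snd t) \<cdot> snd (snd t) = hat (cover X) (cover X) (emb X \<cdot> ret X)"
    using Y unfolding e_def by (intro exI[of _ "(Y, Arrow Y ?V i, Arrow ?V Y p)"]) simp
  from someI_ex[OF this]
  have c: "img X \<in> Obj C" "incl X \<in> homs (img X) ?V" "quot X \<in> homs ?V (img X)"
    "quot X \<cdot> incl X = ide (img X)" "incl X \<cdot> quot X = e"
    unfolding image_data_def[symmetric] img_def incl_def quot_def e_def by auto
  then show "img X \<in> Obj C" "arrow (incl X)" "dm (incl X) = img X" "cd (incl X) = ?V"
    "arrow (quot X)" "dm (quot X) = ?V" "cd (quot X) = img X" "quot X \<cdot> incl X = ide (img X)"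
    "incl X \<cdot> quot X = hat (cover X) (cover X) (emb X \<cdot> ret X)"
    by (simp_all add: homsD[OF c(2)] homsD[OF c(3)] e_def)
qed

text \<open>
  For \<open>a : X \<rightarrow> U P\<close> this is the composite of the value of the functor \<open>descent\<close> at \<open>a\<close> and of the
  isomorphism from \<open>descent (U P)\<close> to \<open>U H P\<close>, which itself is the case \<open>a = 1\<close>.
\<close>

definition comparison where
  "comparison P a = hat (cover (dm a)) P (a \<cdot> ret (dm a)) \<cdot> incl (dm a)"

definition descent :: "('o, 'm, 'o, 'm) fctr" where
  "descent = \<lparr>fob = img, fmor = (\<lambda>X Y m. mp (quot Y \<cdot> hat (cover X) (cover Y) (emb Y \<cdot> Arrow X Y m \<cdot> ret X) \<cdot> incl X))\<rparr>"

lemma fob_descent [simp]: "fob descent X = img X"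
  by (simp add: descent_def)

lemma fap_descent:
  "arrow a \<Longrightarrow> descent \<star> a = quot (cd a) \<cdot> hat (cover (dm a)) (cover (cd a)) (emb (cd a) \<cdot> a \<cdot> ret (dm a)) \<cdot> incl (dm a)"
  by (rule arrow.expand) (simp add: fap_def descent_def)

lemma hat_simps:
  assumes "P \<in> Obj D" "Q \<in> Obj D" "arrow a" "dm a = fst P" "cd a = fst Q"
  shows "arrow (hat P Q a)" "dm (hat P Q a) = fst (fob H P)" "cd (hat P Q a) = fst (fob H Q)"
  using homsD[OF hat_homs[OF assms(1,2) homsI[OF assms(3-5)]]] by auto

lemma hat_cmp':
  assumes "P \<in> Obj D" "Q \<in> Obj D" "R \<in> Obj D" "arrow a" "dm a = fst P" "cd a = fst Q"
    "arrow b" "dm b = fst Q" "cd b = fst R"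
  shows "hat Q R b \<cdot> hat P Q a = hat P R (b \<cdot> a)"
  using assms by (intro hat_cmp[symmetric]) (auto intro: homsI)

lemma hat_cmp_assoc:
  assumes "P \<in> Obj D" "Q \<in> Obj D" "R \<in> Obj D" "arrow a" "dm a = fst P" "cd a = fst Q"
    "arrow b" "dm b = fst Q" "cd b = fst R" "arrow x" "cd x = fst (fob H P)"
  shows "hat Q R b \<cdot> hat P Q a \<cdot> x = hat P R (b \<cdot> a) \<cdot> x"
  using assms by (simp add: hat_cmp'[symmetric] cmp_assoc hat_simps)

lemma incl_quot_cancel:
  "X \<in> Obj C \<Longrightarrow> arrow x \<Longrightarrow> cd x = fst (fob H (cover X)) \<Longrightarrow>
    incl X \<cdot> quot X \<cdot> x = hat (cover X) (cover X) (emb X \<cdot> ret X) \<cdot> x"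
  by (simp add: cmp_assoc[symmetric] del: image_simps(9)) simp

lemma comparison_simps:
  assumes "P \<in> Obj D" "arrow a" "cd a = fst P"
  shows "arrow (comparison P a)" "dm (comparison P a) = img (dm a)" "cd (comparison P a) = fst (fob H P)"
  using assms by (simp_all add: comparison_def hat_simps)

lemma descent_arr: "arrow a \<Longrightarrow> arrow (descent \<star> a)"
  by (simp add: fap_descent hat_simps)

lemma comparison_left:
  assumes "P \<in> Obj D" "Q \<in> Obj D" "arrow a" "cd a = fst P" "arrow b" "dm b = fst P" "cd b = fst Q"
  shows "hat P Q b \<cdot> comparison P a = comparison Q (b \<cdot> a)"
  using assms by (simp add: comparison_def hat_cmp_assoc cmp_assoc)

lemma comparison_right:
  assumes "P \<in> Obj D" "arrow a" "cd a = fst P" "arrow c" "cd c = dm a"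
  shows "comparison P a \<cdot> descent \<star> c = comparison P (a \<cdot> c)"
  using assms by (simp add: comparison_def fap_descent hat_cmp_assoc hat_simps cmp_assoc incl_quot_cancel)

lemma descent_functor: "functor descent"
proof (rule functorI)
  fix a b assume ab [simp]: "arrow a" "arrow b" "cd a = dm b"
  show "descent \<star> (b \<cdot> a) = (descent \<star> b) \<cdot> (descent \<star> a)"
    by (simp add: fap_descent hat_cmp_assoc hat_simps cmp_assoc incl_quot_cancel)
next
  fix X assume [simp]: "X \<in> Obj C"
  show "descent \<star> ide X = ide (fob descent X)"
    by (simp add: fap_descent image_simps(9)[symmetric] cmp_assoc del: image_simps(9))
qed (simp_all add: descent_arr)

lemma descent_linear: "linear_functor K C C descent"
proof -
  have lin: "linear_op X Y (img X) (img Y)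
      (\<lambda>a. quot Y \<cdot> hat (cover X) (cover Y) (emb Y \<cdot> a \<cdot> ret X) \<cdot> incl X)"
    if [simp]: "X \<in> Obj C" "Y \<in> Obj C" for X Y
  proof -
    have 1: "linear_op X Y (fst (cover X)) Y (\<lambda>a. a \<cdot> ret X)"
      by (rule linear_op_right) (auto intro: homsI)
    have 2: "linear_op (fst (cover X)) Y (fst (cover X)) (fst (cover Y)) (\<lambda>a. emb Y \<cdot> a)"
      by (rule linear_op_left) (auto intro: homsI)
    have 3: "linear_op (fst (cover X)) (fst (cover Y)) (fst (fob H (cover X))) (fst (fob H (cover Y))) (hat (cover X) (cover Y))"
      by (rule linear_op_hat) simp_all
    have 4: "linear_op (fst (fob H (cover X))) (fst (fob H (cover Y))) (img X) (fst (fob H (cover Y))) (\<lambda>a. a \<cdot> incl X)"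
      by (rule linear_op_right) (auto intro: homsI)
    have 5: "linear_op (img X) (fst (fob H (cover Y))) (img X) (img Y) (\<lambda>a. quot Y \<cdot> a)"
      by (rule linear_op_left) (auto intro: homsI)
    show ?thesis
      by (rule linear_op_comp[OF linear_op_comp[OF linear_op_comp[OF linear_op_comp[OF 1 2] 3] 4] 5])
  qed
  show ?thesis
  proof (rule linear_functorI[OF descent_functor])
    fix X Y assume XY: "X \<in> Obj C" "Y \<in> Obj C"
    have eq: "descent \<star> a = quot Y \<cdot> hat (cover X) (cover Y) (emb Y \<cdot> a \<cdot> ret X) \<cdot> incl X" if "a \<in> homs X Y" for a
      using that by (simp add: fap_descent)
    show "linear_op X Y (fob descent X) (fob descent Y) (\<lambda>a. descent \<star> a)"
      using lin[OF XY] unfolding linear_op_def by (simp add: eq add_homs scale_homs)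
  qed
qed

definition theta ("\<theta>") where "\<theta> P = comparison P (ide (fst P))"

lemma theta_simps [simp]:
  assumes P [simp]: "P \<in> Obj D"
  shows "invertible (\<theta> P)" "dm (\<theta> P) = img (fst P)" "cd (\<theta> P) = fst (fob H P)"
proof -
  show sel [simp]: "dm (\<theta> P) = img (fst P)" "cd (\<theta> P) = fst (fob H P)"
    by (simp_all add: theta_def comparison_simps)
  let ?X = "fst P"
  have \<theta>: "\<theta> P = hat (cover ?X) P (ret ?X) \<cdot> incl ?X" by (simp add: theta_def comparison_def)
  show "invertible (\<theta> P)"
  proof (rule isoI)
    let ?w = "quot ?X \<cdot> hat P (cover ?X) (emb ?X)"
    show "arrow (\<theta> P)" "arrow ?w" "dm ?w = cd (\<theta> P)" "cd ?w = dm (\<theta> P)"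
      by (simp_all add: \<theta> hat_simps)
    have "?w \<cdot> \<theta> P = quot ?X \<cdot> (incl ?X \<cdot> quot ?X) \<cdot> incl ?X"
      by (simp add: \<theta> hat_simps hat_cmp_assoc cmp_assoc)
    also have "\<dots> = ide (dm (\<theta> P))" by (simp add: cmp_assoc del: image_simps(9))
    finally show "?w \<cdot> \<theta> P = ide (dm (\<theta> P))" .
    show "\<theta> P \<cdot> ?w = ide (cd (\<theta> P))"
      by (simp add: \<theta> hat_simps hat_cmp' hat_cmp_assoc cmp_assoc incl_quot_cancel hat_ide)
  qed
qed

lemma theta_natural:
  assumes "P \<in> Obj D" "Q \<in> Obj D" "a \<in> homs (fst P) (fst Q)"
  shows "\<theta> Q \<cdot> descent \<star> a = hat P Q a \<cdot> \<theta> P"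
  using assms by (simp add: theta_def comparison_left comparison_right)

lemma theta_S:
  assumes [simp]: "P \<in> Obj D" "\<chi> \<in> carrier DG"
  shows "und (\<delta> \<chi> P) \<cdot> \<theta> (fob (S \<chi>) P) = \<theta> P"
proof -
  have "und (\<delta> \<chi> P) \<cdot> hat (cover (fst P)) (fob (S \<chi>) P) (ret (fst P)) = hat (cover (fst P)) P (ret (fst P))"
    by (rule hat_S) (auto intro: homsI)
  then show ?thesis
    by (simp add: theta_def comparison_def S_closed S_functor cmp_assoc[symmetric] hat_simps)
qed

text \<open>
  At underlying objects, the structure of \<open>descent\<close> is the only one for which \<open>\<theta>\<close> is equivariant.
\<close>

definition descent_str0 where
  "descent_str0 g P = inv_arr (T g \<star> \<theta> P) \<cdot> \<sigma> (fob H P) g \<cdot> \<theta> P \<cdot> descent \<star> inv_arr (\<sigma> P g)"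

lemma descent_str0_simps [simp]:
  assumes "g \<in> carrier G" "P \<in> Obj D"
  shows "invertible (descent_str0 g P)" "dm (descent_str0 g P) = img (fob (T g) (fst P))"
    "cd (descent_str0 g P) = fob (T g) (img (fst P))"
  using assms by (simp_all add: descent_str0_def descent_functor)

lemma descent_str0_str:
  assumes "g \<in> carrier G" "P \<in> Obj D"
  shows "descent_str0 g P \<cdot> descent \<star> \<sigma> P g = inv_arr (T g \<star> \<theta> P) \<cdot> \<sigma> (fob H P) g \<cdot> \<theta> P"
  using assms by (simp add: descent_str0_def descent_functor cmp_assoc fap_cmp[symmetric])

text \<open>
  An arrow \<open>a\<close> and its conjugate under \<open>g\<close> are related by \<open>\<sigma> Q g\<close> and \<open>\<sigma> P g\<close>, and their
  images under \<open>hat\<close> are related in the same way by the structure isomorphisms of \<open>H P\<close> and \<open>H Q\<close>.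
\<close>

lemma descent_str0_natural:
  assumes g [simp]: "g \<in> carrier G" and P [simp]: "P \<in> Obj D" and Q [simp]: "Q \<in> Obj D"
    and a: "a \<in> homs (fst P) (fst Q)"
  shows "descent_str0 g Q \<cdot> descent \<star> T g \<star> a = (T g \<star> descent \<star> a) \<cdot> descent_str0 g P"
proof (rule iso_cancel_right)
  note [simp] = descent_functor homsD[OF a] homsD[OF conj_homs[OF P Q g a]] homsD[OF hat_homs[OF P Q a]]
  have "(descent_str0 g Q \<cdot> descent \<star> T g \<star> a) \<cdot> descent \<star> \<sigma> P g =
      (descent_str0 g Q \<cdot> descent \<star> \<sigma> Q g) \<cdot> descent \<star> conj_act P Q g a"
    by (simp add: cmp_assoc fap_cmp[symmetric] str_conj[OF P Q g a])
  also have "\<dots> = inv_arr (T g \<star> \<theta> Q) \<cdot> (\<sigma> (fob H Q) g \<cdot> conj_act (fob H P) (fob H Q) g (hat P Q a)) \<cdot> \<theta> P"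
    using homsD[OF hat_homs[OF P Q conj_homs[OF P Q g a]]]
    by (simp add: descent_str0_str cmp_assoc theta_natural[OF P Q conj_homs[OF P Q g a]] hat_conj[OF P Q g a])
  also have "\<dots> = (inv_arr (T g \<star> \<theta> Q) \<cdot> T g \<star> hat P Q a) \<cdot> \<sigma> (fob H P) g \<cdot> \<theta> P"
    by (subst str_conj) (simp_all add: hat_homs[OF P Q a] cmp_assoc)
  also have "inv_arr (T g \<star> \<theta> Q) \<cdot> T g \<star> hat P Q a = (T g \<star> descent \<star> a) \<cdot> inv_arr (T g \<star> \<theta> P)"
    by (rule inva_switch) (simp_all add: fap_cmp[symmetric] theta_natural[OF P Q a])
  also have "((T g \<star> descent \<star> a) \<cdot> inv_arr (T g \<star> \<theta> P)) \<cdot> \<sigma> (fob H P) g \<cdot> \<theta> P =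
      ((T g \<star> descent \<star> a) \<cdot> descent_str0 g P) \<cdot> descent \<star> \<sigma> P g"
    by (simp add: cmp_assoc descent_str0_str)
  finally show "(descent_str0 g Q \<cdot> descent \<star> T g \<star> a) \<cdot> descent \<star> \<sigma> P g =
     ((T g \<star> descent \<star> a) \<cdot> descent_str0 g P) \<cdot> descent \<star> \<sigma> P g" .
qed (use a in \<open>simp_all add: descent_functor\<close>)

definition descent_str where
  "descent_str g = extend (descent \<circ>\<^sub>F T g) (T g \<circ>\<^sub>F descent) (descent_str0 g)"

lemma descent_str:
  assumes [simp]: "g \<in> carrier G"
  shows "nat_iso (descent \<circ>\<^sub>F T g) (T g \<circ>\<^sub>F descent) (descent_str g)"
    "P \<in> Obj D \<Longrightarrow> descent_str g (fst P) = descent_str0 g P"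
  unfolding descent_str_def
  by (intro extend; simp add: descent_functor descent_str0_natural)+

text \<open>
  It suffices to compare the two sides at underlying objects. After composing with the structure
  isomorphisms of \<open>P\<close>, both become the structure isomorphism of \<open>H P\<close> at \<open>gh\<close>, transported along \<open>\<theta>\<close>.
\<close>

lemma descent_coherent: "coherent descent descent_str"
  unfolding coherent_def
proof (intro conjI ballI)
  note [simp] = descent_functor
  fix g assume g [simp]: "g \<in> carrier G"
  show "nat_iso (descent \<circ>\<^sub>F T g) (T g \<circ>\<^sub>F descent) (descent_str g)" by (rule descent_str(1)[OF g])
  fix h X assume h [simp]: "h \<in> carrier G" and X: "X \<in> Obj C"
  note [simp] = nat_isoD(1-4)[OF descent_str(1)]
  show "descent_str (g *\<^sub>G h) X \<cdot> descent \<star> eps g h X =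
      eps g h (fob descent X) \<cdot> (T g \<star> descent_str h X) \<cdot> descent_str g (fob (T h) X)"
  proof (rule natural_ext[OF _ _ _ _ _ X])
    show "natural (descent \<circ>\<^sub>F (T g \<circ>\<^sub>F T h)) (T (g *\<^sub>G h) \<circ>\<^sub>F descent)
        (\<lambda>X. descent_str (g *\<^sub>G h) X \<cdot> descent \<star> eps g h X)"
      using nat_iso_vcomp[OF _ _ _ nat_iso_whisker_left[OF _ _ _ eps_nat_iso[OF g h], of descent]
          descent_str(1)[of "g *\<^sub>G h"]]
      by (simp add: nat_iso_def)
    have 1: "nat_iso (descent \<circ>\<^sub>F (T g \<circ>\<^sub>F T h)) (T g \<circ>\<^sub>F (descent \<circ>\<^sub>F T h)) (\<lambda>X. descent_str g (fob (T h) X))"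
      using nat_iso_whisker_right[OF _ descent_str(1)[OF g], of "T h"] by (simp add: comp_fctr_assoc)
    have 2: "nat_iso (T g \<circ>\<^sub>F (descent \<circ>\<^sub>F T h)) (T g \<circ>\<^sub>F T h \<circ>\<^sub>F descent) (\<lambda>X. T g \<star> descent_str h X)"
      using nat_iso_whisker_left[OF _ _ _ descent_str(1)[OF h], of "T g"] by (simp add: comp_fctr_assoc)
    have 3: "nat_iso (T g \<circ>\<^sub>F T h \<circ>\<^sub>F descent) (T (g *\<^sub>G h) \<circ>\<^sub>F descent) (\<lambda>X. eps g h (fob descent X))"
      by (rule nat_iso_whisker_right[OF _ eps_nat_iso[OF g h]]) simp
    show "natural (descent \<circ>\<^sub>F (T g \<circ>\<^sub>F T h)) (T (g *\<^sub>G h) \<circ>\<^sub>F descent)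
        (\<lambda>X. eps g h (fob descent X) \<cdot> (T g \<star> descent_str h X) \<cdot> descent_str g (fob (T h) X))"
      using nat_iso_vcomp[OF _ _ _ nat_iso_vcomp[OF _ _ _ 1 2] 3] by (simp add: nat_iso_def)
    fix P assume P [simp]: "P \<in> Obj D"
    let ?X = "fst P"
    show "descent_str (g *\<^sub>G h) ?X \<cdot> descent \<star> eps g h ?X =
        eps g h (fob descent ?X) \<cdot> (T g \<star> descent_str h ?X) \<cdot> descent_str g (fob (T h) ?X)"
    proof (rule iso_cancel_right)
      let ?k = "(descent \<star> T g \<star> \<sigma> P h) \<cdot> descent \<star> \<sigma> P g"
      have "(descent_str (g *\<^sub>G h) ?X \<cdot> descent \<star> eps g h ?X) \<cdot> ?k =
          descent_str0 (g *\<^sub>G h) P \<cdot> descent \<star> \<sigma> P (g *\<^sub>G h)"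
        by (simp add: descent_str(2) str_mult fap_cmp cmp_assoc)
      also have "\<dots> = inv_arr (T (g *\<^sub>G h) \<star> \<theta> P) \<cdot> \<sigma> (fob H P) (g *\<^sub>G h) \<cdot> \<theta> P"
        by (rule descent_str0_str) simp_all
      also have "\<dots> = (inv_arr (T (g *\<^sub>G h) \<star> \<theta> P) \<cdot> eps g h (cd (\<theta> P))) \<cdot>
          (T g \<star> \<sigma> (fob H P) h) \<cdot> \<sigma> (fob H P) g \<cdot> \<theta> P"
        by (simp add: str_mult cmp_assoc)
      also have "inv_arr (T (g *\<^sub>G h) \<star> \<theta> P) \<cdot> eps g h (cd (\<theta> P)) = eps g h (dm (\<theta> P)) \<cdot> inv_arr (T g \<star> T h \<star> \<theta> P)"
        by (rule inva_switch[OF eps_natural]) simp_all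
      also have "(eps g h (dm (\<theta> P)) \<cdot> inv_arr (T g \<star> T h \<star> \<theta> P)) \<cdot> (T g \<star> \<sigma> (fob H P) h) \<cdot> \<sigma> (fob H P) g \<cdot> \<theta> P =
          eps g h (img ?X) \<cdot> T g \<star> (inv_arr (T h \<star> \<theta> P) \<cdot> \<sigma> (fob H P) h \<cdot> \<theta> P) \<cdot>
          inv_arr (T g \<star> \<theta> P) \<cdot> \<sigma> (fob H P) g \<cdot> \<theta> P"
        by (simp add: fap_cmp fap_inva cmp_assoc)
      also have "\<dots> = eps g h (img ?X) \<cdot> T g \<star> (descent_str h ?X \<cdot> descent \<star> \<sigma> P h) \<cdot>
          (descent_str g (dm (\<sigma> P h)) \<cdot> descent \<star> \<sigma> P g)"
        by (simp add: descent_str(2) descent_str0_str)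
      also have "\<dots> = eps g h (img ?X) \<cdot> (T g \<star> descent_str h ?X) \<cdot>
          (((T g \<circ>\<^sub>F descent) \<star> \<sigma> P h) \<cdot> descent_str g (dm (\<sigma> P h))) \<cdot> descent \<star> \<sigma> P g"
        by (simp add: fap_cmp cmp_assoc)
      also have "((T g \<circ>\<^sub>F descent) \<star> \<sigma> P h) \<cdot> descent_str g (dm (\<sigma> P h)) =
          descent_str g (cd (\<sigma> P h)) \<cdot> (descent \<circ>\<^sub>F T g) \<star> \<sigma> P h"
        by (rule nat_isoD(5)[OF descent_str(1)[OF g], symmetric]) simp
      finally show "(descent_str (g *\<^sub>G h) ?X \<cdot> descent \<star> eps g h ?X) \<cdot> ?k =
          (eps g h (fob descent ?X) \<cdot> (T g \<star> descent_str h ?X) \<cdot> descent_str g (fob (T h) ?X)) \<cdot> ?k"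
        by (simp add: cmp_assoc)
    qed simp_all
  qed simp_all
qed

lemma elift_descent: "endo (with_arrows descent descent_str)" "elift (with_arrows descent descent_str) \<approx>\<^sub>D q"
proof -
  define p where "p = with_arrows descent descent_str"
  have p [simp]: "endo p" and fst_p [simp]: "fst p = descent"
    using endo_with_arrows[OF descent_linear descent_coherent] by (simp_all add: p_def)
  have dlt_p: "dlt p g X = descent_str g X" if "g \<in> carrier G" "X \<in> Obj C" for g X
    using dlt_with_arrows[OF descent_coherent] that by (simp add: p_def)
  note [simp] = lift_functor lift_closed S_closed S_functor endo_elift
  define s where "s P = Arrow (fob (lift p) P) (fob H P) (mp (\<theta> P))" for P
  have [simp]: "dm (s P) = fob (lift p) P" "cd (s P) = fob H P" for P by (simp_all add: s_def)
  have und_s [simp]: "und (s P) = \<theta> P" if "P \<in> Obj D" for P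
    using that by (intro arrow.expand) (simp add: s_def und_def)
  have arr_s [simp]: "arr D (s P)" if [simp]: "P \<in> Obj D" for P
  proof (rule arr_DI)
    fix g assume [simp]: "g \<in> carrier G"
    show "\<sigma> (cd (s P)) g \<cdot> und (s P) = (T g \<star> und (s P)) \<cdot> \<sigma> (dm (s P)) g"
      by (simp add: dlt_p descent_str(2) descent_str0_str)
  qed simp_all
  have "D.nat_iso (lift p) H s"
  proof (rule D.nat_isoI)
    show "D.invertible (s P)" if "P \<in> Obj D" for P using that by (intro iso_DI) simp_all
    fix a assume a: "arr D a"
    have "\<theta> (cd a) \<cdot> descent \<star> und a = und (H \<star> a) \<cdot> \<theta> (dm a)"
      using a theta_natural[of "dm a" "cd a" "und a"] by (simp add: hat_und homsI)
    then show "s (cd a) \<cdot>\<^sub>D lift p \<star> a = (H \<star> a) \<cdot>\<^sub>D s (dm a)"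
      using a by (intro und_eqI) simp_all
  qed simp_all
  moreover have "(S \<chi> \<star> s P) \<cdot>\<^sub>D D.dlt (elift p) \<chi> P = \<delta> \<chi> P \<cdot>\<^sub>D s (fob (S \<chi>) P)"
    if "\<chi> \<in> carrier DG" "P \<in> Obj D" for \<chi> P
    using that by (intro und_eqI) (simp_all add: dlt_elift lift_S theta_S)
  ultimately have "elift p \<approx>\<^sub>D q"
    by (intro D.isomorphicI[of _ _ s] D.intertwinesI) simp_all
  then show "endo (with_arrows descent descent_str)" "elift (with_arrows descent descent_str) \<approx>\<^sub>D q"
    using p unfolding p_def by blast+
qed

end


section \<open>The equivariantization isomorphism\<close>

context equivariantization_setting begin

lemma elift_surjective:
  assumes "D.endo q"
  shows "\<exists>p. endo p \<and> elift p \<approx>\<^sub>D q"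
proof -
  interpret dual_endofunctor K C G A q
    by unfold_locales (rule assms)
  show ?thesis using elift_descent by blast
qed

abbreviation comp_D (infixl \<open>\<diamondop>\<^sub>D\<close> 65) where "p \<diamondop>\<^sub>D q \<equiv> eq_comp D DA p q"

lemma elift_inverse:
  assumes pr: "p \<diamondop> r \<approx> one_endo" and [simp]: "endo p" "endo r"
  shows "elift p \<diamondop>\<^sub>D elift r \<approx>\<^sub>D D.one_endo"
  using D.isomorphic_trans[OF D.isomorphic_sym[OF elift_comp] D.isomorphic_trans[OF elift_cong[OF pr] elift_one]]
  by simp

lemma elift_autos:
  assumes p: "p \<in> autos"
  shows "elift p \<in> D.autos"
proof -
  have [simp]: "endo p" using p by (simp add: autos_def)
  obtain r where [simp]: "endo r" and r: "p \<diamondop> r \<approx> one_endo" "r \<diamondop> p \<approx> one_endo"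
    using equivariant_inverse[of p] p by (auto simp: autos_def)
  have "autoequivalence D (fst (elift p))"
    by (rule D.autoequivalence_if_inverse[OF elift_inverse[OF r(1)] elift_inverse[OF r(2)]])
      (simp_all add: endo_elift)
  then show ?thesis by (simp add: D.autos_def endo_elift)
qed

text \<open>
  An inverse of the lift is itself isomorphic to a lift, say of \<open>r\<close>; by injectivity, \<open>r\<close> is an inverse
  of \<open>p\<close>.
\<close>

lemma autos_if_elift:
  assumes p [simp]: "endo p" and a: "elift p \<in> D.autos"
  shows "p \<in> autos"
proof -
  obtain s where s [simp]: "D.endo s" and ps: "elift p \<diamondop>\<^sub>D s \<approx>\<^sub>D D.one_endo" "s \<diamondop>\<^sub>D elift p \<approx>\<^sub>D D.one_endo"
    using D.equivariant_inverse[of "elift p"] a by (auto simp: D.autos_def)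
  obtain r where r [simp]: "endo r" and rs: "elift r \<approx>\<^sub>D s" using elift_surjective[OF s] by blast
  note [trans] = D.isomorphic_trans
  have refl: "elift p \<approx>\<^sub>D elift p" by (rule D.isomorphic_refl) (simp add: endo_elift)
  have "elift (p \<diamondop> r) \<approx>\<^sub>D elift p \<diamondop>\<^sub>D elift r" by (simp add: elift_comp)
  also have "elift p \<diamondop>\<^sub>D elift r \<approx>\<^sub>D elift p \<diamondop>\<^sub>D s" by (rule D.comp_endo_cong[OF refl rs])
  also note ps(1)
  also have "D.one_endo \<approx>\<^sub>D elift one_endo" by (rule D.isomorphic_sym[OF elift_one])
  finally have 1: "p \<diamondop> r \<approx> one_endo" by (intro elift_reflects_isomorphic) simp_all
  have "elift (r \<diamondop> p) \<approx>\<^sub>D elift r \<diamondop>\<^sub>D elift p" by (simp add: elift_comp)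
  also have "elift r \<diamondop>\<^sub>D elift p \<approx>\<^sub>D s \<diamondop>\<^sub>D elift p" by (rule D.comp_endo_cong[OF rs refl])
  also note ps(2)
  also have "D.one_endo \<approx>\<^sub>D elift one_endo" by (rule D.isomorphic_sym[OF elift_one])
  finally have 2: "r \<diamondop> p \<approx> one_endo" by (intro elift_reflects_isomorphic) simp_all
  show ?thesis using autoequivalence_if_inverse[OF 1 2] by (simp add: autos_def)
qed

abbreviation "\<Phi> \<equiv> equivariantization_hom K C G A"

lemma equivariantization_hom_cls:
  assumes p: "p \<in> autos"
  shows "\<Phi> \<langle>p\<rangle> = D.cls (elift p)"
  unfolding equivariantization_hom_def
proof (rule UN_cls_eq[OF p])
  fix p' assume "p' \<in> \<langle>p\<rangle>"
  then have "p' \<in> autos" "p \<approx> p'" using mem_cls[OF p] by blast+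
  then show "D.cls (elift p') = D.cls (elift p)"
    using p by (subst D.cls_eq_iff) (auto intro: elift_autos elift_cong isomorphic_sym)
qed

lemma equivariantization_iso: "\<Phi> \<in> iso (Aut K C G A) (Aut K D DG DA)"
proof -
  have endo: "endo p" if "p \<in> autos" for p using that by (simp add: autos_def)
  have "\<Phi> \<in> hom (Aut K C G A) (Aut K D DG DA)"
  proof (rule homI)
    fix x assume "x \<in> carrier (Aut K C G A)"
    then obtain p where p: "p \<in> autos" and x: "x = \<langle>p\<rangle>" by (auto simp: carrier_Aut)
    show "\<Phi> x \<in> carrier (Aut K D DG DA)"
      unfolding x equivariantization_hom_cls[OF p] by (rule D.cls_closed[OF elift_autos[OF p]])
    fix y assume "y \<in> carrier (Aut K C G A)"
    then obtain r where r: "r \<in> autos" and y: "y = \<langle>r\<rangle>" by (auto simp: carrier_Aut)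
    show "\<Phi> (x \<otimes>\<^bsub>Aut K C G A\<^esub> y) = \<Phi> x \<otimes>\<^bsub>Aut K D DG DA\<^esub> \<Phi> y"
      unfolding x y mult_Aut[OF p r] equivariantization_hom_cls[OF p] equivariantization_hom_cls[OF r]
        equivariantization_hom_cls[OF autos_comp[OF p r]] D.mult_Aut[OF elift_autos[OF p] elift_autos[OF r]]
      using p r by (subst D.cls_eq_iff) (auto intro: elift_autos autos_comp D.autos_comp elift_comp endo)
  qed
  moreover have "bij_betw \<Phi> (carrier (Aut K C G A)) (carrier (Aut K D DG DA))"
  proof (rule bij_betwI')
    fix x y assume "x \<in> carrier (Aut K C G A)" "y \<in> carrier (Aut K C G A)"
    then obtain p r where p: "p \<in> autos" and x: "x = \<langle>p\<rangle>" and r: "r \<in> autos" and y: "y = \<langle>r\<rangle>"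
      by (auto simp: carrier_Aut)
    have "D.cls (elift p) = D.cls (elift r) \<longleftrightarrow> elift p \<approx>\<^sub>D elift r"
      by (rule D.cls_eq_iff[OF elift_autos[OF p] elift_autos[OF r]])
    also have "\<dots> \<longleftrightarrow> p \<approx> r"
      using elift_cong elift_reflects_isomorphic endo p r by blast
    also have "\<dots> \<longleftrightarrow> \<langle>p\<rangle> = \<langle>r\<rangle>" by (rule cls_eq_iff[OF p r, symmetric])
    finally show "\<Phi> x = \<Phi> y \<longleftrightarrow> x = y"
      unfolding x y equivariantization_hom_cls[OF p] equivariantization_hom_cls[OF r] .
    show "\<Phi> x \<in> carrier (Aut K D DG DA)"
      unfolding x equivariantization_hom_cls[OF p] by (rule D.cls_closed[OF elift_autos[OF p]])
  next
    fix y assume "y \<in> carrier (Aut K D DG DA)"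
    then obtain q where q: "q \<in> D.autos" and y: "y = D.cls q" by (auto simp: D.carrier_Aut)
    then have "D.endo q" by (simp add: D.autos_def)
    then obtain p where p: "endo p" and pq: "elift p \<approx>\<^sub>D q" using elift_surjective by blast
    have "elift p \<in> D.autos" using D.autos_cong[OF q] D.isomorphic_sym[OF pq] by blast
    then have "p \<in> autos" using autos_if_elift p by blast
    then show "\<exists>x \<in> carrier (Aut K C G A). y = \<Phi> x"
      using pq q \<open>elift p \<in> D.autos\<close> unfolding y
      by (intro bexI[of _ "\<langle>p\<rangle>"] cls_closed)
        (simp_all add: equivariantization_hom_cls D.cls_eq_iff D.isomorphic_sym)
  qed
  ultimately show ?thesis by (simp add: iso_def)
qed

end

theorem theorem5p3:
  fixes K :: "('k, 'e) ring_scheme"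
    and G :: "('g, 'f) monoid_scheme"
    and C :: "('k, 'o, 'm) lin_cat"
    and A :: "('g, 'o, 'm) cat_action"
  assumes "field K"
    and "comm_group G" and "finite (carrier G)" and "splits_over K G"
    and "additive_linear_category K C" and "idempotent_complete C"
    and "linear_action K C G A"
  shows "let CG = equivariantization C G A;
             DG = dual_group K G;
             DA = dual_action K C G A;
             \<Phi> = equivariantization_hom K C G A
         in group (Aut K C G A) \<and> group (Aut K CG DG DA) \<and>
            (\<forall>p \<in> eq_autoequivalences K C G A.
               eq_lift C G A p \<in> eq_autoequivalences K CG DG DA \<and>
               \<Phi> (eq_class K C G A p) = eq_class K CG DG DA (eq_lift C G A p)) \<and>
            \<Phi> \<in> iso (Aut K C G A) (Aut K CG DG DA)"
proof -
  interpret additive_linear_category K C by fact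
  interpret G: comm_group G by fact
  interpret equivariantization_setting K C G A
    by unfold_locales (use assms in auto)
  show ?thesis
    unfolding Let_def eq_autoequivalences_eq D.eq_autoequivalences_eq
    using group_Aut D.group_Aut elift_autos equivariantization_hom_cls equivariantization_iso by blast
qed

end
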